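(* Every commutative Polish group is Brown subordinate to the Hilbert space; that is, if $G$ is a commutative Polish group and $\Delta$ is a separable infinite-dimensional real Hilbert space (regarded as an additive topological group with the norm topology), then every noise that has a faithful continuous representation in $G$ necessarily has a faithful continuous representation in $\Delta$.
   Context: Every probability space is assumed to be a Lebesgue space (in the sense of Rokhlin), and every $\sigma$-field contains all sets of probability zero ("generated" is understood accordingly). A noise consists of a probability space $(\Omega,\mathcal F,P)$, a one-parameter group $(T_t)_{t\in\mathbb R}$ of measure preserving transformations $T_t:\Omega\to\Omega$, and a two-parameter family of sub-$\sigma$-fields $\mathcal F_{s,t}\subset\mathcal F$ for $-\infty<s\le t<\infty$, such that for all $r,s,t$: (a) $T_t$ sends $\mathcal F_{r,s}$ onto $\mathcal F_{r+t,s+t}$ ($r\le s$); (b) $\mathcal F_{r,s}$ and $\mathcal F_{s,t}$ are independent ($r\le s\le t$); (c) $\mathcal F_{r,s}$ and $\mathcal F_{s,t}$, taken together, generate $\mathcal F_{r,t}$ ($r\le s\le t$). (Here $T_t$ sends a set $A$ to $T_t^{-1}(A)$ and a random variable $f$ to $f\circ T_t$.) A Polish group is a metrizable topological group that is separable and complete in a (equivalently any) metric $\rho_{\rm left}+\rho_{\rm right}$, the sum of a left-invariant and a right-invariant compatible metric. A $G$-valued random variable is an equivalence class (equality almost everywhere) of measurable maps $\Omega\to G$. A representation of a noise in a Polish group $G$ is a two-parameter family of $G$-valued random variables $X_{s,t}$, $-\infty<s\le t<\infty$, such that for all $r,s,t$: (a) $T_t$ sends $X_{r,s}$ to $X_{r+t,s+t}$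 ($r\le s$); (b) $X_{s,t}$ is $\mathcal F_{s,t}$-measurable ($s\le t$); (c) $X_{s,t}X_{r,s}=X_{r,t}$ ($r\le s\le t$; group operation of $G$); and for each neighborhood $U$ of the unit of $G$: (d) $P(X_{0,t}\in U)\to1$ as $t\to0+$. The representation is continuous if for each such $U$, $\frac1tP(X_{0,t}\notin U)\to0$ as $t\to0+$. It is faithful if for each $t\ge0$ the $\sigma$-field $\mathcal F_{0,t}$ is generated by the random variables $X_{0,s}$, $s\in[0,t]$. For Polish groups $G_1,G_2$: $G_1$ is Brown subordinate to $G_2$ if every noise that has a faithful continuous representation in $G_1$ has a faithful continuous representation in $G_2$. *)

theory Defs
  imports "HOL-Probability.Probability"
begin

section \<open>Polish groups\<close>

text \<open>Groups are written additively; \<^class>\<open>topological_group_add\<close> does not assume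
  commutativity.\<close>

definition (in topological_space) compatible_metric :: "('a \<Rightarrow> 'a \<Rightarrow> real) \<Rightarrow> bool" where
  "compatible_metric d \<longleftrightarrow> Metric_space UNIV d \<and> Metric_space.mtopology UNIV d = topology open"

definition (in plus) left_invariant :: "('a \<Rightarrow> 'a \<Rightarrow> real) \<Rightarrow> bool" where
  "left_invariant d \<longleftrightarrow> (\<forall>g x y. d (g + x) (g + y) = d x y)"

definition (in plus) right_invariant :: "('a \<Rightarrow> 'a \<Rightarrow> real) \<Rightarrow> bool" where
  "right_invariant d \<longleftrightarrow> (\<forall>g x y. d (x + g) (y + g) = d x y)"

class polish_group = topological_group_add +
  assumes separable: "separable_space (topology open)"
    and complete_left_plus_right:
      "\<exists>dl dr :: 'a \<Rightarrow> 'a \<Rightarrow> real.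
         compatible_metric dl \<and> left_invariant dl \<and>
         compatible_metric dr \<and> right_invariant dr \<and>
         Metric_space.mcomplete UNIV (\<lambda>x y. dl x y + dr x y)"

instance polish_group \<subseteq> second_countable_topology
proof
  obtain d :: "'a \<Rightarrow> 'a \<Rightarrow> real" where d: "compatible_metric d"
    using complete_left_plus_right by blast
  interpret Metric_space UNIV d
    using d by (simp add: compatible_metric_def)
  have top: "mtopology = euclidean"
    using d by (simp add: compatible_metric_def)
  obtain D :: "'a set" where D: "countable D" "closure D = UNIV"
    using separable by (auto simp: separable_space_def)
  define B where "B = (\<lambda>(x, n::nat). mball x (inverse (real (Suc n)))) ` (D \<times> UNIV)"
  have opB: "open (mball x r)" for x r
    using openin_mball[of x r] unfolding top by simp
  have "topological_basis B"
  proof (rule topological_basisI)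
    fix b assume "b \<in> B"
    then show "open b" using opB by (auto simp: B_def)
  next
    fix U :: "'a set" and x assume U: "open U" and x: "x \<in> U"
    have "openin mtopology U" using U top by simp
    then obtain r where r: "r > 0" "mball x r \<subseteq> U"
      using x unfolding openin_mtopology by blast
    obtain n where n: "inverse (real (Suc n)) < r / 2"
      using reals_Archimedean[of "r / 2"] r by auto
    have "x \<in> closure D" using D by simp
    moreover have "x \<in> mball x (inverse (real (Suc n)))" by simp
    ultimately have "D \<inter> mball x (inverse (real (Suc n))) \<noteq> {}"
      using open_Int_closure_eq_empty[OF opB, of x "inverse (real (Suc n))" D] by blast
    then obtain y where y: "y \<in> D" "y \<in> mball x (inverse (real (Suc n)))" by blast
    have "mball y (inverse (real (Suc n))) \<subseteq> mball x r"
    proof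
      fix z assume "z \<in> mball y (inverse (real (Suc n)))"
      then have "d y z < inverse (real (Suc n))" "d x y < inverse (real (Suc n))"
        using y by auto
      moreover have "d x z \<le> d x y + d y z" by (rule triangle) auto
      ultimately show "z \<in> mball x r" using n by simp
    qed
    moreover have "x \<in> mball y (inverse (real (Suc n)))" using y by (simp add: commute)
    moreover have "mball y (inverse (real (Suc n))) \<in> B" using y by (auto simp: B_def)
    ultimately show "\<exists>b\<in>B. x \<in> b \<and> b \<subseteq> U" using r by blast
  qed
  moreover have "countable B" using D by (simp add: B_def)
  ultimately show "\<exists>B::'a set set. countable B \<and> open = generate_topology B"
    using topological_basis_imp_subbasis by blast
qed

class separable_hilbert = real_inner + polish_space

lemma compatible_metric_dist: "compatible_metric (dist :: 'a::metric_space \<Rightarrow> 'a \<Rightarrow> real)"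
  by (simp add: compatible_metric_def Met_TC.Metric_space_axioms)

instance separable_hilbert \<subseteq> polish_group
proof
  obtain D :: "'a set" where "countable D"
    and D: "\<forall>X. open X \<longrightarrow> X \<noteq> {} \<longrightarrow> (\<exists>d\<in>D. d \<in> X)"
    using countable_dense_exists by blast
  have "- closure D = {}"
  proof (rule ccontr)
    assume "- closure D \<noteq> {}"
    then obtain d where "d \<in> D" "d \<in> - closure D" using D by blast
    then show False using closure_subset by blast
  qed
  then have "closure D = UNIV" by blast
  with \<open>countable D\<close> show "separable_space (euclidean :: 'a topology)"
    by (auto simp: separable_space_def)
  let ?d = "dist :: 'a \<Rightarrow> 'a \<Rightarrow> real"
  let ?s = "\<lambda>x y. ?d x y + ?d x y"
  have M: "Metric_space UNIV ?s"
  proof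
    fix x y z :: 'a
    show "?s x z \<le> ?s x y + ?s y z" using dist_triangle[of x z y] by linarith
  qed (auto simp: dist_commute)
  have "Metric_space.mcomplete UNIV ?s"
    unfolding Metric_space.mcomplete_def[OF M]
  proof (intro allI impI)
    fix \<sigma> :: "nat \<Rightarrow> 'a" assume C: "Metric_space.MCauchy UNIV ?s \<sigma>"
    have "Cauchy \<sigma>"
    proof (rule metric_CauchyI)
      fix e :: real assume "e > 0"
      then obtain N where N: "\<And>n m. N \<le> n \<Longrightarrow> N \<le> m \<Longrightarrow> ?s (\<sigma> n) (\<sigma> m) < e"
        using C unfolding Metric_space.MCauchy_def[OF M] by blast
      have "?d (\<sigma> m) (\<sigma> n) < e" if "m \<ge> N" "n \<ge> N" for m n
        using N[OF that] zero_le_dist[of "\<sigma> m" "\<sigma> n"] by linarith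
      then show "\<exists>N. \<forall>m\<ge>N. \<forall>n\<ge>N. ?d (\<sigma> m) (\<sigma> n) < e" by blast
    qed
    then obtain x where x: "\<sigma> \<longlonglongrightarrow> x"
      using Cauchy_convergent convergent_def by blast
    have "limitin (Metric_space.mtopology UNIV ?s) \<sigma> x sequentially"
      unfolding Metric_space.limitin_metric[OF M]
    proof (intro conjI allI impI)
      fix e :: real assume "e > 0"
      then have "\<forall>\<^sub>F n in sequentially. ?d (\<sigma> n) x < e / 2"
        using x by (intro tendstoD) auto
      then show "\<forall>\<^sub>F n in sequentially. \<sigma> n \<in> UNIV \<and> ?s (\<sigma> n) x < e"
        by eventually_elim auto
    qed simp
    then show "\<exists>x. limitin (Metric_space.mtopology UNIV ?s) \<sigma> x sequentially" by blast
  qed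
  moreover have "left_invariant ?d" "right_invariant ?d"
    by (auto simp: left_invariant_def right_invariant_def dist_norm)
  ultimately show "\<exists>dl dr :: 'a \<Rightarrow> 'a \<Rightarrow> real.
         compatible_metric dl \<and> left_invariant dl \<and>
         compatible_metric dr \<and> right_invariant dr \<and>
         Metric_space.mcomplete UNIV (\<lambda>x y. dl x y + dr x y)"
    using compatible_metric_dist by blast
qed

section \<open>Lebesgue spaces\<close>

text \<open>Since \<open>f\<close> is a bijection, the last clause makes it bimeasurable and measure preserving.\<close>

definition isomorphic_mod_0 :: "'a measure \<Rightarrow> 'b measure \<Rightarrow> bool" where
  "isomorphic_mod_0 M N \<longleftrightarrow>
     (\<exists>A\<in>null_sets M. \<exists>B\<in>null_sets N. \<exists>f.
        bij_betw f (space M - A) (space N - B) \<and>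
        (\<forall>E \<subseteq> space M - A.
           (E \<in> sets M \<longleftrightarrow> f ` E \<in> sets N) \<and> emeasure M E = emeasure N (f ` E)))"

text \<open>A Lebesgue probability space is a complete one which, apart from countably many atoms, is
  isomorphic mod 0 to an interval with Lebesgue measure. The interval is a single point, of
  measure zero, if the space is purely atomic.\<close>

definition lebesgue_prob_space :: "'w measure \<Rightarrow> bool" where
  "lebesgue_prob_space M \<longleftrightarrow> prob_space M \<and> complete_measure M \<and>
     (\<exists>C \<subseteq> space M. countable C \<and> (\<forall>x\<in>C. {x} \<in> sets M \<and> measure M {x} > 0) \<and>
        isomorphic_mod_0 (restrict_space M (space M - C))
          (lebesgue_on {0 .. measure M (space M - C)}))"

section \<open>Noises\<close>

text \<open>Every sub-\<open>\<sigma>\<close>-field contains all null sets, so "generated" means generated together with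
  the null sets.\<close>

definition generated_field :: "'w measure \<Rightarrow> 'w set set \<Rightarrow> 'w set set" where
  "generated_field M S = sigma_sets (space M) (S \<union> null_sets M)"

text \<open>The image of the \<open>\<sigma>\<close>-field \<open>A\<close> under the map that sends a set \<open>E\<close> to its preimage under
  \<open>\<tau>\<close>; like every \<open>\<sigma>\<close>-field of the theory it is understood mod 0.\<close>

definition field_sent_by :: "'w measure \<Rightarrow> ('w \<Rightarrow> 'w) \<Rightarrow> 'w measure \<Rightarrow> 'w set set" where
  "field_sent_by M \<tau> A = {B \<in> sets M. \<exists>E\<in>sets A. AE \<omega> in M. \<omega> \<in> B \<longleftrightarrow> \<tau> \<omega> \<in> E}"

text \<open>Transformations of a Lebesgue space, like random variables, are identified when they are
  equal almost everywhere, so the group law is required almost everywhere (for each pair of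
  times). This includes the case where it holds everywhere.\<close>

definition measure_preserving_flow :: "'w measure \<Rightarrow> (real \<Rightarrow> 'w \<Rightarrow> 'w) \<Rightarrow> bool" where
  "measure_preserving_flow M T \<longleftrightarrow>
     (\<forall>t. T t \<in> M \<rightarrow>\<^sub>M M \<and> distr M M (T t) = M) \<and>
     (AE \<omega> in M. T 0 \<omega> = \<omega>) \<and>
     (\<forall>s t. AE \<omega> in M. T (s + t) \<omega> = T s (T t \<omega>))"

definition noise ::
  "'w measure \<Rightarrow> (real \<Rightarrow> 'w \<Rightarrow> 'w) \<Rightarrow> (real \<Rightarrow> real \<Rightarrow> 'w measure) \<Rightarrow> bool" where
  "noise M T F \<longleftrightarrow>
     lebesgue_prob_space M \<and>
     measure_preserving_flow M T \<and>
     (\<forall>s t. s \<le> t \<longrightarrow> subalgebra M (F s t) \<and> null_sets M \<subseteq> sets (F s t)) \<and>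
     (\<forall>r s t. r \<le> s \<longrightarrow> field_sent_by M (T t) (F r s) = sets (F (r + t) (s + t))) \<and>
     (\<forall>r s t. r \<le> s \<longrightarrow> s \<le> t \<longrightarrow>
        prob_space.indep_set M (sets (F r s)) (sets (F s t))) \<and>
     (\<forall>r s t. r \<le> s \<longrightarrow> s \<le> t \<longrightarrow>
        sets (F r t) = generated_field M (sets (F r s) \<union> sets (F s t)))"

section \<open>Representations\<close>

text \<open>Random variables are given by representatives of their classes; all conditions below depend
  only on the classes. Neighbourhoods of the unit may be taken open, since the conditions on
  probabilities are monotone in \<open>U\<close>.\<close>

definition representation ::
  "'w measure \<Rightarrow> (real \<Rightarrow> 'w \<Rightarrow> 'w) \<Rightarrow> (real \<Rightarrow> real \<Rightarrow> 'w measure) \<Rightarrow>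
     (real \<Rightarrow> real \<Rightarrow> 'w \<Rightarrow> 'g::polish_group) \<Rightarrow> bool" where
  "representation M T F X \<longleftrightarrow>
     (\<forall>r s t. r \<le> s \<longrightarrow> (AE \<omega> in M. X r s (T t \<omega>) = X (r + t) (s + t) \<omega>)) \<and>
     (\<forall>s t. s \<le> t \<longrightarrow> X s t \<in> F s t \<rightarrow>\<^sub>M borel) \<and>
     (\<forall>r s t. r \<le> s \<longrightarrow> s \<le> t \<longrightarrow> (AE \<omega> in M. X s t \<omega> + X r s \<omega> = X r t \<omega>)) \<and>
     (\<forall>U. open U \<longrightarrow> 0 \<in> U \<longrightarrow>
        ((\<lambda>t. measure M {\<omega> \<in> space M. X 0 t \<omega> \<in> U}) \<longlongrightarrow> 1) (at_right 0))"

definition continuous_representation ::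
  "'w measure \<Rightarrow> (real \<Rightarrow> 'w \<Rightarrow> 'w) \<Rightarrow> (real \<Rightarrow> real \<Rightarrow> 'w measure) \<Rightarrow>
     (real \<Rightarrow> real \<Rightarrow> 'w \<Rightarrow> 'g::polish_group) \<Rightarrow> bool" where
  "continuous_representation M T F X \<longleftrightarrow> representation M T F X \<and>
     (\<forall>U. open U \<longrightarrow> 0 \<in> U \<longrightarrow>
        ((\<lambda>t. 1 / t * measure M {\<omega> \<in> space M. X 0 t \<omega> \<notin> U}) \<longlongrightarrow> 0) (at_right 0))"

definition faithful_representation ::
  "'w measure \<Rightarrow> (real \<Rightarrow> 'w \<Rightarrow> 'w) \<Rightarrow> (real \<Rightarrow> real \<Rightarrow> 'w measure) \<Rightarrow>
     (real \<Rightarrow> real \<Rightarrow> 'w \<Rightarrow> 'g::polish_group) \<Rightarrow> bool" where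
  "faithful_representation M T F X \<longleftrightarrow> representation M T F X \<and>
     (\<forall>t\<ge>0. sets (F 0 t) =
        generated_field M {X 0 s -` B \<inter> space M | s B. s \<in> {0..t} \<and> B \<in> sets borel})"

text \<open>The first argument fixes the type of sample points of the noises considered.\<close>

definition brown_subordinate ::
  "'w itself \<Rightarrow> 'g1::polish_group itself \<Rightarrow> 'g2::polish_group itself \<Rightarrow> bool" where
  "brown_subordinate _ _ _ \<longleftrightarrow>
     (\<forall>(M :: 'w measure) T F. noise M T F \<longrightarrow>
        (\<exists>X :: real \<Rightarrow> real \<Rightarrow> 'w \<Rightarrow> 'g1.
           continuous_representation M T F X \<and> faithful_representation M T F X) \<longrightarrow>
        (\<exists>Y :: real \<Rightarrow> real \<Rightarrow> 'w \<Rightarrow> 'g2.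
           continuous_representation M T F Y \<and> faithful_representation M T F Y))"

end

theory Submission
  imports Defs
begin

text \<open>
  Let \<open>X\<close> be a representation in the commutative group \<open>G\<close> and \<open>f\<close> a bounded Lipschitz function on \<open>G\<close>.
  By commutativity the conditional expectations of \<open>f (X s (s + \<epsilon>))\<close> given \<open>F u v\<close>, \<open>s \<le> u \<le> v \<le> s + \<epsilon>\<close>, are
  functions of the increments \<open>X u v\<close> that depend only on the length of the interval. Summing their
  centred versions over finer and finer partitions gives a decreasing sequence of projections, whose
  \<open>L\<^sup>2\<close> limit \<open>Y\<close>, the first chaos component, is additive and stationary; over an interval of length
  \<open>h\<close> it approximates the conditional expectation with squared error \<open>o(h)\<close>. Continuity of \<open>X\<close> and
  the Lipschitz property make \<open>Y\<close> continuous.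

  The functionals \<open>Y\<close> generate the noise. Split \<open>[0, s]\<close> into \<open>n\<close> blocks of length \<open>h\<close> and replace,
  one block after the other, the field of the block by the one generated by the functionals \<open>Y\<close>.
  The conditional expectation of \<open>f (X 0 (s + \<epsilon>))\<close> changes by orthogonal steps. Commutativity lets
  the piece \<open>[s, s + \<epsilon>]\<close> be thought of as adjacent to the block, so each step has squared norm
  \<open>o(h)\<close> and their total tends to \<open>0\<close>; finally \<open>\<epsilon>\<close> tends to \<open>0\<close>.

  Countably many functionals \<open>Y\<close> suffice, and suitably scaled they are the coordinates of a process
  in the Hilbert space.
\<close>

section \<open>Square integrable functions\<close>

text \<open>The error \<open>o(h)\<close> is obtained for each fixed shift \<open>b\<close> of the
  test function, but on a block the shift is \<open>b - W\<close>, where \<open>W\<close> collects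
  the increments outside the block and is random. The functionals \<open>Y \<epsilon> c\<close> are
  chosen separately for every \<open>c\<close>, so a random \<open>c\<close> cannot simply be
  inserted, and no rate uniform in \<open>c\<close> is at hand. Therefore the shift is rounded to a
  countable dense sequence. The difference of the families for two nearby shifts is again coherent,
  so rounding with accuracy \<open>\<delta>\<close> costs a multiple of
  \<open>\<delta>\<^sup>2 * h / \<epsilon>\<close> per block, which can be summed over all blocks.
  The rates are averaged over \<open>W\<close>, whose law is the same for every block, by dominated
  convergence; the dominating bound is linear in \<open>h\<close> with a constant uniform in the
  shift. The extra piece of length \<open>\<epsilon>\<close> is present because coherence holds only
  within length \<open>\<epsilon>\<close>: a part of length \<open>h\<close> is lent to the block,
  which leaves outside increments of total length exactly \<open>s\<close>, and the other
  \<open>\<epsilon> - h\<close> smooths the test function.\<close>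

definition L2 :: "'a measure \<Rightarrow> 'a measure \<Rightarrow> ('a \<Rightarrow> real) set" where
  "L2 M N = {f \<in> borel_measurable N. integrable M (\<lambda>x. (f x)\<^sup>2)}"

text \<open>Members of \<open>L2 M N\<close> are functions, not classes; \<open>N\<close>
  contributes only its sigma-field, and all integrals are taken under \<open>M\<close>. Norms and
  distances are kept squared, so that orthogonality appears as plain additivity.\<close>

abbreviation sq_norm :: "'a measure \<Rightarrow> ('a \<Rightarrow> real) \<Rightarrow> real" where
  "sq_norm M f \<equiv> \<integral>x. (f x)\<^sup>2 \<partial>M"

abbreviation sq_dist :: "'a measure \<Rightarrow> ('a \<Rightarrow> real) \<Rightarrow> ('a \<Rightarrow> real) \<Rightarrow> real" where
  "sq_dist M f g \<equiv> \<integral>x. (f x - g x)\<^sup>2 \<partial>M"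

abbreviation L2_inner :: "'a measure \<Rightarrow> ('a \<Rightarrow> real) \<Rightarrow> ('a \<Rightarrow> real) \<Rightarrow> real" where
  "L2_inner M f g \<equiv> \<integral>x. f x * g x \<partial>M"

lemma L2_measurable: "f \<in> L2 M N \<Longrightarrow> f \<in> borel_measurable N"
  by (simp add: L2_def)

lemma L2_square: "f \<in> L2 M N \<Longrightarrow> integrable M (\<lambda>x. (f x)\<^sup>2)"
  by (simp add: L2_def)

lemma L2_mono: "subalgebra N N' \<Longrightarrow> f \<in> L2 M N' \<Longrightarrow> f \<in> L2 M N"
  by (auto simp: L2_def intro: measurable_from_subalg)

lemma L2_integrable_mult:
  assumes "f \<in> L2 M M" "g \<in> L2 M M"
  shows "integrable M (\<lambda>x. f x * g x)"
proof (rule Bochner_Integration.integrable_bound)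
  show "integrable M (\<lambda>x. (f x)\<^sup>2 + (g x)\<^sup>2)"
    using assms by (intro Bochner_Integration.integrable_add) (auto simp: L2_def)
  show "(\<lambda>x. f x * g x) \<in> borel_measurable M"
    using assms by (auto simp: L2_def)
  have "\<bar>a * b\<bar> \<le> a\<^sup>2 + b\<^sup>2" for a b :: real
  proof -
    have "0 \<le> (\<bar>a\<bar> - \<bar>b\<bar>)\<^sup>2 + a\<^sup>2 + b\<^sup>2" by simp
    then show ?thesis by (simp add: power2_diff abs_mult)
  qed
  then show "AE x in M. norm (f x * g x) \<le> norm ((f x)\<^sup>2 + (g x)\<^sup>2)"
    by auto
qed

lemma L2_const [simp]: "finite_measure M \<Longrightarrow> (\<lambda>x. c) \<in> L2 M N"
  by (simp add: L2_def finite_measure.integrable_const)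

lemma L2_cmult: "f \<in> L2 M N \<Longrightarrow> (\<lambda>x. c * f x) \<in> L2 M N"
  by (auto simp: L2_def power_mult_distrib)

lemma L2_add:
  assumes "subalgebra M N" "f \<in> L2 M N" "g \<in> L2 M N"
  shows "(\<lambda>x. f x + g x) \<in> L2 M N"
proof -
  have "f \<in> L2 M M" "g \<in> L2 M M" using assms by (auto intro: L2_mono)
  then have "integrable M (\<lambda>x. (f x)\<^sup>2 + 2 * (f x * g x) + (g x)\<^sup>2)"
    by (intro Bochner_Integration.integrable_add integrable_mult_right L2_integrable_mult L2_square)
  then show ?thesis
    using assms by (auto simp: L2_def power2_sum algebra_simps)
qed

lemma L2_diff:
  assumes "subalgebra M N" "f \<in> L2 M N" "g \<in> L2 M N"
  shows "(\<lambda>x. f x - g x) \<in> L2 M N"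
  using L2_add[OF assms(1,2) L2_cmult[OF assms(3), of "-1"]] by simp

lemma L2_sum:
  assumes "finite_measure M" "subalgebra M N" "\<And>i. i \<in> I \<Longrightarrow> f i \<in> L2 M N"
  shows "(\<lambda>x. \<Sum>i\<in>I. f i x) \<in> L2 M N"
proof (cases "finite I")
  case True
  then show ?thesis using assms
    by (induction I rule: finite_induct) (auto intro: L2_add)
qed (use assms in auto)

lemma (in finite_measure) L2_bounded:
  assumes "subalgebra M N" "f \<in> borel_measurable N" "\<And>x. x \<in> space M \<Longrightarrow> \<bar>f x\<bar> \<le> B"
  shows "f \<in> L2 M N"
proof -
  have [measurable]: "f \<in> borel_measurable M"
    using assms measurable_from_subalg by blast
  have "integrable M (\<lambda>x. (f x)\<^sup>2)"
  proof (rule integrable_const_bound[where B="B\<^sup>2"])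
    show "AE x in M. norm ((f x)\<^sup>2) \<le> B\<^sup>2"
      using assms(3) by (intro AE_I2) (simp, metis abs_ge_zero power2_abs power_mono)
  qed simp
  then show ?thesis using assms by (simp add: L2_def)
qed

lemma L2_AE_cong:
  assumes "f \<in> L2 M M" "g \<in> borel_measurable M" "AE x in M. f x = g x"
  shows "g \<in> L2 M M"
proof -
  have "integrable M (\<lambda>x. (f x)\<^sup>2) \<longleftrightarrow> integrable M (\<lambda>x. (g x)\<^sup>2)"
    using assms by (intro Bochner_Integration.integrable_cong_AE) (auto simp: L2_def)
  then show ?thesis using assms by (auto simp: L2_def)
qed

lemma L2_integrable: "finite_measure M \<Longrightarrow> f \<in> L2 M M \<Longrightarrow> integrable M f"
  using L2_integrable_mult[of f M "\<lambda>x. 1"] by simp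

lemma L2_subalg: "subalgebra M N \<Longrightarrow> f \<in> L2 M N \<Longrightarrow> f \<in> L2 M M"
  by (rule L2_mono)

lemma L2_add_le:
  assumes "f \<in> L2 M M" "g \<in> L2 M M"
  shows "(\<integral>x. (f x + g x)\<^sup>2 \<partial>M) \<le> 2 * sq_norm M f + 2 * sq_norm M g"
proof -
  have "(\<integral>x. (f x + g x)\<^sup>2 \<partial>M) \<le> (\<integral>x. 2 * (f x)\<^sup>2 + 2 * (g x)\<^sup>2 \<partial>M)"
  proof (rule integral_mono)
    show "integrable M (\<lambda>x. (f x + g x)\<^sup>2)"
      using assms by (intro L2_square[OF L2_add]) (auto simp: subalgebra_def)
    show "integrable M (\<lambda>x. 2 * (f x)\<^sup>2 + 2 * (g x)\<^sup>2)"
      using assms by (auto simp: L2_def)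
    show "(f x + g x)\<^sup>2 \<le> 2 * (f x)\<^sup>2 + 2 * (g x)\<^sup>2" for x
      using sum_squares_ge_zero[of "f x - g x" 0] by (simp add: power2_eq_square algebra_simps)
  qed
  also have "\<dots> = 2 * sq_norm M f + 2 * sq_norm M g"
    using assms by (subst Bochner_Integration.integral_add) (auto simp: L2_def)
  finally show ?thesis .
qed

lemma L2_diff_le:
  assumes "f \<in> L2 M M" "g \<in> L2 M M"
  shows "sq_dist M f g \<le> 2 * sq_norm M f + 2 * sq_norm M g"
  using L2_add_le[OF assms(1) L2_cmult[OF assms(2), of "-1"]] by simp

lemma L2_triangle_le:
  assumes "f \<in> L2 M M" "g \<in> L2 M M" "h \<in> L2 M M"
  shows "sq_dist M f h \<le> 2 * sq_dist M f g + 2 * sq_dist M g h"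
proof -
  have "subalgebra M M" by (simp add: subalgebra_def)
  then show ?thesis
    using L2_add_le[OF L2_diff[OF _ assms(1,2)] L2_diff[OF _ assms(2,3)]] by simp
qed

lemma L2_square_expand:
  assumes "f \<in> L2 M M" "g \<in> L2 M M"
  shows "sq_dist M f g =
    (sq_norm M f) - 2 * L2_inner M f g + sq_norm M g"
proof -
  have "sq_dist M f g = (\<integral>x. (f x)\<^sup>2 - 2 * (f x * g x) + (g x)\<^sup>2 \<partial>M)"
    by (simp add: power2_diff algebra_simps)
  also have "\<dots> = sq_norm M f - 2 * L2_inner M f g + sq_norm M g"
    using L2_square[OF assms(1)] L2_square[OF assms(2)] L2_integrable_mult[OF assms] by simp
  finally show ?thesis .
qed

lemma L2_Cauchy_Schwarz:
  assumes "f \<in> L2 M M" "g \<in> L2 M M"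
  shows "(L2_inner M f g)\<^sup>2 \<le> sq_norm M f * sq_norm M g"
proof -
  define A B C where "A = sq_norm M f" and "B = L2_inner M f g" and "C = sq_norm M g"
  have pos: "0 \<le> A - 2 * t * B + t\<^sup>2 * C" for t
  proof -
    have "0 \<le> (\<integral>x. (f x - t * g x)\<^sup>2 \<partial>M)" by simp
    also have "\<dots> = A - 2 * t * B + t\<^sup>2 * C"
      using L2_square_expand[OF assms(1) L2_cmult[OF assms(2), of t]]
      by (simp add: A_def B_def C_def power_mult_distrib mult.left_commute[of _ t])
    finally show ?thesis .
  qed
  have "A \<ge> 0" "C \<ge> 0" by (simp_all add: A_def C_def)
  show ?thesis
  proof (cases "C = 0")
    case True
    have "B = 0"
    proof (rule ccontr)
      assume "B \<noteq> 0"
      then show False using pos[of "(A + 1) / (2 * B)"] True by (simp add: field_simps)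
    qed
    then show ?thesis using \<open>A \<ge> 0\<close> \<open>C \<ge> 0\<close> by (simp add: A_def B_def C_def)
  next
    case False
    with \<open>C \<ge> 0\<close> have "C > 0" by simp
    have "0 \<le> (A - 2 * (B / C) * B + (B / C)\<^sup>2 * C) * C"
      using pos[of "B / C"] \<open>C > 0\<close> by simp
    also have "\<dots> = A * C - B\<^sup>2"
      using \<open>C > 0\<close> by (simp add: field_simps power2_eq_square)
    finally show ?thesis by (simp add: A_def B_def C_def)
  qed
qed

lemma L2_zero_AE:
  assumes "f \<in> L2 M M" "sq_norm M f = 0"
  shows "AE x in M. f x = 0"
  using assms integral_nonneg_eq_0_iff_AE[of M "\<lambda>x. (f x)\<^sup>2"] by (auto simp: L2_def)

lemma L2_zero_AE_le:
  assumes "f \<in> L2 M M" "sq_norm M f \<le> 0"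
  shows "AE x in M. f x = 0"
  using assms by (intro L2_zero_AE) (auto intro!: antisym)

lemma L2_tendsto_inner:
  assumes S: "\<And>m. S m \<in> L2 M M" and Y: "Y \<in> L2 M M" and h: "h \<in> L2 M M"
    and lim: "(\<lambda>m. \<integral>x. (S m x - Y x)\<^sup>2 \<partial>M) \<longlonglongrightarrow> 0"
  shows "(\<lambda>m. \<integral>x. S m x * h x \<partial>M) \<longlonglongrightarrow> (L2_inner M Y h)"
proof -
  have sub: "subalgebra M M" by (simp add: subalgebra_def)
  define C where "C = sq_norm M h"
  have *: "\<bar>L2_inner M (S m) h - L2_inner M Y h\<bar> \<le> sqrt (sq_dist M (S m) Y * C)" for m
  proof -
    have "L2_inner M (S m) h - L2_inner M Y h = (\<integral>x. (S m x - Y x) * h x \<partial>M)"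
      using L2_integrable_mult[OF S h] L2_integrable_mult[OF Y h] by (simp add: left_diff_distrib)
    moreover have "(\<integral>x. (S m x - Y x) * h x \<partial>M)\<^sup>2 \<le> sq_dist M (S m) Y * C"
      unfolding C_def by (rule L2_Cauchy_Schwarz[OF L2_diff[OF sub S Y] h])
    ultimately show ?thesis by (metis real_le_rsqrt real_sqrt_abs real_sqrt_le_iff)
  qed
  have "(\<lambda>m. sqrt (sq_dist M (S m) Y * C)) \<longlonglongrightarrow> sqrt (0 * C)"
    by (rule tendsto_real_sqrt[OF tendsto_mult[OF lim tendsto_const]])
  then have lim0: "(\<lambda>m. sqrt (sq_dist M (S m) Y * C)) \<longlonglongrightarrow> 0" by simp
  have "(\<lambda>m. L2_inner M (S m) h - L2_inner M Y h) \<longlonglongrightarrow> 0"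
    by (rule Lim_null_comparison[OF _ lim0]) (simp add: * always_eventually)
  then show ?thesis by (rule LIM_zero_cancel)
qed

lemma L2_limit_unique:
  assumes S: "\<And>m. S m \<in> L2 M M" and Y: "Y \<in> L2 M M" "Z \<in> L2 M M"
    and lim: "(\<lambda>m. \<integral>x. (S m x - Y x)\<^sup>2 \<partial>M) \<longlonglongrightarrow> 0" "(\<lambda>m. \<integral>x. (S m x - Z x)\<^sup>2 \<partial>M) \<longlonglongrightarrow> 0"
  shows "AE x in M. Y x = Z x"
proof -
  have sub: "subalgebra M M" by (simp add: subalgebra_def)
  have "(\<lambda>m. 2 * sq_dist M (S m) Y + 2 * sq_dist M (S m) Z) \<longlonglongrightarrow> 2 * 0 + 2 * 0"
    by (rule tendsto_add[OF tendsto_mult_left[OF lim(1)] tendsto_mult_left[OF lim(2)]])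
  moreover have "sq_dist M Y Z \<le> 2 * sq_dist M (S m) Y + 2 * sq_dist M (S m) Z" for m
    using L2_triangle_le[OF Y(1) S Y(2)] by (simp add: power2_commute)
  ultimately have "sq_dist M Y Z \<le> 0"
    by (intro LIMSEQ_le_const) auto
  then have "AE x in M. Y x - Z x = 0"
    by (rule L2_zero_AE_le[OF L2_diff[OF sub Y]])
  then show ?thesis by auto
qed

lemma L2_tendsto_add:
  assumes "\<And>m. S m \<in> L2 M M" "Y \<in> L2 M M" "\<And>m. S' m \<in> L2 M M" "Y' \<in> L2 M M"
    and "(\<lambda>m. \<integral>x. (S m x - Y x)\<^sup>2 \<partial>M) \<longlonglongrightarrow> 0" "(\<lambda>m. \<integral>x. (S' m x - Y' x)\<^sup>2 \<partial>M) \<longlonglongrightarrow> 0"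
  shows "(\<lambda>m. \<integral>x. ((S m x + S' m x) - (Y x + Y' x))\<^sup>2 \<partial>M) \<longlonglongrightarrow> 0"
proof (rule tendsto_sandwich[OF _ _ tendsto_const])
  have sub: "subalgebra M M" by (simp add: subalgebra_def)
  have "(\<lambda>m. 2 * sq_dist M (S m) Y + 2 * sq_dist M (S' m) Y') \<longlonglongrightarrow> 2 * 0 + 2 * 0"
    by (rule tendsto_add[OF tendsto_mult_left[OF assms(5)] tendsto_mult_left[OF assms(6)]])
  then show "(\<lambda>m. 2 * sq_dist M (S m) Y + 2 * sq_dist M (S' m) Y') \<longlonglongrightarrow> 0"
    by simp
  show "\<forall>\<^sub>F m in sequentially. (\<integral>x. ((S m x + S' m x) - (Y x + Y' x))\<^sup>2 \<partial>M)
      \<le> 2 * sq_dist M (S m) Y + 2 * sq_dist M (S' m) Y'"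
  proof (intro always_eventually allI)
    fix m
    show "(\<integral>x. ((S m x + S' m x) - (Y x + Y' x))\<^sup>2 \<partial>M)
      \<le> 2 * sq_dist M (S m) Y + 2 * sq_dist M (S' m) Y'"
      using L2_add_le[OF L2_diff[OF sub assms(1,2)] L2_diff[OF sub assms(3,4)], of m m]
      by (simp add: add_diff_add)
  qed
qed auto

text \<open>The Riesz-Fischer argument, arranged so that the limit is measurable for the
  sub-sigma-field \<open>N\<close> itself and not only for \<open>M\<close>.\<close>

lemma (in prob_space) L2_complete:
  assumes sub: "subalgebra M N" and S: "\<And>m. S m \<in> L2 M N"
    and C: "\<And>e. e > 0 \<Longrightarrow> \<exists>k. \<forall>m\<ge>k. \<forall>n\<ge>k. sq_dist M (S m) (S n) < e"
  shows "\<exists>Y\<in>L2 M N. (\<lambda>m. \<integral>x. (S m x - Y x)\<^sup>2 \<partial>M) \<longlonglongrightarrow> 0"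
proof -
  have subM: "subalgebra M M" by (simp add: subalgebra_def)
  have [measurable]: "S m \<in> borel_measurable M" for m
    using S[of m] sub by (auto simp: L2_def intro: measurable_from_subalg)
  have SM: "S m \<in> L2 M M" for m using S sub by (rule L2_subalg[rotated])
  \<comment> \<open>Squared distances below \<open>(1/4)^i\<close> along a subsequence give mean
    absolute increments of at most \<open>(1/2)^i\<close> by Cauchy-Schwarz, hence an almost
    everywhere absolutely convergent telescoping series.\<close>
  have "\<exists>k. \<forall>i. (\<forall>m\<ge>k i. \<forall>n\<ge>k i. sq_dist M (S m) (S n) < (1/4)^i) \<and> k i \<le> k (Suc i)"
  proof (rule dependent_nat_choice)
    show "\<exists>x. \<forall>m\<ge>x. \<forall>n\<ge>x. sq_dist M (S m) (S n) < (1/4)^0"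
      using C[of 1] by simp
    show "\<exists>y. (\<forall>m\<ge>y. \<forall>n\<ge>y. sq_dist M (S m) (S n) < (1/4)^Suc i) \<and> x \<le> y" for x i
    proof -
      obtain k where "\<forall>m\<ge>k. \<forall>n\<ge>k. sq_dist M (S m) (S n) < (1/4)^Suc i"
        using C[of "(1/4)^Suc i"] by auto
      then show ?thesis by (intro exI[of _ "max k x"]) auto
    qed
  qed
  then obtain r where r: "\<And>i m n. m \<ge> r i \<Longrightarrow> n \<ge> r i \<Longrightarrow> sq_dist M (S m) (S n) < (1/4)^i"
    and rmono: "\<And>i. r i \<le> r (Suc i)" by blast
  define D where "D i x = \<bar>S (r (Suc i)) x - S (r i) x\<bar>" for i x
  have [measurable]: "D i \<in> borel_measurable M" for i unfolding D_def by measurable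
  have Dnn: "0 \<le> D i x" for i x by (simp add: D_def)
  have Dint: "(\<integral>\<^sup>+x. ennreal (D i x) \<partial>M) \<le> ennreal ((1/2)^i)" for i
  proof -
    have L: "(\<lambda>x. S (r (Suc i)) x - S (r i) x) \<in> L2 M M" by (rule L2_diff[OF subM SM SM])
    have D2: "D i \<in> L2 M M" using L by (auto simp: L2_def D_def)
    have "(\<integral>x. D i x * 1 \<partial>M)\<^sup>2 \<le> sq_norm M (D i) * (\<integral>x. 1\<^sup>2 \<partial>M)"
      by (rule L2_Cauchy_Schwarz[OF D2]) (simp add: L2_const finite_measure_axioms)
    also have "\<dots> \<le> (1/4)^i"
      using r[of i "r (Suc i)" "r i"] rmono[of i] by (simp add: D_def prob_space)
    also have "\<dots> = ((1/2)^i)\<^sup>2" by (simp add: power2_eq_square power_mult_distrib[symmetric])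
    finally have "\<bar>\<integral>x. D i x \<partial>M\<bar> \<le> (1/2)^i" by (simp add: power2_le_iff_abs_le)
    then have "(\<integral>x. D i x \<partial>M) \<le> (1/2)^i" by (rule abs_le_D1)
    moreover have "integrable M (D i)" by (rule L2_integrable[OF finite_measure_axioms D2])
    ultimately show ?thesis
      by (subst nn_integral_eq_integral) (auto simp: Dnn ennreal_leI)
  qed
  have "(\<integral>\<^sup>+x. (\<Sum>i. ennreal (D i x)) \<partial>M) = (\<Sum>i. \<integral>\<^sup>+x. ennreal (D i x) \<partial>M)"
    by (rule nn_integral_suminf) measurable
  also have "\<dots> \<le> (\<Sum>i. ennreal ((1/2)^i))" by (intro suminf_le Dint) auto
  also have "\<dots> < \<infinity>"
    by (subst suminf_ennreal_eq[where x=2]) (auto intro!: geometric_sums[of "1/2::real", simplified])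
  finally have "AE x in M. (\<Sum>i. ennreal (D i x)) \<noteq> \<infinity>"
    by (intro nn_integral_noteq_infinite) auto
  then have "AE x in M. summable (\<lambda>i. D i x)"
  proof eventually_elim
    case (elim x)
    show ?case by (rule summable_suminf_not_top) (use elim in \<open>auto simp: D_def\<close>)
  qed
  then have conv: "AE x in M. convergent (\<lambda>i. S (r i) x)"
  proof eventually_elim
    case (elim x)
    then have "summable (\<lambda>i. S (r (Suc i)) x - S (r i) x)"
      unfolding D_def by (rule summable_rabs_cancel)
    then have "convergent (\<lambda>n. \<Sum>i<n. S (r (Suc i)) x - S (r i) x)"
      by (simp add: summable_iff_convergent)
    then have "convergent (\<lambda>n. S (r n) x - S (r 0) x)"
      using sum_lessThan_telescope[of "\<lambda>n. S (r n) x"] by simp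
    from convergent_add[OF this convergent_const[of "S (r 0) x"]] show ?case by simp
  qed
  \<comment> \<open>\<open>lim\<close> is total, so \<open>Y\<close> is defined at every point and
    inherits measurability for \<open>N\<close> without the choice of an exceptional set.\<close>
  define Y where "Y x = lim (\<lambda>i. S (r i) x)" for x
  have YN: "Y \<in> borel_measurable N"
    unfolding Y_def using S by (intro borel_measurable_lim_metric) (auto simp: L2_def)
  have [measurable]: "Y \<in> borel_measurable M" using measurable_from_subalg[OF sub YN] .
  have lim: "AE x in M. (\<lambda>i. S (r i) x) \<longlonglongrightarrow> Y x"
    using conv unfolding Y_def by eventually_elim (simp add: convergent_LIMSEQ_iff)
  have rge: "r i \<le> r j" if "i \<le> j" for i j
    using lift_Suc_mono_le[of r, OF rmono that] .
  \<comment> \<open>Fatou's lemma along the subsequence. The estimate covers every \<open>m\<close>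
    beyond \<open>r i\<close>, so it yields convergence of the full sequence.\<close>
  have bound: "(\<integral>\<^sup>+x. ennreal ((S m x - Y x)\<^sup>2) \<partial>M) \<le> ennreal ((1/4)^i)" if "m \<ge> r i" for m i
  proof -
    have "(\<integral>\<^sup>+x. ennreal ((S m x - Y x)\<^sup>2) \<partial>M) = (\<integral>\<^sup>+x. liminf (\<lambda>j. ennreal ((S m x - S (r j) x)\<^sup>2)) \<partial>M)"
    proof (rule nn_integral_cong_AE, use lim in eventually_elim)
      fix x assume "(\<lambda>i. S (r i) x) \<longlonglongrightarrow> Y x"
      then have "(\<lambda>j. ennreal ((S m x - S (r j) x)\<^sup>2)) \<longlonglongrightarrow> ennreal ((S m x - Y x)\<^sup>2)"
        by (intro tendsto_ennrealI tendsto_intros)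
      then show "ennreal ((S m x - Y x)\<^sup>2) = liminf (\<lambda>j. ennreal ((S m x - S (r j) x)\<^sup>2))"
        by (rule lim_imp_Liminf[OF trivial_limit_sequentially, symmetric])
    qed
    also have "\<dots> \<le> liminf (\<lambda>j. \<integral>\<^sup>+x. ennreal ((S m x - S (r j) x)\<^sup>2) \<partial>M)"
      by (rule nn_integral_liminf) measurable
    also have "\<dots> \<le> ennreal ((1/4)^i)"
    proof (rule Liminf_le)
      show "\<forall>\<^sub>F j in sequentially. (\<integral>\<^sup>+x. ennreal ((S m x - S (r j) x)\<^sup>2) \<partial>M) \<le> ennreal ((1/4)^i)"
        using eventually_ge_at_top[of i]
      proof eventually_elim
        case (elim j)
        have "(\<integral>\<^sup>+x. ennreal ((S m x - S (r j) x)\<^sup>2) \<partial>M) = ennreal (sq_dist M (S m) (S (r j)))"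
          by (rule nn_integral_eq_integral[OF L2_square[OF L2_diff[OF subM SM SM]]]) auto
        then show ?case using r[OF that rge[OF elim]] by (simp add: ennreal_leI)
      qed
    qed simp
    finally show ?thesis .
  qed
  have dif: "(\<lambda>x. S m x - Y x) \<in> L2 M M" if "m \<ge> r 0" for m
  proof -
    have "integrable M (\<lambda>x. (S m x - Y x)\<^sup>2)"
      using le_less_trans[OF bound[OF that] ennreal_less_top] by (intro integrableI_nonneg) auto
    then show ?thesis by (simp add: L2_def)
  qed
  have "Y \<in> L2 M M"
    using L2_diff[OF subM SM[of "r 0"] dif[OF order_refl]] by simp
  then have Y: "Y \<in> L2 M N" using YN by (simp add: L2_def)
  moreover have "(\<lambda>m. \<integral>x. (S m x - Y x)\<^sup>2 \<partial>M) \<longlonglongrightarrow> 0"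
  proof (rule LIMSEQ_I)
    fix e :: real assume "e > 0"
    then obtain i where i: "(1/4)^i < e" using real_arch_pow_inv[of e "1/4"] by auto
    have "norm (sq_dist M (S m) Y - 0) < e" if "m \<ge> r i" for m
    proof -
      have "m \<ge> r 0" using that rge[of 0 i] by simp
      have "ennreal (sq_dist M (S m) Y) = (\<integral>\<^sup>+x. ennreal ((S m x - Y x)\<^sup>2) \<partial>M)"
        by (rule nn_integral_eq_integral[symmetric, OF L2_square[OF dif[OF \<open>m \<ge> r 0\<close>]]]) auto
      also have "\<dots> \<le> ennreal ((1/4)^i)" by (rule bound[OF that])
      finally have "sq_dist M (S m) Y \<le> (1/4)^i" by (simp add: ennreal_le_iff)
      then show ?thesis using i by simp
    qed
    then show "\<exists>k. \<forall>m\<ge>k. norm (sq_dist M (S m) Y - 0) < e" by blast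
  qed
  ultimately show ?thesis by blast
qed

section \<open>Independence and conditional orthogonality\<close>

text \<open>The two functions differ only inside a null set \<open>Z\<close>. Completeness makes all
  subsets of \<open>Z\<close> null sets, and these belong to \<open>N\<close>, so preimages change
  only by members of \<open>N\<close>. This carries measurability across identities that hold almost
  everywhere.\<close>

lemma measurable_AE_cong_complete:
  assumes M: "complete_measure M" and sub: "subalgebra M N" and null: "null_sets M \<subseteq> sets N"
    and f: "f \<in> N \<rightarrow>\<^sub>M K" and eq: "AE x in M. f x = g x" and g: "\<And>x. x \<in> space M \<Longrightarrow> g x \<in> space K"
  shows "g \<in> N \<rightarrow>\<^sub>M K"
proof (rule measurableI)
  have sp: "space N = space M" using sub by (simp add: subalgebra_def)
  show "g x \<in> space K" if "x \<in> space N" for x using that g sp by simp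
  fix B assume B: "B \<in> sets K"
  obtain Z where Z: "Z \<in> null_sets M" "\<And>x. x \<in> space M - Z \<Longrightarrow> f x = g x"
    using eq by (auto elim!: AE_E3)
  have "g -` B \<inter> Z \<in> null_sets M"
  proof -
    have "g -` B \<inter> Z \<in> sets M" using complete_measure.complete[OF M _ Z(1)] by simp
    then show ?thesis using Z(1) by (metis Int_lower2 null_sets_subset)
  qed
  moreover have "Z \<in> sets N" "f -` B \<inter> space N \<in> sets N"
    using null Z(1) f B by (auto intro: measurable_sets)
  ultimately have "(f -` B \<inter> space N - Z) \<union> (g -` B \<inter> Z) \<in> sets N"
    using null by blast
  moreover have "g -` B \<inter> space N = (f -` B \<inter> space N - Z) \<union> (g -` B \<inter> Z)"
    using Z sets.sets_into_space[of Z M] sp by (auto dest: null_setsD2)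
  ultimately show "g -` B \<inter> space N \<in> sets N" by simp
qed

text \<open>No null sets are added here, in contrast to \<open>generated_field\<close>; they return
  at the end, through the requirement that the final sigma-field contain them.\<close>

definition join_algebra :: "'a measure \<Rightarrow> 'a measure \<Rightarrow> 'a measure" where
  "join_algebra A B = sigma (space A) (sets A \<union> sets B)"

section \<open>Joins of two sigma-fields and their pi-system of rectangles\<close>

context
  fixes M A B :: "'a measure"
  assumes A: "subalgebra M A" and B: "subalgebra M B"
begin

lemma space_join: "space (join_algebra A B) = space M"
  using A by (simp add: join_algebra_def subalgebra_def space_measure_of_conv)

lemma sets_join: "sets (join_algebra A B) = sigma_sets (space M) (sets A \<union> sets B)"
proof -
  have "sets A \<union> sets B \<subseteq> Pow (space M)"
    using A B sets.sets_into_space by (fastforce simp: subalgebra_def)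
  then show ?thesis using A by (simp add: join_algebra_def subalgebra_def)
qed

lemma subalgebra_join: "subalgebra M (join_algebra A B)"
proof -
  have "sigma_sets (space M) (sets A \<union> sets B) \<subseteq> sets M"
    using A B by (intro sets.sigma_sets_subset) (auto simp: subalgebra_def)
  then show ?thesis by (simp add: subalgebra_def space_join sets_join)
qed

lemma subalgebra_join_left: "subalgebra (join_algebra A B) A"
  using A by (auto simp: subalgebra_def space_join sets_join)

lemma subalgebra_join_right: "subalgebra (join_algebra A B) B"
  using B by (auto simp: subalgebra_def space_join sets_join)

lemma join_least:
  assumes "subalgebra N A" "subalgebra N B"
  shows "subalgebra N (join_algebra A B)"
proof -
  have "sigma_sets (space N) (sets A \<union> sets B) \<subseteq> sets N"
    using assms by (intro sets.sigma_sets_subset) (auto simp: subalgebra_def)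
  moreover have "space N = space M" using assms A by (simp add: subalgebra_def)
  ultimately show ?thesis by (simp add: subalgebra_def space_join sets_join)
qed

definition rectangles :: "'a set set" where
  "rectangles = {a \<inter> b | a b. a \<in> sets A \<and> b \<in> sets B}"

lemma Int_stable_rectangles: "Int_stable rectangles"
proof (rule Int_stableI)
  fix x y assume "x \<in> rectangles" "y \<in> rectangles"
  then obtain a b a' b' where "x = a \<inter> b" "y = a' \<inter> b'" "a \<in> sets A" "a' \<in> sets A" "b \<in> sets B" "b' \<in> sets B"
    by (auto simp: rectangles_def)
  then have "x \<inter> y = (a \<inter> a') \<inter> (b \<inter> b')" "a \<inter> a' \<in> sets A" "b \<inter> b' \<in> sets B" by auto
  then show "x \<inter> y \<in> rectangles" unfolding rectangles_def by blast
qed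

lemma space_in_rectangles: "space M \<in> rectangles"
proof -
  have "space M \<in> sets A" "space M \<in> sets B" using A B sets.top[of A] sets.top[of B] by (auto simp: subalgebra_def)
  then show ?thesis unfolding rectangles_def by blast
qed

lemma rectangles_sub: "rectangles \<subseteq> sets M"
  using A B by (auto simp: rectangles_def subalgebra_def)

lemma sets_join_rectangles: "sets (join_algebra A B) = sigma_sets (space M) rectangles"
proof -
  have sub: "sets A \<subseteq> Pow (space M)" "sets B \<subseteq> Pow (space M)"
    using A B sets.sets_into_space by (fastforce simp: subalgebra_def)+
  have top: "space M \<in> sets A" "space M \<in> sets B" using A B sets.top[of A] sets.top[of B] by (auto simp: subalgebra_def)
  have "sets A \<union> sets B \<subseteq> rectangles"
  proof
    fix x assume "x \<in> sets A \<union> sets B"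
    then have "x = x \<inter> space M" "x = space M \<inter> x" "x \<in> sets A \<or> x \<in> sets B" using sub by auto
    then show "x \<in> rectangles" unfolding rectangles_def using top by blast
  qed
  then have "sigma_sets (space M) (sets A \<union> sets B) \<subseteq> sigma_sets (space M) rectangles"
    by (rule sigma_sets_mono')
  moreover have "rectangles \<subseteq> sigma_sets (space M) (sets A \<union> sets B)"
  proof -
    have "a \<inter> b \<in> sets (join_algebra A B)" if "a \<in> sets A" "b \<in> sets B" for a b
      using that by (intro sets.Int) (auto simp: sets_join)
    then show ?thesis by (auto simp: rectangles_def sets_join)
  qed
  then have "sigma_sets (space M) rectangles \<subseteq> sigma_sets (space M) (sets A \<union> sets B)"
    by (rule sigma_sets_mono)
  ultimately show ?thesis by (simp add: sets_join)
qed

end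

context prob_space
begin

lemma sub_refl [simp]: "subalgebra M M"
  by (simp add: subalgebra_def)

lemma sigma_finite_subalgebra_prob: "subalgebra M N \<Longrightarrow> sigma_finite_subalgebra M N"
  by (intro finite_measure_subalgebra_is_sigma_finite finite_measure_subalgebra.intro
        finite_measure_axioms finite_measure_subalgebra_axioms.intro)

text \<open>The sets over which the signed function \<open>u\<close> integrates to zero are closed
  under complements, because \<open>space M\<close> is among them, and under countable disjoint
  unions. Dynkin's lemma extends the property from the pi-system \<open>G\<close>.\<close>

lemma orthogonal_sigma_sets:
  fixes u :: "'a \<Rightarrow> real"
  assumes u: "integrable M u" and G: "Int_stable G" "G \<subseteq> events" "space M \<in> G"
    and z: "\<And>D. D \<in> G \<Longrightarrow> (\<integral>x\<in>D. u x \<partial>M) = 0" and D: "D \<in> sigma_sets (space M) G"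
  shows "(\<integral>x\<in>D. u x \<partial>M) = 0"
proof -
  have sub: "sigma_sets (space M) G \<subseteq> events" using G(2) by (rule sets.sigma_sets_subset)
  have si: "set_integrable M A u" if "A \<in> events" for A
    using integrable_mult_indicator[OF that u] by (simp add: set_integrable_def)
  have Pow: "G \<subseteq> Pow (space M)" using G(2) sets.sets_into_space by blast
  show ?thesis
  proof (rule sigma_sets_induct_disjoint[OF G(1) Pow D])
    show "(\<integral>x\<in>A. u x \<partial>M) = 0" if "A \<in> G" for A using z that .
    show "(\<integral>x\<in>{}. u x \<partial>M) = 0" by (simp add: set_lebesgue_integral_def)
    show "(\<integral>x\<in>(space M - A). u x \<partial>M) = 0" if A: "A \<in> sigma_sets (space M) G" "(\<integral>x\<in>A. u x \<partial>M) = 0" for A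
    proof -
      have "A \<in> events" "A \<subseteq> space M" using A(1) sub sets.sets_into_space by auto
      then have "(\<integral>x\<in>A \<union> (space M - A). u x \<partial>M) = (\<integral>x\<in>A. u x \<partial>M) + (\<integral>x\<in>(space M - A). u x \<partial>M)"
        by (intro set_integral_Un si) auto
      moreover have "A \<union> (space M - A) = space M" using \<open>A \<subseteq> space M\<close> by auto
      ultimately show ?thesis using A(2) z[OF G(3)] by simp
    qed
    show "(\<integral>x\<in>(\<Union>i. A i). u x \<partial>M) = 0"
      if A: "disjoint_family A" "range A \<subseteq> sigma_sets (space M) G" "\<And>i. (\<integral>x\<in>A i. u x \<partial>M) = 0"
      for A :: "nat \<Rightarrow> 'a set"
    proof -
      have ev: "A i \<in> events" for i using A(2) sub by auto
      have "(\<integral>x\<in>(\<Union>i. A i). u x \<partial>M) = (\<Sum>i. (\<integral>x\<in>A i. u x \<partial>M))"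
        by (rule lebesgue_integral_countable_add) (use ev A(1) in \<open>auto intro!: si simp: disjoint_family_on_def\<close>)
      then show ?thesis using A(3) by simp
    qed
  qed
qed

text \<open>Vanishing integrals over the sets of \<open>N\<close> say that the conditional
  expectation of \<open>u\<close> given \<open>N\<close> is zero; the pull-out property then gives
  orthogonality to \<open>v\<close>.\<close>

lemma orthogonal_L2:
  fixes u v :: "'a \<Rightarrow> real"
  assumes N: "subalgebra M N" and u: "integrable M u"
    and z: "\<And>D. D \<in> sets N \<Longrightarrow> (\<integral>x\<in>D. u x \<partial>M) = 0"
    and v: "v \<in> borel_measurable N" "integrable M (\<lambda>x. u x * v x)"
  shows "L2_inner M u v = 0"
proof -
  interpret sigma_finite_subalgebra M N by (rule sigma_finite_subalgebra_prob[OF N])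
  have "AE x in M. real_cond_exp M N u x = 0"
    by (rule real_cond_exp_charact) (use z u in auto)
  moreover have [measurable]: "v \<in> borel_measurable M" "u \<in> borel_measurable M"
    using measurable_from_subalg[OF N v(1)] u by auto
  ultimately have "L2_inner M v (real_cond_exp M N u) = (\<integral>x. 0 \<partial>M)"
    by (intro integral_cong_AE) auto
  moreover have "L2_inner M v (real_cond_exp M N u) = L2_inner M v u"
    by (rule real_cond_exp_intg(2)) (use v in \<open>auto simp: mult.commute\<close>)
  ultimately show ?thesis by (simp add: mult.commute)
qed

lemma orthogonal_join:
  assumes A: "subalgebra M A" and B: "subalgebra M B" and u: "u \<in> L2 M M"
    and z: "\<And>a b. a \<in> sets A \<Longrightarrow> b \<in> sets B \<Longrightarrow> L2_inner M (indicator (a \<inter> b)) u = 0"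
    and v: "v \<in> L2 M (join_algebra A B)"
  shows "L2_inner M u v = 0"
proof (rule orthogonal_L2[OF subalgebra_join[OF A B]])
  show int: "integrable M u" using u finite_measure_axioms by (rule L2_integrable[rotated])
  show "(\<integral>x\<in>D. u x \<partial>M) = 0" if "D \<in> sets (join_algebra A B)" for D
  proof (rule orthogonal_sigma_sets[OF int Int_stable_rectangles[OF A B] rectangles_sub[OF A B] space_in_rectangles[OF A B]])
    show "D \<in> sigma_sets (space M) (rectangles A B)" using that sets_join_rectangles[OF A B] by simp
    show "(\<integral>x\<in>D. u x \<partial>M) = 0" if "D \<in> rectangles A B" for D
      using that z by (auto simp: rectangles_def[OF A B] set_lebesgue_integral_def)
  qed
  show "v \<in> borel_measurable (join_algebra A B)" using v by (rule L2_measurable)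
  show "integrable M (\<lambda>x. u x * v x)"
    by (rule L2_integrable_mult[OF u L2_subalg[OF subalgebra_join[OF A B] v]])
qed

section \<open>Consequences of independence: product laws, products of functions, frozen
  variables\<close>

lemma indep_varI:
  assumes ind: "indep_set (sets A) (sets B)" and sub: "subalgebra M A" "subalgebra M B"
    and X: "X \<in> A \<rightarrow>\<^sub>M S" and Y: "Y \<in> B \<rightarrow>\<^sub>M T"
  shows "indep_var S X T Y"
proof -
  have sp: "space A = space M" "space B = space M" using sub by (auto simp: subalgebra_def)
  have *: "sigma_sets (space M) {X -` E \<inter> space M |E. E \<in> sets S} \<subseteq> sets A"
    using sets.sigma_sets_subset[of "{X -` E \<inter> space M |E. E \<in> sets S}" A] measurable_sets[OF X] sp by auto
  have **: "sigma_sets (space M) {Y -` E \<inter> space M |E. E \<in> sets T} \<subseteq> sets B"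
    using sets.sigma_sets_subset[of "{Y -` E \<inter> space M |E. E \<in> sets T}" B] measurable_sets[OF Y] sp by auto
  have "indep_set (sigma_sets (space M) {X -` E \<inter> space M |E. E \<in> sets S})
      (sigma_sets (space M) {Y -` E \<inter> space M |E. E \<in> sets T})"
    using ind * ** unfolding indep_set_def
    by (rule_tac indep_sets_mono_sets) (auto split: bool.splits)
  then show ?thesis
    using measurable_from_subalg[OF sub(1) X] measurable_from_subalg[OF sub(2) Y] by (simp add: indep_var_eq)
qed

lemma indep_distr_pair:
  assumes ind: "indep_set (sets A) (sets B)" and sub: "subalgebra M A" "subalgebra M B"
    and X: "X \<in> A \<rightarrow>\<^sub>M S" and Y: "Y \<in> B \<rightarrow>\<^sub>M T"
  shows "distr M S X \<Otimes>\<^sub>M distr M T Y = distr M (S \<Otimes>\<^sub>M T) (\<lambda>\<omega>. (X \<omega>, Y \<omega>))"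
proof (rule pair_measure_eqI)
  have [measurable]: "X \<in> M \<rightarrow>\<^sub>M S" "Y \<in> M \<rightarrow>\<^sub>M T"
    using X Y sub by (auto intro: measurable_from_subalg)
  interpret D1: prob_space "distr M S X" by (rule prob_space_distr) measurable
  interpret D2: prob_space "distr M T Y" by (rule prob_space_distr) measurable
  show "sigma_finite_measure (distr M S X)" "sigma_finite_measure (distr M T Y)" by unfold_locales
  show "sets (distr M S X \<Otimes>\<^sub>M distr M T Y) = sets (distr M (S \<Otimes>\<^sub>M T) (\<lambda>\<omega>. (X \<omega>, Y \<omega>)))"
    by (simp cong: sets_pair_measure_cong)
  fix E F assume "E \<in> sets (distr M S X)" "F \<in> sets (distr M T Y)"
  then have [measurable]: "E \<in> sets S" "F \<in> sets T" by auto
  have sp: "space A = space M" "space B = space M" using sub by (auto simp: subalgebra_def)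
  have "prob ((X -` E \<inter> space M) \<inter> (Y -` F \<inter> space M)) = prob (X -` E \<inter> space M) * prob (Y -` F \<inter> space M)"
    using measurable_sets[OF X, of E] measurable_sets[OF Y, of F] by (intro indep_setD[OF ind]) (auto simp: sp)
  moreover have "(\<lambda>\<omega>. (X \<omega>, Y \<omega>)) -` (E \<times> F) \<inter> space M = (X -` E \<inter> space M) \<inter> (Y -` F \<inter> space M)" by auto
  ultimately show "emeasure (distr M S X) E * emeasure (distr M T Y) F
      = emeasure (distr M (S \<Otimes>\<^sub>M T) (\<lambda>\<omega>. (X \<omega>, Y \<omega>))) (E \<times> F)"
    by (simp add: emeasure_distr emeasure_eq_measure ennreal_mult[symmetric])
qed

lemma indep_L2_mult:
  assumes ind: "indep_set (sets A) (sets B)" and sub: "subalgebra M A" "subalgebra M B"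
    and f: "f \<in> L2 M A" and g: "g \<in> L2 M B"
  shows "L2_inner M f g = (\<integral>x. f x \<partial>M) * (\<integral>x. g x \<partial>M)"
proof (rule indep_var_lebesgue_integral)
  show "indep_var borel f borel g"
    using f g by (intro indep_varI[OF ind sub] L2_measurable)
  show "integrable M f" "integrable M g"
    using L2_subalg[OF sub(1) f] L2_subalg[OF sub(2) g] by (auto intro: L2_integrable finite_measure_axioms)
qed

text \<open>On \<open>a \<inter> b \<inter> c\<close> the independence of \<open>K\<close> and
  \<open>C\<close> splits off \<open>c\<close>, and that of \<open>A\<close> and \<open>B\<close>
  separates the rest. In the applications \<open>A\<close> and \<open>C\<close> are the fields
  before and after a time interval, \<open>B\<close> is the field of the interval, and
  \<open>K\<close> that of everything up to its end.\<close>

lemma indep_set_join: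
  assumes sub: "subalgebra M A" "subalgebra M B" "subalgebra M C" "subalgebra M K"
    and K: "subalgebra K A" "subalgebra K B"
    and AB: "indep_set (sets A) (sets B)" and KC: "indep_set (sets K) (sets C)"
  shows "indep_set (sets (join_algebra A C)) (sets B)"
proof -
  have "indep_set (rectangles A C) (sets B)"
  proof (rule indep_setI)
    show "rectangles A C \<subseteq> events" by (rule rectangles_sub[OF sub(1,3)])
    show "sets B \<subseteq> events" using sub by (simp add: subalgebra_def)
    fix x b assume x: "x \<in> rectangles A C" and b: "b \<in> sets B"
    then obtain a c where x: "x = a \<inter> c" "a \<in> sets A" "c \<in> sets C"
      by (auto simp: rectangles_def[OF sub(1,3)])
    have ab: "a \<in> sets K" "b \<in> sets K" using x b K by (auto simp: subalgebra_def)
    have "prob (x \<inter> b) = prob ((a \<inter> b) \<inter> c)" by (simp add: x Int_ac)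
    also have "\<dots> = prob (a \<inter> b) * prob c" by (rule indep_setD[OF KC]) (use ab x in auto)
    also have "\<dots> = prob a * prob c * prob b" using indep_setD[OF AB x(2) b] by simp
    also have "prob a * prob c = prob x" using indep_setD[OF KC ab(1) x(3)] x by simp
    finally show "prob (x \<inter> b) = prob x * prob b" .
  qed
  then have "indep_set (sigma_sets (space M) (rectangles A C)) (sigma_sets (space M) (sets B))"
    by (rule indep_set_sigma_sets[OF _ Int_stable_rectangles[OF sub(1,3)]]) (auto simp: Int_stable_def)
  moreover have "sigma_sets (space M) (sets B) = sets B"
    using sub(2) sets.sigma_sets_eq[of B] by (simp add: subalgebra_def)
  ultimately show ?thesis by (simp add: sets_join_rectangles[OF sub(1,3)])
qed

text \<open>Fubini's theorem for the product law of an independent pair: \<open>Y\<close> is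
  integrated out while \<open>X\<close> is held fixed. The weight \<open>z\<close> turns this into a
  statement about the conditional expectation given \<open>A\<close>.\<close>

lemma freeze:
  fixes k :: "'b \<times> 'c \<Rightarrow> real"
  assumes ind: "indep_set (sets A) (sets B)" and sub: "subalgebra M A" "subalgebra M B"
    and X: "X \<in> A \<rightarrow>\<^sub>M S" and Y: "Y \<in> B \<rightarrow>\<^sub>M T"
    and k: "k \<in> borel_measurable (S \<Otimes>\<^sub>M T)" and bd: "\<And>p. \<bar>k p\<bar> \<le> C"
    and z: "z \<in> borel_measurable A" "integrable M z"
  shows "(\<integral>\<omega>. k (X \<omega>, Y \<omega>) * z \<omega> \<partial>M) = (\<integral>\<omega>. (\<integral>y. k (X \<omega>, y) \<partial>distr M T Y) * z \<omega> \<partial>M)"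
proof -
  note [measurable] = k X Y z(1)
  have [measurable]: "X \<in> M \<rightarrow>\<^sub>M S" "Y \<in> M \<rightarrow>\<^sub>M T" "z \<in> borel_measurable M"
    using X Y z sub by (auto intro: measurable_from_subalg)
  \<comment> \<open>\<open>z\<close> travels together with \<open>X\<close>, so that the
    independence of this pair from \<open>Y\<close> covers the weighted integral as well.\<close>
  let ?J = "\<lambda>\<omega>. (z \<omega>, X \<omega>)"
  have "?J \<in> A \<rightarrow>\<^sub>M borel \<Otimes>\<^sub>M S" by measurable
  then have eq: "distr M (borel \<Otimes>\<^sub>M S) ?J \<Otimes>\<^sub>M distr M T Y
      = distr M ((borel \<Otimes>\<^sub>M S) \<Otimes>\<^sub>M T) (\<lambda>\<omega>. (?J \<omega>, Y \<omega>))"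
    by (rule indep_distr_pair[OF ind sub _ Y])
  interpret D1: prob_space "distr M (borel \<Otimes>\<^sub>M S) ?J" by (rule prob_space_distr) measurable
  interpret D2: prob_space "distr M T Y" by (rule prob_space_distr) measurable
  interpret P: pair_prob_space "distr M (borel \<Otimes>\<^sub>M S) ?J" "distr M T Y" ..
  let ?g = "\<lambda>(p, y). k (snd p, y) * fst p"
  have g [measurable]: "?g \<in> borel_measurable ((borel \<Otimes>\<^sub>M S) \<Otimes>\<^sub>M T)" by measurable
  have int: "integrable M (\<lambda>\<omega>. k (X \<omega>, Y \<omega>) * z \<omega>)"
  proof (rule Bochner_Integration.integrable_bound)
    show "integrable M (\<lambda>\<omega>. C * z \<omega>)" using z by simp
    show "AE \<omega> in M. norm (k (X \<omega>, Y \<omega>) * z \<omega>) \<le> norm (C * z \<omega>)"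
      using bd by (auto simp: abs_mult intro!: mult_right_mono order_trans[OF bd abs_ge_self])
  qed measurable
  have int': "integrable (distr M (borel \<Otimes>\<^sub>M S) ?J \<Otimes>\<^sub>M distr M T Y) ?g"
    unfolding eq by (subst integrable_distr_eq) (use int in auto)
  have "(\<integral>\<omega>. k (X \<omega>, Y \<omega>) * z \<omega> \<partial>M) = (\<integral>p. ?g p \<partial>distr M ((borel \<Otimes>\<^sub>M S) \<Otimes>\<^sub>M T) (\<lambda>\<omega>. (?J \<omega>, Y \<omega>)))"
    by (subst integral_distr) auto
  also have "\<dots> = (\<integral>p. (\<integral>y. ?g (p, y) \<partial>distr M T Y) \<partial>distr M (borel \<Otimes>\<^sub>M S) ?J)"
    unfolding eq[symmetric] by (rule P.integral_fst'[OF int', symmetric])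
  also have "\<dots> = (\<integral>\<omega>. (\<integral>y. ?g (?J \<omega>, y) \<partial>distr M T Y) \<partial>M)"
    by (rule integral_distr) measurable
  also have "\<dots> = (\<integral>\<omega>. (\<integral>y. k (X \<omega>, y) \<partial>distr M T Y) * z \<omega> \<partial>M)"
    by simp
  finally show ?thesis .
qed

text \<open>Since \<open>C\<close> is independent of \<open>K\<close>, the function \<open>d\<close>
  sees of \<open>C\<close> only what lies in \<open>CL\<close>. Paired with \<open>d\<close> and a
  factor from \<open>KL\<close>, the indicator of a set of \<open>C\<close> may therefore be
  replaced by its conditional expectation given \<open>CL\<close>, and the claim falls back on the
  assumed orthogonality to \<open>KL\<close> joined with \<open>CL\<close>.\<close>

lemma conditional_orthogonal:
  assumes sub: "subalgebra M K" "subalgebra M C" and ind: "indep_set (sets K) (sets C)"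
    and KL: "subalgebra K KL" and CL: "subalgebra C CL"
    and d: "d \<in> L2 M (join_algebra K CL)"
    and orth: "\<And>w. w \<in> L2 M (join_algebra KL CL) \<Longrightarrow> L2_inner M d w = 0"
    and v: "v \<in> L2 M (join_algebra KL C)"
  shows "L2_inner M d v = 0"
proof -
  have sKL: "subalgebra M KL" and sCL: "subalgebra M CL"
    using sub KL CL by (auto simp: subalgebra_def)
  have sj: "subalgebra M (join_algebra K CL)" "subalgebra M (join_algebra KL CL)"
    by (rule subalgebra_join[OF sub(1) sCL], rule subalgebra_join[OF sKL sCL])
  have dM: "d \<in> L2 M M" by (rule L2_subalg[OF sj(1) d])
  interpret L: sigma_finite_subalgebra M CL by (rule sigma_finite_subalgebra_prob[OF sCL])
  show ?thesis
  proof (rule orthogonal_join[OF sKL sub(2) dM _ v])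
    fix p c assume p: "p \<in> sets KL" and c: "c \<in> sets C"
    have pK: "p \<in> sets K" using p KL by (auto simp: subalgebra_def)
    have [measurable]: "c \<in> events" "p \<in> events" using c p sub sKL by (auto simp: subalgebra_def)
    define \<gamma>0 where "\<gamma>0 = real_cond_exp M CL (indicator c)"
    \<comment> \<open>Clipping to \<open>[0, 1]\<close> alters the conditional expectation only on a
      null set, keeps it \<open>CL\<close>-measurable and bounds it everywhere, so that products
      with it are square integrable.\<close>
    define \<gamma> where "\<gamma> x = max 0 (min 1 (\<gamma>0 x))" for x
    have m0 [measurable]: "\<gamma>0 \<in> borel_measurable CL" by (simp add: \<gamma>0_def)
    have m1: "\<gamma> \<in> borel_measurable CL" unfolding \<gamma>_def by measurable
    have [measurable]: "\<gamma> \<in> borel_measurable M" "\<gamma>0 \<in> borel_measurable M"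
      using measurable_from_subalg[OF sCL m1] measurable_from_subalg[OF sCL m0] .
    have intc: "integrable M (indicator c :: 'a \<Rightarrow> real)" by (simp add: emeasure_eq_measure)
    have "AE x in M. \<gamma>0 x \<ge> 0" "AE x in M. \<gamma>0 x \<le> 1"
      unfolding \<gamma>0_def by (rule L.real_cond_exp_ge_c[OF intc], simp) (rule L.real_cond_exp_le_c[OF intc], simp add: indicator_def)
    then have ae: "AE x in M. \<gamma>0 x = \<gamma> x" by eventually_elim (simp add: \<gamma>_def)
    have \<gamma>L2: "\<gamma> \<in> L2 M CL" by (rule L2_bounded[OF sCL m1, of 1]) (simp add: \<gamma>_def)
    have indL2: "indicator a \<in> L2 M N" if "a \<in> sets N" "subalgebra M N" for a N
      by (rule L2_bounded[OF that(2), of _ 1]) (use that in \<open>auto simp: indicator_def\<close>)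
    have cond: "L2_inner M (indicator l) \<gamma> = L2_inner M (indicator l) (indicator c)" if l: "l \<in> sets CL" for l
    proof -
      have [measurable]: "l \<in> events" using l sCL by (auto simp: subalgebra_def)
      have "L2_inner M (indicator l) \<gamma> = L2_inner M (indicator l) \<gamma>0"
        by (intro integral_cong_AE) (use ae in auto)
      also have "\<dots> = L2_inner M (indicator l) (indicator c)"
        unfolding \<gamma>0_def by (rule L.real_cond_exp_intg(2)) (use l in \<open>auto simp: emeasure_eq_measure simp flip: indicator_inter_arith\<close>)
      finally show ?thesis .
    qed
    have CM: "indicator c \<in> L2 M C" "\<gamma> \<in> L2 M C"
      using indL2[OF c sub(2)] L2_mono[OF CL \<gamma>L2] by auto
    have u: "(\<lambda>x. indicator c x - \<gamma> x) \<in> L2 M C" by (rule L2_diff[OF sub(2) CM])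
    \<comment> \<open>The indicator of \<open>c\<close> minus its conditional expectation is
      orthogonal to the whole of \<open>join_algebra K CL\<close>: on a rectangle
      \<open>k \<inter> l\<close> independence factors out \<open>k\<close>, and the remaining
      factor vanishes by the defining property of conditional expectation.\<close>
    have step1: "(\<integral>x. (indicator c x - \<gamma> x) * w x \<partial>M) = 0" if w: "w \<in> L2 M (join_algebra K CL)" for w
    proof (rule orthogonal_join[OF sub(1) sCL L2_subalg[OF sub(2) u] _ w])
      fix k l assume k: "k \<in> sets K" and l: "l \<in> sets CL"
      have lC: "l \<in> sets C" using l CL by (auto simp: subalgebra_def)
      have [measurable]: "l \<in> events" using l sCL by (auto simp: subalgebra_def)
      have lu: "(\<lambda>x. indicator l x * (indicator c x - \<gamma> x)) \<in> L2 M C"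
      proof (rule L2_bounded[OF sub(2), of _ 1])
        show "(\<lambda>x. indicator l x * (indicator c x - \<gamma> x)) \<in> borel_measurable C"
          using lC L2_measurable[OF u] by measurable
        show "\<bar>indicator l x * (indicator c x - \<gamma> x)\<bar> \<le> 1" for x
          by (auto simp: indicator_def \<gamma>_def)
      qed
      have i: "integrable M (\<lambda>x. indicator l x * indicator c x :: real)" "integrable M (\<lambda>x. indicator l x * \<gamma> x)"
        using integrable_mult_indicator[of l M "indicator c :: 'a \<Rightarrow> real", OF _ intc] integrable_mult_indicator[of l M \<gamma>]
          L2_integrable[OF finite_measure_axioms L2_subalg[OF sCL \<gamma>L2]] by auto
      have "(\<integral>x. indicator (k \<inter> l) x * (indicator c x - \<gamma> x) \<partial>M)
          = (\<integral>x. indicator k x * (indicator l x * (indicator c x - \<gamma> x)) \<partial>M)"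
        by (simp add: indicator_inter_arith mult.assoc)
      also have "\<dots> = (\<integral>x. indicator k x \<partial>M) * (\<integral>x. indicator l x * (indicator c x - \<gamma> x) \<partial>M)"
        by (rule indep_L2_mult[OF ind sub indL2[OF k sub(1)] lu])
      also have "(\<integral>x. indicator l x * (indicator c x - \<gamma> x) \<partial>M) = 0"
        using cond[OF l] i by (simp add: right_diff_distrib)
      finally show "(\<integral>x. indicator (k \<inter> l) x * (indicator c x - \<gamma> x) \<partial>M) = 0" by simp
    qed
    have pj: "p \<in> sets (join_algebra K CL)" "p \<in> sets (join_algebra KL CL)"
      using subalgebra_join_left[OF sub(1) sCL] subalgebra_join_left[OF sKL sCL] pK p by (auto simp: subalgebra_def)
    have pd: "(\<lambda>x. indicator p x * d x) \<in> L2 M (join_algebra K CL)"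
    proof -
      have "integrable M (\<lambda>x. indicator p x * (d x)\<^sup>2)"
        using integrable_mult_indicator[of p M "\<lambda>x. (d x)\<^sup>2"] L2_square[OF d] by simp
      moreover have "(indicator p x * d x)\<^sup>2 = indicator p x * (d x)\<^sup>2" for x by (simp add: indicator_def)
      ultimately show ?thesis using pj(1) L2_measurable[OF d] by (simp add: L2_def)
    qed
    have p\<gamma>: "(\<lambda>x. indicator p x * \<gamma> x) \<in> L2 M (join_algebra KL CL)"
    proof (rule L2_bounded[OF sj(2), of _ 1])
      have "\<gamma> \<in> borel_measurable (join_algebra KL CL)"
        by (rule measurable_from_subalg[OF subalgebra_join_right[OF sKL sCL] m1])
      then show "(\<lambda>x. indicator p x * \<gamma> x) \<in> borel_measurable (join_algebra KL CL)"
        using pj(2) by measurable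
    qed (auto simp: indicator_def \<gamma>_def)
    have i: "integrable M (\<lambda>x. indicator c x * (indicator p x * d x))" "integrable M (\<lambda>x. \<gamma> x * (indicator p x * d x))"
      using L2_integrable_mult[OF L2_subalg[OF sub(2) CM(1)] L2_subalg[OF sj(1) pd]]
        L2_integrable_mult[OF L2_subalg[OF sub(2) CM(2)] L2_subalg[OF sj(1) pd]] .
    have "L2_inner M (indicator (p \<inter> c)) d = (\<integral>x. indicator c x * (indicator p x * d x) \<partial>M)"
      by (simp add: indicator_inter_arith mult_ac)
    also have "\<dots> = (\<integral>x. \<gamma> x * (indicator p x * d x) \<partial>M)"
      using step1[OF pd] i by (simp add: left_diff_distrib)
    also have "\<dots> = (\<integral>x. d x * (indicator p x * \<gamma> x) \<partial>M)" by (simp add: mult_ac)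
    also have "\<dots> = 0" by (rule orth[OF p\<gamma>])
    finally show "L2_inner M (indicator (p \<inter> c)) d = 0" .
  qed
qed

end

section \<open>The first chaos component of a coherent family\<close>

locale noise_space =
  fixes M :: "'w measure" and T :: "real \<Rightarrow> 'w \<Rightarrow> 'w" and F :: "real \<Rightarrow> real \<Rightarrow> 'w measure"
  assumes noise: "noise M T F"

sublocale noise_space \<subseteq> prob_space M
proof -
  have "lebesgue_prob_space M" by (insert noise, unfold noise_def, elim conjE, assumption)
  then show "prob_space M" by (simp add: lebesgue_prob_space_def)
qed

context noise_space
begin

lemma
  shows lebesgue: "lebesgue_prob_space M"
    and flow: "measure_preserving_flow M T"
    and fields: "\<forall>s t. s \<le> t \<longrightarrow> subalgebra M (F s t) \<and> null_sets M \<subseteq> sets (F s t)"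
    and fields_indep: "\<forall>r s t. r \<le> s \<longrightarrow> s \<le> t \<longrightarrow> indep_set (sets (F r s)) (sets (F s t))"
    and fields_generate: "\<forall>r s t. r \<le> s \<longrightarrow> s \<le> t \<longrightarrow>
        sets (F r t) = generated_field M (sets (F r s) \<union> sets (F s t))"
  by (insert noise, unfold noise_def, elim conjE, assumption)+

lemma complete: "complete_measure M"
  using lebesgue by (simp add: lebesgue_prob_space_def)

lemma F_sub: "s \<le> t \<Longrightarrow> subalgebra M (F s t)"
  and F_null: "s \<le> t \<Longrightarrow> null_sets M \<subseteq> sets (F s t)"
  using fields[rule_format, of s t] by simp_all

lemma F_space: "s \<le> t \<Longrightarrow> space (F s t) = space M"
  using F_sub by (simp add: subalgebra_def)

lemma F_indep: "r \<le> s \<Longrightarrow> s \<le> t \<Longrightarrow> indep_set (sets (F r s)) (sets (F s t))"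
  by (rule fields_indep[rule_format])

lemma F_mono:
  assumes "a \<le> s" "s \<le> t" "t \<le> b"
  shows "subalgebra (F a b) (F s t)"
proof -
  have gen: "sets (F r s) \<union> sets (F s t) \<subseteq> sets (F r t)" if "r \<le> s" "s \<le> t" for r s t
  proof -
    have "sets (F r t) = generated_field M (sets (F r s) \<union> sets (F s t))"
      by (rule fields_generate[rule_format, OF that])
    then show ?thesis by (auto simp: generated_field_def)
  qed
  have "sets (F s t) \<subseteq> sets (F a b)"
    using gen[of a s t] gen[of a t b] assms by auto
  then show ?thesis using assms by (simp add: subalgebra_def F_space)
qed

lemma T_measurable [measurable]: "T t \<in> M \<rightarrow>\<^sub>M M"
  and T_distr: "distr M M (T t) = M"
  using flow by (simp_all add: measure_preserving_flow_def)

lemma T_integral: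
  fixes f :: "'w \<Rightarrow> real"
  assumes "f \<in> borel_measurable M"
  shows "(\<integral>\<omega>. f (T t \<omega>) \<partial>M) = (\<integral>\<omega>. f \<omega> \<partial>M)"
  using integral_distr[OF T_measurable[of t] assms] by (simp add: T_distr)

lemma T_L2:
  assumes "f \<in> L2 M M"
  shows "(\<lambda>\<omega>. f (T t \<omega>)) \<in> L2 M M"
proof -
  have [measurable]: "f \<in> borel_measurable M" using assms by (rule L2_measurable)
  have "integrable (distr M M (T t)) (\<lambda>\<omega>. (f \<omega>)\<^sup>2)"
    using L2_square[OF assms] by (simp add: T_distr)
  then show ?thesis by (simp add: L2_def integrable_distr_eq)
qed

lemma L2_F: "f \<in> L2 M (F s t) \<Longrightarrow> s \<le> t \<Longrightarrow> f \<in> L2 M M"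
  by (rule L2_subalg[OF F_sub])

lemma L2_F_mono: "f \<in> L2 M (F s t) \<Longrightarrow> a \<le> s \<Longrightarrow> s \<le> t \<Longrightarrow> t \<le> b \<Longrightarrow> f \<in> L2 M (F a b)"
  by (rule L2_mono[OF F_mono])

lemma F_inner_indep:
  assumes "f \<in> L2 M (F a b)" "g \<in> L2 M (F c d)" "a \<le> b" "b \<le> c" "c \<le> d"
  shows "L2_inner M f g = (\<integral>\<omega>. f \<omega> \<partial>M) * (\<integral>\<omega>. g \<omega> \<partial>M)"
  using assms by (intro indep_L2_mult[OF F_indep[of a b d]] F_sub L2_F_mono[of g c d b d]) auto

text \<open>These are the stationary elements of the first chaos; centring excludes a deterministic
  drift. As for representations, the identities hold almost everywhere, separately for each choice
  of times.\<close>

definition additive_functional :: "(real \<Rightarrow> real \<Rightarrow> 'w \<Rightarrow> real) \<Rightarrow> bool" where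
  "additive_functional Y \<longleftrightarrow>
     (\<forall>s t. s \<le> t \<longrightarrow> Y s t \<in> L2 M (F s t) \<and> (\<integral>\<omega>. Y s t \<omega> \<partial>M) = 0) \<and>
     (\<forall>r s t. r \<le> s \<longrightarrow> s \<le> t \<longrightarrow> (AE \<omega> in M. Y r t \<omega> = Y r s \<omega> + Y s t \<omega>)) \<and>
     (\<forall>r s t. s \<le> t \<longrightarrow> (AE \<omega> in M. Y s t (T r \<omega>) = Y (s + r) (t + r) \<omega>))"

lemma
  assumes Y: "additive_functional Y"
  shows additive_functional_L2: "s \<le> t \<Longrightarrow> Y s t \<in> L2 M (F s t)"
    and additive_functional_mean: "s \<le> t \<Longrightarrow> (\<integral>\<omega>. Y s t \<omega> \<partial>M) = 0"
    and additive_functional_add: "r \<le> s \<Longrightarrow> s \<le> t \<Longrightarrow> AE \<omega> in M. Y r t \<omega> = Y r s \<omega> + Y s t \<omega>"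
    and additive_functional_shift: "s \<le> t \<Longrightarrow> AE \<omega> in M. Y s t (T r \<omega>) = Y (s + r) (t + r) \<omega>"
proof -
  note def = Y[unfolded additive_functional_def]
  note def(1)[THEN conjunct1, rule_format]
  then show "s \<le> t \<Longrightarrow> Y s t \<in> L2 M (F s t)" "s \<le> t \<Longrightarrow> (\<integral>\<omega>. Y s t \<omega> \<partial>M) = 0" by simp_all
  show "r \<le> s \<Longrightarrow> s \<le> t \<Longrightarrow> AE \<omega> in M. Y r t \<omega> = Y r s \<omega> + Y s t \<omega>"
    by (rule def[THEN conjunct2, THEN conjunct1, rule_format])
  show "s \<le> t \<Longrightarrow> AE \<omega> in M. Y s t (T r \<omega>) = Y (s + r) (t + r) \<omega>"
    by (rule def[THEN conjunct2, THEN conjunct2, rule_format])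
qed

end

text \<open>\<open>coherent\<close> says that \<open>\<phi> u v\<close> is the orthogonal projection
  of \<open>\<phi> s t\<close> on the functions of \<open>F u v\<close>. The model is the family of
  centred conditional expectations of one variable attached to an interval of length
  \<open>\<epsilon>\<close>, which explains the restriction on lengths; the projection must depend
  on \<open>[u, v]\<close> alone and not on the surrounding interval.\<close>

locale coherent_family = noise_space +
  fixes \<phi> :: "real \<Rightarrow> real \<Rightarrow> 'a \<Rightarrow> real" and \<epsilon> :: real
  assumes eps: "\<epsilon> > 0"
    and L2_phi: "s \<le> t \<Longrightarrow> t \<le> s + \<epsilon> \<Longrightarrow> \<phi> s t \<in> L2 M (F s t)"
    and mean_phi: "s \<le> t \<Longrightarrow> t \<le> s + \<epsilon> \<Longrightarrow> (\<integral>\<omega>. \<phi> s t \<omega> \<partial>M) = 0"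
    and coherent: "s \<le> u \<Longrightarrow> u \<le> v \<Longrightarrow> v \<le> t \<Longrightarrow> t \<le> s + \<epsilon> \<Longrightarrow> \<eta> \<in> L2 M (F u v) \<Longrightarrow>
      (L2_inner M (\<phi> s t) \<eta>) = L2_inner M (\<phi> u v) \<eta>"
    and shift_phi: "s \<le> t \<Longrightarrow> t \<le> s + \<epsilon> \<Longrightarrow> AE \<omega> in M. \<phi> s t (T r \<omega>) = \<phi> (s + r) (t + r) \<omega>"
begin

lemma L2_phi_M: "s \<le> t \<Longrightarrow> t \<le> s + \<epsilon> \<Longrightarrow> \<phi> s t \<in> L2 M M"
  by (rule L2_F[OF L2_phi])

text \<open>\<open>F u u\<close> is independent of itself, so a centred square integrable function
  measurable for it has norm zero. The degenerate blocks produced by clipping a grid thus contribute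
  nothing.\<close>

lemma phi_self: "AE \<omega> in M. \<phi> u u \<omega> = 0"
proof (rule L2_zero_AE)
  have e: "u \<le> u + \<epsilon>" using eps by simp
  show "\<phi> u u \<in> L2 M M" by (rule L2_phi_M[OF order_refl e])
  show "sq_norm M (\<phi> u u) = 0"
    using F_inner_indep[OF L2_phi[OF order_refl e] L2_phi[OF order_refl e]] mean_phi[OF order_refl e]
    by (simp add: power2_eq_square)
qed

lemma phi_inner: "s \<le> u \<Longrightarrow> u \<le> v \<Longrightarrow> v \<le> t \<Longrightarrow> t \<le> s + \<epsilon> \<Longrightarrow>
    (L2_inner M (\<phi> s t) (\<phi> u v)) = sq_norm M (\<phi> u v)"
  by (subst coherent[of s u v t]) (auto intro!: L2_phi simp: power2_eq_square)

lemma phi_norm_mono: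
  assumes "s \<le> u" "u \<le> v" "v \<le> t" "t \<le> s + \<epsilon>"
  shows "sq_norm M (\<phi> u v) \<le> sq_norm M (\<phi> s t)"
proof -
  have "0 \<le> sq_dist M (\<phi> s t) (\<phi> u v)" by simp
  also have "\<dots> = sq_norm M (\<phi> s t) - sq_norm M (\<phi> u v)"
    using assms by (subst L2_square_expand) (auto intro!: L2_phi_M simp: phi_inner)
  finally show ?thesis by simp
qed

lemma phi_norm_shift:
  assumes "s \<le> t" "t \<le> s + \<epsilon>"
  shows "sq_norm M (\<phi> (s + r) (t + r)) = sq_norm M (\<phi> s t)"
proof -
  have [measurable]: "\<phi> s t \<in> borel_measurable M" "\<phi> (s + r) (t + r) \<in> borel_measurable M"
    using assms by (auto intro!: L2_measurable[OF L2_phi_M])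
  have "sq_norm M (\<phi> (s + r) (t + r)) = (\<integral>\<omega>. (\<phi> s t (T r \<omega>))\<^sup>2 \<partial>M)"
    using shift_phi[OF assms, of r] by (intro integral_cong_AE) (auto elim: eventually_mono)
  then show ?thesis by (simp add: T_integral[of "\<lambda>\<omega>. (\<phi> s t \<omega>)\<^sup>2"])
qed

section \<open>Sums over partitions and over dyadic grids\<close>

definition part_sum :: "(nat \<Rightarrow> real) \<Rightarrow> nat \<Rightarrow> 'a \<Rightarrow> real" where
  "part_sum q n \<omega> = (\<Sum>k<n. \<phi> (q k) (q (Suc k)) \<omega>)"

text \<open>The sequence is infinite and may be constant on stretches. A finite partition is an
  initial segment of it, and clipped grids fit in without special treatment of their ends.\<close>

definition partition :: "(nat \<Rightarrow> real) \<Rightarrow> bool" where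
  "partition q \<longleftrightarrow> (\<forall>k. q k \<le> q (Suc k) \<and> q (Suc k) \<le> q k + \<epsilon>)"

lemma partition_mono: "partition q \<Longrightarrow> i \<le> j \<Longrightarrow> q i \<le> q j"
  using lift_Suc_mono_le[of q i j] by (simp add: partition_def)

lemma L2_block: "partition q \<Longrightarrow> \<phi> (q k) (q (Suc k)) \<in> L2 M (F (q k) (q (Suc k)))"
  by (rule L2_phi) (auto simp: partition_def)

lemma L2_block_M: "partition q \<Longrightarrow> \<phi> (q k) (q (Suc k)) \<in> L2 M M"
  by (rule L2_phi_M) (auto simp: partition_def)

lemma L2_part_sum:
  assumes q: "partition q"
  shows "part_sum q n \<in> L2 M (F (q 0) (q n))"
proof -
  have "(\<lambda>\<omega>. \<Sum>k<n. \<phi> (q k) (q (Suc k)) \<omega>) \<in> L2 M (F (q 0) (q n))"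
  proof (rule L2_sum[OF finite_measure_axioms F_sub])
    show "q 0 \<le> q n" by (rule partition_mono[OF q]) simp
    fix k assume "k \<in> {..<n}"
    then show "\<phi> (q k) (q (Suc k)) \<in> L2 M (F (q 0) (q n))"
      by (intro L2_F_mono[OF L2_block[OF q]] partition_mono[OF q]) auto
  qed
  then show ?thesis unfolding part_sum_def[abs_def] .
qed

lemma L2_part_sum_M: "partition q \<Longrightarrow> part_sum q n \<in> L2 M M"
  by (rule L2_F[OF L2_part_sum partition_mono]) auto

text \<open>Only the block that contains \<open>[u, v]\<close> contributes. There coherence applies;
  every other block is independent of the centred function \<open>\<eta>\<close>.\<close>

lemma part_sum_inner:
  assumes q: "partition q" and k: "k < n" and uv: "q k \<le> u" "u \<le> v" "v \<le> q (Suc k)"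
    and \<eta>: "\<eta> \<in> L2 M (F u v)" "(\<integral>\<omega>. \<eta> \<omega> \<partial>M) = 0"
  shows "L2_inner M (part_sum q n) \<eta> = L2_inner M (\<phi> u v) \<eta>"
proof -
  have \<eta>M: "\<eta> \<in> L2 M M" using \<eta>(1) uv(2) by (rule L2_F)
  have "L2_inner M (part_sum q n) \<eta> = (\<integral>\<omega>. (\<Sum>i<n. \<phi> (q i) (q (Suc i)) \<omega> * \<eta> \<omega>) \<partial>M)"
    by (simp add: part_sum_def sum_distrib_right)
  also have "\<dots> = (\<Sum>i<n. \<integral>\<omega>. \<phi> (q i) (q (Suc i)) \<omega> * \<eta> \<omega> \<partial>M)"
    by (intro Bochner_Integration.integral_sum L2_integrable_mult[OF L2_block_M[OF q] \<eta>M])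
  also have "\<dots> = (\<Sum>i<n. if i = k then \<integral>\<omega>. \<phi> u v \<omega> * \<eta> \<omega> \<partial>M else 0)"
  proof (rule sum.cong[OF refl])
    fix i
    consider "i = k" | "i < k" | "i > k" by linarith
    then show "L2_inner M (\<phi> (q i) (q (Suc i))) \<eta> = (if i = k then \<integral>\<omega>. \<phi> u v \<omega> * \<eta> \<omega> \<partial>M else 0)"
    proof cases
      case 1
      then show ?thesis using coherent[OF uv _ \<eta>(1)] q by (simp add: partition_def)
    next
      case 2
      then have "q (Suc i) \<le> u" using partition_mono[OF q, of "Suc i" k] uv by simp
      then have "L2_inner M (\<phi> (q i) (q (Suc i))) \<eta> = 0"
        using q uv by (subst F_inner_indep[OF L2_block[OF q] \<eta>(1)]) (auto simp: partition_def \<eta>)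
      then show ?thesis using 2 by simp
    next
      case 3
      then have "v \<le> q i" using partition_mono[OF q, of "Suc k" i] uv by simp
      then have "L2_inner M \<eta> (\<phi> (q i) (q (Suc i))) = 0"
        using q uv by (subst F_inner_indep[OF \<eta>(1) L2_block[OF q]]) (auto simp: partition_def \<eta>)
      then show ?thesis using 3 by (simp add: mult.commute)
    qed
  qed
  also have "\<dots> = L2_inner M (\<phi> u v) \<eta>" using k by simp
  finally show ?thesis .
qed

lemma part_sum_norm:
  assumes q: "partition q"
  shows "sq_norm M (part_sum q n) = (\<Sum>k<n. \<integral>\<omega>. (\<phi> (q k) (q (Suc k)) \<omega>)\<^sup>2 \<partial>M)"
proof -
  have "sq_norm M (part_sum q n) = (\<integral>\<omega>. (\<Sum>k<n. part_sum q n \<omega> * \<phi> (q k) (q (Suc k)) \<omega>) \<partial>M)"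
    by (simp add: part_sum_def power2_eq_square sum_distrib_left)
  also have "\<dots> = (\<Sum>k<n. \<integral>\<omega>. part_sum q n \<omega> * \<phi> (q k) (q (Suc k)) \<omega> \<partial>M)"
    by (intro Bochner_Integration.integral_sum L2_integrable_mult L2_part_sum_M L2_block_M q)
  also have "\<dots> = (\<Sum>k<n. \<integral>\<omega>. (\<phi> (q k) (q (Suc k)) \<omega>)\<^sup>2 \<partial>M)"
    using q by (intro sum.cong refl, subst part_sum_inner[OF q _ order_refl _ order_refl L2_block[OF q]])
      (auto simp: partition_def mean_phi power2_eq_square)
  finally show ?thesis .
qed

lemma phi_part_sum_inner:
  assumes q: "partition q" and st: "q 0 = s" "q n = t" "t \<le> s + \<epsilon>"
    and \<eta>: "\<And>k. k < n \<Longrightarrow> \<eta> k \<in> L2 M (F (q k) (q (Suc k)))"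
  shows "(\<integral>\<omega>. \<phi> s t \<omega> * (\<Sum>k<n. \<eta> k \<omega>) \<partial>M) = (\<Sum>k<n. \<integral>\<omega>. \<phi> (q k) (q (Suc k)) \<omega> * \<eta> k \<omega> \<partial>M)"
proof -
  have st': "s \<le> t" using partition_mono[OF q, of 0 n] st by simp
  have \<eta>M: "\<eta> k \<in> L2 M M" if "k < n" for k
    by (rule L2_F[OF \<eta>[OF that]]) (use q in \<open>simp add: partition_def\<close>)
  have "(\<integral>\<omega>. \<phi> s t \<omega> * (\<Sum>k<n. \<eta> k \<omega>) \<partial>M) = (\<integral>\<omega>. (\<Sum>k<n. \<phi> s t \<omega> * \<eta> k \<omega>) \<partial>M)"
    by (simp add: sum_distrib_left)
  also have "\<dots> = (\<Sum>k<n. \<integral>\<omega>. \<phi> s t \<omega> * \<eta> k \<omega> \<partial>M)"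
    by (intro Bochner_Integration.integral_sum L2_integrable_mult L2_phi_M st' st \<eta>M) auto
  also have "\<dots> = (\<Sum>k<n. \<integral>\<omega>. \<phi> (q k) (q (Suc k)) \<omega> * \<eta> k \<omega> \<partial>M)"
  proof (intro sum.cong refl coherent)
    fix k assume k: "k \<in> {..<n}"
    show "s \<le> q k" "q (Suc k) \<le> t"
      using partition_mono[OF q, of 0 k] partition_mono[OF q, of "Suc k" n] k st by auto
    show "q k \<le> q (Suc k)" using q by (simp add: partition_def)
  qed (use st \<eta> in auto)
  finally show ?thesis .
qed

text \<open>\<open>part_sum q n\<close> has with \<open>\<phi> s t\<close> the same inner product as
  with itself, so it is a projection of \<open>\<phi> s t\<close> and not longer than it; its
  squared norm is the sum over the blocks. All bounds linear in the length of an interval originate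
  here.\<close>

lemma phi_superadditive:
  assumes q: "partition q" and st: "q 0 = s" "q n = t" "t \<le> s + \<epsilon>"
  shows "(\<Sum>k<n. \<integral>\<omega>. (\<phi> (q k) (q (Suc k)) \<omega>)\<^sup>2 \<partial>M) \<le> sq_norm M (\<phi> s t)"
proof -
  have st': "s \<le> t" using partition_mono[OF q, of 0 n] st by simp
  have "L2_inner M (\<phi> s t) (part_sum q n) = (\<Sum>k<n. \<integral>\<omega>. (\<phi> (q k) (q (Suc k)) \<omega>)\<^sup>2 \<partial>M)"
    unfolding part_sum_def by (subst phi_part_sum_inner[OF q st L2_block[OF q]]) (simp add: power2_eq_square)
  then have "sq_dist M (\<phi> s t) (part_sum q n)
      = sq_norm M (\<phi> s t) - (\<Sum>k<n. \<integral>\<omega>. (\<phi> (q k) (q (Suc k)) \<omega>)\<^sup>2 \<partial>M)"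
    using L2_square_expand[OF L2_phi_M[OF st' st(3)] L2_part_sum_M[OF q, of n]] part_sum_norm[OF q, of n] by simp
  moreover have "0 \<le> sq_dist M (\<phi> s t) (part_sum q n)" by simp
  ultimately show ?thesis by linarith
qed

definition grid :: "real \<Rightarrow> nat \<Rightarrow> nat \<Rightarrow> real" where
  "grid b m k = b + real k * (\<epsilon> / 2 ^ m)"

definition clamp :: "real \<Rightarrow> real \<Rightarrow> real \<Rightarrow> real" where
  "clamp s t x = max s (min t x)"

lemma grid_mono: "i \<le> j \<Longrightarrow> grid b m i \<le> grid b m j"
  using eps by (auto simp: grid_def divide_right_mono mult_right_mono)

lemma grid_Suc: "grid b m (Suc k) = grid b m k + \<epsilon> / 2 ^ m"
  by (simp add: grid_def algebra_simps add_divide_distrib)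

lemma grid_refine: "m \<le> m' \<Longrightarrow> grid b m k = grid b m' (k * 2 ^ (m' - m))"
  using power_add[of "2::real" "m' - m" m] by (simp add: grid_def field_simps)

lemma step_le_eps: "\<epsilon> / 2 ^ m \<le> \<epsilon>"
  using eps by (simp add: field_simps)

lemma clamp_mono: "x \<le> y \<Longrightarrow> clamp s t x \<le> clamp s t y"
  by (auto simp: clamp_def)

lemma clamp_step: "x \<le> y \<Longrightarrow> y \<le> x + d \<Longrightarrow> clamp s t y \<le> clamp s t x + d"
  by (auto simp: clamp_def)

lemma partition_grid: "partition (\<lambda>k. clamp s t (grid b m k))"
  unfolding partition_def
proof (intro allI conjI)
  fix k
  show "clamp s t (grid b m k) \<le> clamp s t (grid b m (Suc k))"
    by (intro clamp_mono grid_mono) simp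
  have "grid b m (Suc k) \<le> grid b m k + \<epsilon>" using step_le_eps[of m] by (simp add: grid_Suc)
  then show "clamp s t (grid b m (Suc k)) \<le> clamp s t (grid b m k) + \<epsilon>"
    by (intro clamp_step grid_mono) auto
qed

text \<open>The grid has an external base point \<open>b\<close>, covers a window of length
  \<open>N * \<epsilon>\<close> and is clipped to \<open>[s, t]\<close>. Adjacent intervals can then
  share one grid, so that their sums are comparable block by block.\<close>

definition S :: "real \<Rightarrow> nat \<Rightarrow> real \<Rightarrow> real \<Rightarrow> nat \<Rightarrow> 'a \<Rightarrow> real" where
  "S b N s t m = part_sum (\<lambda>k. clamp s t (grid b m k)) (N * 2 ^ m)"

lemma L2_S:
  assumes "s \<le> t"
  shows "S b N s t m \<in> L2 M (F s t)"
proof -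
  have "clamp s t (grid b m 0) \<le> clamp s t (grid b m (N * 2 ^ m))"
    by (intro clamp_mono grid_mono) simp
  then show ?thesis unfolding S_def
    by (intro L2_F_mono[OF L2_part_sum[OF partition_grid]]) (use assms in \<open>auto simp: clamp_def\<close>)
qed

lemma L2_S_M: "S b N s t m \<in> L2 M M"
  unfolding S_def by (rule L2_part_sum_M[OF partition_grid])

text \<open>Every fine block lies in one coarse block, so the coarse sum pairs with it as the block
  pairs with itself. The finer sum is therefore a projection of the coarser one.\<close>

lemma S_nested:
  assumes "m \<le> m'"
  shows "L2_inner M (S b N s t m) (S b N s t m') = sq_norm M (S b N s t m')"
proof -
  let ?q = "\<lambda>k. clamp s t (grid b m k)" and ?q' = "\<lambda>k. clamp s t (grid b m' k)"
  have "L2_inner M (S b N s t m) (S b N s t m')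
      = (\<integral>\<omega>. (\<Sum>j<N * 2 ^ m'. part_sum ?q (N * 2 ^ m) \<omega> * \<phi> (?q' j) (?q' (Suc j)) \<omega>) \<partial>M)"
    by (simp add: S_def part_sum_def[of ?q'] sum_distrib_left)
  also have "\<dots> = (\<Sum>j<N * 2 ^ m'. \<integral>\<omega>. part_sum ?q (N * 2 ^ m) \<omega> * \<phi> (?q' j) (?q' (Suc j)) \<omega> \<partial>M)"
    by (intro Bochner_Integration.integral_sum L2_integrable_mult L2_part_sum_M L2_block_M partition_grid)
  also have "\<dots> = (\<Sum>j<N * 2 ^ m'. \<integral>\<omega>. (\<phi> (?q' j) (?q' (Suc j)) \<omega>)\<^sup>2 \<partial>M)"
  proof (rule sum.cong[OF refl])
    fix j assume j: "j \<in> {..<N * 2 ^ m'}"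
    \<comment> \<open>A coarse cell consists of \<open>d\<close> fine cells, and the fine cell
      \<open>j\<close> lies in the coarse cell \<open>j div d\<close>.\<close>
    define d where "d = (2::nat) ^ (m' - m)"
    have d: "2 ^ m' = 2 ^ m * d" "d > 0"
      using assms by (auto simp: d_def simp flip: power_add)
    define k where "k = j div d"
    have "j < N * 2 ^ m * d" using j d by (simp add: mult.assoc)
    then have k: "k < N * 2 ^ m" using d by (simp add: k_def less_mult_imp_div_less)
    have kj: "k * d \<le> j" "Suc j \<le> Suc k * d"
      using d by (auto simp: k_def dividend_less_div_times Suc_le_eq)
    have "L2_inner M (part_sum ?q (N * 2 ^ m)) (\<phi> (?q' j) (?q' (Suc j)))
        = L2_inner M (\<phi> (?q' j) (?q' (Suc j))) (\<phi> (?q' j) (?q' (Suc j)))"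
    proof (rule part_sum_inner[OF partition_grid k _ _ _ L2_block[OF partition_grid]])
      show "?q k \<le> ?q' j" "?q' (Suc j) \<le> ?q (Suc k)"
        unfolding grid_refine[OF assms] using kj by (auto simp: d_def intro!: clamp_mono grid_mono)
      show "?q' j \<le> ?q' (Suc j)" using partition_grid by (simp add: partition_def)
      show "(\<integral>\<omega>. \<phi> (?q' j) (?q' (Suc j)) \<omega> \<partial>M) = 0"
        using partition_grid[of s t b m'] by (intro mean_phi) (auto simp: partition_def)
    qed
    then show "L2_inner M (part_sum ?q (N * 2 ^ m)) (\<phi> (?q' j) (?q' (Suc j)))
        = sq_norm M (\<phi> (?q' j) (?q' (Suc j)))" by (simp add: power2_eq_square)
  qed
  also have "\<dots> = sq_norm M (S b N s t m')"
    unfolding S_def by (rule part_sum_norm[OF partition_grid, symmetric])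
  finally show ?thesis .
qed

lemma S_diff_norm:
  assumes "m \<le> m'"
  shows "sq_dist M (S b N s t m) (S b N s t m')
    = sq_norm M (S b N s t m) - sq_norm M (S b N s t m')"
  using L2_square_expand[OF L2_S_M L2_S_M] S_nested[OF assms] by simp

text \<open>The squared norms decrease in \<open>m\<close> and are nonnegative, and the squared
  distance of two sums is the difference of their squared norms; hence the sums form a Cauchy
  sequence.\<close>

lemma S_limit_exists:
  assumes "s \<le> t"
  shows "\<exists>Y\<in>L2 M (F s t). (\<lambda>m. \<integral>\<omega>. (S b N s t m \<omega> - Y \<omega>)\<^sup>2 \<partial>M) \<longlonglongrightarrow> 0"
proof (rule L2_complete[OF F_sub[OF assms] L2_S[OF assms]])
  fix e :: real assume e: "e > 0"
  define a where "a m = sq_norm M (S b N s t m)" for m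
  have dec: "decseq a"
  proof (rule decseq_SucI)
    fix m
    have "0 \<le> sq_dist M (S b N s t m) (S b N s t (Suc m))" by simp
    then show "a (Suc m) \<le> a m" using S_diff_norm[of m "Suc m"] by (simp add: a_def)
  qed
  have "Bseq a"
    by (rule decseq_bounded[OF dec, of 0]) (simp add: a_def)
  then have "convergent a" using dec by (intro Bseq_monoseq_convergent) (auto simp: monoseq_iff)
  then have "Cauchy a" by (rule convergent_Cauchy)
  then have "\<exists>k. \<forall>m\<ge>k. \<forall>n\<ge>k. \<bar>a m - a n\<bar> < e"
    using e unfolding Cauchy_def dist_real_def by blast
  then obtain k where k: "\<And>m n. m \<ge> k \<Longrightarrow> n \<ge> k \<Longrightarrow> \<bar>a m - a n\<bar> < e" by blast
  have "sq_dist M (S b N s t m) (S b N s t n) < e" if "m \<ge> k" "n \<ge> k" for m n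
  proof (cases "m \<le> n")
    case True
    then show ?thesis using S_diff_norm[OF True, of b N s t] k[OF that] by (simp add: a_def)
  next
    case False
    then have "n \<le> m" by simp
    then show ?thesis using S_diff_norm[OF \<open>n \<le> m\<close>, of b N s t] k[OF that]
      by (simp add: a_def power2_commute)
  qed
  then show "\<exists>k. \<forall>m\<ge>k. \<forall>n\<ge>k. sq_dist M (S b N s t m) (S b N s t n) < e" by blast
qed

section \<open>Limits along dyadic grids: additivity and independence of the grid\<close>

definition Yw :: "real \<Rightarrow> nat \<Rightarrow> real \<Rightarrow> real \<Rightarrow> 'a \<Rightarrow> real" where
  "Yw b N s t = (SOME Y. Y \<in> L2 M (F s t) \<and> (\<lambda>m. \<integral>\<omega>. (S b N s t m \<omega> - Y \<omega>)\<^sup>2 \<partial>M) \<longlonglongrightarrow> 0)"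

lemma
  assumes "s \<le> t"
  shows L2_Yw: "Yw b N s t \<in> L2 M (F s t)"
    and Yw_limit: "(\<lambda>m. \<integral>\<omega>. (S b N s t m \<omega> - Yw b N s t \<omega>)\<^sup>2 \<partial>M) \<longlonglongrightarrow> 0"
  using someI_ex[OF S_limit_exists[OF assms, of b N, unfolded Bex_def]] by (auto simp: Yw_def)

lemma L2_Yw_M: "s \<le> t \<Longrightarrow> Yw b N s t \<in> L2 M M"
  by (rule L2_F[OF L2_Yw])

lemma mean_Yw:
  assumes "s \<le> t"
  shows "(\<integral>\<omega>. Yw b N s t \<omega> \<partial>M) = 0"
proof -
  have "(\<lambda>m. \<integral>\<omega>. S b N s t m \<omega> * 1 \<partial>M) \<longlonglongrightarrow> (\<integral>\<omega>. Yw b N s t \<omega> * 1 \<partial>M)"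
    using assms by (intro L2_tendsto_inner L2_S_M L2_Yw_M Yw_limit L2_const finite_measure_axioms)
  moreover have "(\<integral>\<omega>. S b N s t m \<omega> \<partial>M) = 0" for m
  proof -
    let ?q = "\<lambda>k. clamp s t (grid b m k)"
    have "(\<integral>\<omega>. S b N s t m \<omega> \<partial>M) = (\<Sum>k<N * 2 ^ m. \<integral>\<omega>. \<phi> (?q k) (?q (Suc k)) \<omega> \<partial>M)"
      unfolding S_def part_sum_def
      by (intro Bochner_Integration.integral_sum L2_integrable L2_block_M partition_grid finite_measure_axioms)
    also have "\<dots> = 0"
      using partition_grid[of s t b m] by (intro sum.neutral ballI mean_phi) (auto simp: partition_def)
    finally show ?thesis .
  qed
  ultimately show ?thesis by (simp add: LIMSEQ_const_iff)
qed

text \<open>The \<open>2 ^ m\<close> dyadic cells of \<open>[0, \<epsilon>]\<close> have equal norms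
  by stationarity, so superadditivity leaves each at most the \<open>2 ^ m\<close>-th part of the
  total. Shorter intervals have smaller norms.\<close>

lemma phi_small:
  assumes "u \<le> v" "v \<le> u + \<epsilon> / 2 ^ m"
  shows "sq_norm M (\<phi> u v) \<le> sq_norm M (\<phi> 0 \<epsilon>) / 2 ^ m"
proof -
  have pg: "partition (grid 0 m)"
    using step_le_eps[of m] eps by (auto simp: partition_def grid_Suc)
  have "(\<Sum>k<2 ^ m. \<integral>\<omega>. (\<phi> (grid 0 m k) (grid 0 m (Suc k)) \<omega>)\<^sup>2 \<partial>M) \<le> sq_norm M (\<phi> 0 \<epsilon>)"
    by (rule phi_superadditive[OF pg]) (auto simp: grid_def)
  moreover have "sq_norm M (\<phi> (grid 0 m k) (grid 0 m (Suc k))) = sq_norm M (\<phi> 0 (\<epsilon> / 2 ^ m))" for k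
    using phi_norm_shift[of 0 "\<epsilon> / 2 ^ m" "grid 0 m k"] eps step_le_eps[of m] by (simp add: grid_Suc add.commute)
  ultimately have "2 ^ m * sq_norm M (\<phi> 0 (\<epsilon> / 2 ^ m)) \<le> sq_norm M (\<phi> 0 \<epsilon>)"
    by simp
  moreover have "sq_norm M (\<phi> u v) \<le> sq_norm M (\<phi> 0 (\<epsilon> / 2 ^ m))"
  proof -
    have "sq_norm M (\<phi> u v) \<le> sq_norm M (\<phi> u (u + \<epsilon> / 2 ^ m))"
      using assms step_le_eps[of m] by (intro phi_norm_mono) auto
    also have "\<dots> = sq_norm M (\<phi> 0 (\<epsilon> / 2 ^ m))"
      using phi_norm_shift[of 0 "\<epsilon> / 2 ^ m" u] eps step_le_eps[of m] by (simp add: add.commute)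
    finally show ?thesis .
  qed
  ultimately have "2 ^ m * sq_norm M (\<phi> u v) \<le> sq_norm M (\<phi> 0 \<epsilon>)"
    by (rule_tac order_trans[OF mult_left_mono]) auto
  then show ?thesis by (simp add: pos_le_divide_eq mult.commute)
qed

lemma clamp_split:
  assumes "r \<le> s" "s \<le> t" "x \<le> y" "y \<le> s \<or> s \<le> x"
  shows "AE \<omega> in M. \<phi> (clamp r t x) (clamp r t y) \<omega>
    - (\<phi> (clamp r s x) (clamp r s y) \<omega> + \<phi> (clamp s t x) (clamp s t y) \<omega>) = 0"
  using assms(4)
proof
  assume "y \<le> s"
  then have "clamp r s x = clamp r t x" "clamp r s y = clamp r t y" "clamp s t x = s" "clamp s t y = s"
    using assms by (auto simp: clamp_def)
  then show ?thesis using phi_self[of s] by simp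
next
  assume "s \<le> x"
  then have "clamp s t x = clamp r t x" "clamp s t y = clamp r t y" "clamp r s x = s" "clamp r s y = s"
    using assms by (auto simp: clamp_def)
  then show ?thesis using phi_self[of s] by simp
qed

text \<open>A cell on one side of \<open>s\<close> occurs in the sum over \<open>[r, t]\<close> and
  in one of the other two sums, up to degenerate blocks. Only a cell across \<open>s\<close> leaves
  an error, made of three terms of squared norm at most \<open>V / 2 ^ m\<close>. The factor is
  \<open>10 = 2 + 2 * (2 + 2)\<close>, from two uses of the inequality for the square of a
  sum.\<close>

lemma S_almost_additive:
  assumes "r \<le> s" "s \<le> t"
  shows "(\<integral>\<omega>. (S b N r t m \<omega> - (S b N r s m \<omega> + S b N s t m \<omega>))\<^sup>2 \<partial>M) \<le> 10 * sq_norm M (\<phi> 0 \<epsilon>) / 2 ^ m"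
proof -
  define V where "V = sq_norm M (\<phi> 0 \<epsilon>)"
  have V: "V \<ge> 0" by (simp add: V_def)
  \<comment> \<open>Index of the grid cell containing \<open>s\<close>. For \<open>s < b\<close> the
    negative floor becomes \<open>0\<close> under \<open>nat\<close>, and the cells with index at
    least \<open>1\<close> still lie to the right of \<open>s\<close>.\<close>
  define k0 where "k0 = nat \<lfloor>(s - b) / (\<epsilon> / 2 ^ m)\<rfloor>"
  define err where "err k \<omega> = \<phi> (clamp r t (grid b m k)) (clamp r t (grid b m (Suc k))) \<omega>
    - (\<phi> (clamp r s (grid b m k)) (clamp r s (grid b m (Suc k))) \<omega>
     + \<phi> (clamp s t (grid b m k)) (clamp s t (grid b m (Suc k))) \<omega>)" for k \<omega>
  have L2e: "err k \<in> L2 M M" for k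
    unfolding err_def by (intro L2_diff L2_add L2_block_M[OF partition_grid] sub_refl)
  have sum_eq: "S b N r t m \<omega> - (S b N r s m \<omega> + S b N s t m \<omega>) = (\<Sum>k<N * 2 ^ m. err k \<omega>)" for \<omega>
    by (simp add: S_def part_sum_def err_def sum_subtractf sum.distrib)
  have hpos: "\<epsilon> / 2 ^ m > 0" using eps by simp
  have ae0: "AE \<omega> in M. err k \<omega> = 0" if "k \<noteq> k0" for k
    unfolding err_def
  proof (rule clamp_split[OF assms])
    show "grid b m k \<le> grid b m (Suc k)" by (rule grid_mono) simp
    show "grid b m (Suc k) \<le> s \<or> s \<le> grid b m k"
    proof (cases "k < k0")
      case True
      then have "real (Suc k) \<le> real k0" by simp
      also have "\<dots> \<le> (s - b) / (\<epsilon> / 2 ^ m)"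
      proof -
        have "k0 > 0" using True by simp
        then have "\<lfloor>(s - b) / (\<epsilon> / 2 ^ m)\<rfloor> > 0" by (simp add: k0_def)
        then have "real k0 = of_int \<lfloor>(s - b) / (\<epsilon> / 2 ^ m)\<rfloor>" by (simp add: k0_def)
        then show ?thesis by (metis of_int_floor_le)
      qed
      finally have "real (Suc k) * (\<epsilon> / 2 ^ m) \<le> s - b" using pos_le_divide_eq[OF hpos] by blast
      then show ?thesis unfolding grid_def by linarith
    next
      case False
      then have "k \<ge> Suc k0" using that by simp
      then have "real k \<ge> real k0 + 1" by linarith
      moreover have "real k0 + 1 > (s - b) / (\<epsilon> / 2 ^ m)" unfolding k0_def by linarith
      ultimately have "real k > (s - b) / (\<epsilon> / 2 ^ m)" by linarith
      then have "s - b \<le> real k * (\<epsilon> / 2 ^ m)" using pos_divide_less_eq[OF hpos] by (simp add: less_imp_le)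
      then show ?thesis unfolding grid_def by linarith
    qed
  qed
  have small: "sq_norm M (\<phi> (clamp s' t' (grid b m k)) (clamp s' t' (grid b m (Suc k)))) \<le> V / 2 ^ m" for s' t' k
    unfolding V_def by (rule phi_small)
      (use hpos in \<open>auto intro!: clamp_mono grid_mono clamp_step simp: grid_Suc\<close>)
  have e1: "sq_norm M (err k) \<le> 10 * V / 2 ^ m" for k
  proof -
    let ?a = "\<phi> (clamp r t (grid b m k)) (clamp r t (grid b m (Suc k)))"
    let ?b = "\<phi> (clamp r s (grid b m k)) (clamp r s (grid b m (Suc k)))"
    let ?c = "\<phi> (clamp s t (grid b m k)) (clamp s t (grid b m (Suc k)))"
    have L: "?a \<in> L2 M M" "?b \<in> L2 M M" "?c \<in> L2 M M" by (rule L2_block_M[OF partition_grid])+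
    have "sq_norm M (err k) \<le> 2 * sq_norm M ?a + 2 * (\<integral>\<omega>. (?b \<omega> + ?c \<omega>)\<^sup>2 \<partial>M)"
      unfolding err_def by (rule L2_diff_le[OF L(1) L2_add[OF sub_refl L(2,3)]])
    moreover have "(\<integral>\<omega>. (?b \<omega> + ?c \<omega>)\<^sup>2 \<partial>M) \<le> 2 * sq_norm M ?b + 2 * sq_norm M ?c"
      by (rule L2_add_le[OF L(2,3)])
    moreover define v where "v = V / 2 ^ m"
    ultimately have "sq_norm M (err k) \<le> 10 * v"
      using small[of r t k, folded v_def] small[of r s k, folded v_def] small[of s t k, folded v_def] by linarith
    then show ?thesis by (simp add: v_def)
  qed
  have "AE \<omega> in M. \<forall>k\<in>{..<N * 2 ^ m} - {k0}. err k \<omega> = 0"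
    using ae0 by (intro AE_finite_allI) auto
  then have "AE \<omega> in M. (\<Sum>k<N * 2 ^ m. err k \<omega>) = (if k0 < N * 2 ^ m then err k0 \<omega> else 0)"
  proof eventually_elim
    case (elim \<omega>)
    then have "(\<Sum>k<N * 2 ^ m. err k \<omega>) = (\<Sum>k<N * 2 ^ m. if k = k0 then err k0 \<omega> else 0)"
      by (intro sum.cong) auto
    then show ?case by simp
  qed
  then have "(\<integral>\<omega>. (\<Sum>k<N * 2 ^ m. err k \<omega>)\<^sup>2 \<partial>M) = (\<integral>\<omega>. (if k0 < N * 2 ^ m then err k0 \<omega> else 0)\<^sup>2 \<partial>M)"
    using L2_measurable[OF L2e] by (intro integral_cong_AE) (auto elim: eventually_mono)
  also have "\<dots> \<le> 10 * V / 2 ^ m" using e1[of k0] V by (cases "k0 < N * 2 ^ m") simp_all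
  finally show ?thesis unfolding sum_eq V_def .
qed

lemma Yw_additive:
  assumes "r \<le> s" "s \<le> t"
  shows "AE \<omega> in M. Yw b N r t \<omega> = Yw b N r s \<omega> + Yw b N s t \<omega>"
proof (rule L2_limit_unique[where S="\<lambda>m. S b N r t m"])
  have rt: "r \<le> t" using assms by simp
  show "S b N r t m \<in> L2 M M" for m by (rule L2_S_M)
  show "Yw b N r t \<in> L2 M M" by (rule L2_Yw_M[OF rt])
  show L: "(\<lambda>\<omega>. Yw b N r s \<omega> + Yw b N s t \<omega>) \<in> L2 M M"
    by (intro L2_add sub_refl L2_Yw_M assms)
  show "(\<lambda>m. \<integral>\<omega>. (S b N r t m \<omega> - Yw b N r t \<omega>)\<^sup>2 \<partial>M) \<longlonglongrightarrow> 0" by (rule Yw_limit[OF rt])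
  define V where "V = sq_norm M (\<phi> 0 \<epsilon>)"
  define c where "c m = (\<integral>\<omega>. ((S b N r s m \<omega> + S b N s t m \<omega>) - (Yw b N r s \<omega> + Yw b N s t \<omega>))\<^sup>2 \<partial>M)" for m
  have "c \<longlonglongrightarrow> 0"
    unfolding c_def using assms by (intro L2_tendsto_add L2_S_M L2_Yw_M Yw_limit)
  then have "(\<lambda>m. 2 * (10 * V * (1 / 2) ^ m) + 2 * c m) \<longlonglongrightarrow> 2 * (10 * V * 0) + 2 * 0"
    by (intro tendsto_add tendsto_mult tendsto_const LIMSEQ_realpow_zero) auto
  then have lim: "(\<lambda>m. 2 * (10 * V * (1 / 2) ^ m) + 2 * c m) \<longlonglongrightarrow> 0" by simp
  show "(\<lambda>m. \<integral>\<omega>. (S b N r t m \<omega> - (Yw b N r s \<omega> + Yw b N s t \<omega>))\<^sup>2 \<partial>M) \<longlonglongrightarrow> 0"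
  proof (rule tendsto_sandwich[OF _ _ tendsto_const lim])
    show "\<forall>\<^sub>F m in sequentially. (\<integral>\<omega>. (S b N r t m \<omega> - (Yw b N r s \<omega> + Yw b N s t \<omega>))\<^sup>2 \<partial>M)
        \<le> 2 * (10 * V * (1 / 2) ^ m) + 2 * c m"
    proof (intro always_eventually allI)
      fix m
      have "(\<integral>\<omega>. (S b N r t m \<omega> - (Yw b N r s \<omega> + Yw b N s t \<omega>))\<^sup>2 \<partial>M)
        \<le> 2 * (\<integral>\<omega>. (S b N r t m \<omega> - (S b N r s m \<omega> + S b N s t m \<omega>))\<^sup>2 \<partial>M) + 2 * c m"
        unfolding c_def by (rule L2_triangle_le[OF L2_S_M L2_add[OF sub_refl L2_S_M L2_S_M] L])
      then show "(\<integral>\<omega>. (S b N r t m \<omega> - (Yw b N r s \<omega> + Yw b N s t \<omega>))\<^sup>2 \<partial>M)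
        \<le> 2 * (10 * V * (1 / 2) ^ m) + 2 * c m"
        using S_almost_additive[OF assms, of b N m] by (simp add: V_def power_one_over)
    qed
  qed auto
qed

lemma additive_partition:
  fixes Z :: "real \<Rightarrow> real \<Rightarrow> 'a \<Rightarrow> real"
  assumes Z: "\<And>u v w. u \<le> v \<Longrightarrow> v \<le> w \<Longrightarrow> AE \<omega> in M. Z u w \<omega> = Z u v \<omega> + Z v w \<omega>"
    and q: "\<And>k. q k \<le> q (Suc k)"
  shows "AE \<omega> in M. Z (q 0) (q n) \<omega> = (\<Sum>k<n. Z (q k) (q (Suc k)) \<omega>)"
proof (induction n)
  case 0
  show ?case using Z[of "q 0" "q 0" "q 0"] by auto
next
  case (Suc n)
  have "q 0 \<le> q n" by (rule lift_Suc_mono_le[of q, OF q]) simp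
  from Z[OF this q] Suc.IH show ?case by eventually_elim simp
qed

text \<open>\<open>Z s t\<close> is the sum of its increments over the grid cells, and each of these
  pairs with the dyadic sum as it does with \<open>\<phi> s t\<close>. The pairing is the same for
  every \<open>m\<close> and so survives the limit. This characterizes \<open>Yw\<close> as a
  projection of \<open>\<phi> s t\<close>, without reference to the grid, as long as the window
  covers \<open>[s, t]\<close>.\<close>

lemma phi_inner_additive:
  assumes Z: "\<And>u v w. u \<le> v \<Longrightarrow> v \<le> w \<Longrightarrow> AE \<omega> in M. Z u w \<omega> = Z u v \<omega> + Z v w \<omega>"
    and ZL: "\<And>u v. u \<le> v \<Longrightarrow> Z u v \<in> L2 M (F u v)" "\<And>u v. u \<le> v \<Longrightarrow> (\<integral>\<omega>. Z u v \<omega> \<partial>M) = 0"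
    and st: "s \<le> t" "t \<le> s + \<epsilon>" "b \<le> s" "t \<le> b + real N * \<epsilon>"
  shows "L2_inner M (Yw b N s t) (Z s t) = L2_inner M (\<phi> s t) (Z s t)"
proof -
  have ZM: "Z u v \<in> L2 M M" if "u \<le> v" for u v using ZL(1)[OF that] that by (rule L2_F)
  have "L2_inner M (S b N s t m) (Z s t) = L2_inner M (\<phi> s t) (Z s t)" for m
  proof -
    let ?q = "\<lambda>k. clamp s t (grid b m k)" and ?n = "N * 2 ^ m"
    have q: "?q k \<le> ?q (Suc k)" for k using partition_grid by (simp add: partition_def)
    have "grid b m 0 = b" "grid b m ?n = b + real N * \<epsilon>" by (simp_all add: grid_def)
    then have ends: "?q 0 = s" "?q ?n = t" using st by (auto simp: clamp_def)
    have sum: "AE \<omega> in M. Z s t \<omega> = (\<Sum>k<?n. Z (?q k) (?q (Suc k)) \<omega>)"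
      using additive_partition[of Z ?q ?n, OF Z q] ends by simp
    have ZqM: "(\<lambda>\<omega>. \<Sum>k<?n. Z (?q k) (?q (Suc k)) \<omega>) \<in> L2 M M"
      by (intro L2_sum[OF finite_measure_axioms sub_refl] ZM q)
    note [measurable] = L2_measurable[OF ZM[OF st(1)]] L2_measurable[OF L2_phi_M[OF st(1,2)]]
      L2_measurable[OF ZqM] L2_measurable[OF L2_S_M]
    have "L2_inner M (S b N s t m) (Z s t) = (\<integral>\<omega>. S b N s t m \<omega> * (\<Sum>k<?n. Z (?q k) (?q (Suc k)) \<omega>) \<partial>M)"
      by (rule integral_cong_AE) (use sum in \<open>auto elim: eventually_mono\<close>)
    also have "\<dots> = (\<Sum>k<?n. \<integral>\<omega>. S b N s t m \<omega> * Z (?q k) (?q (Suc k)) \<omega> \<partial>M)"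
      by (simp add: sum_distrib_left, intro Bochner_Integration.integral_sum L2_integrable_mult L2_S_M ZM q)
    also have "\<dots> = (\<Sum>k<?n. \<integral>\<omega>. \<phi> (?q k) (?q (Suc k)) \<omega> * Z (?q k) (?q (Suc k)) \<omega> \<partial>M)"
      unfolding S_def
      by (intro sum.cong refl part_sum_inner[OF partition_grid] q ZL) auto
    also have "\<dots> = (\<integral>\<omega>. \<phi> s t \<omega> * (\<Sum>k<?n. Z (?q k) (?q (Suc k)) \<omega>) \<partial>M)"
      by (rule phi_part_sum_inner[OF partition_grid ends st(2), symmetric]) (intro ZL q)
    also have "\<dots> = L2_inner M (\<phi> s t) (Z s t)"
      by (rule integral_cong_AE) (use sum in \<open>auto elim: eventually_mono\<close>)
    finally show ?thesis .
  qed
  moreover have "(\<lambda>m. \<integral>\<omega>. S b N s t m \<omega> * Z s t \<omega> \<partial>M) \<longlonglongrightarrow> (L2_inner M (Yw b N s t) (Z s t))"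
    using st by (intro L2_tendsto_inner L2_S_M L2_Yw_M Yw_limit ZM)
  ultimately show ?thesis by (simp add: LIMSEQ_const_iff)
qed

text \<open>Both limits are additive, so each may serve as the test family \<open>Z\<close> for
  itself and for the other. The four inner products obtained in this way make the squared distance
  zero.\<close>

lemma Yw_unique_short:
  assumes st: "s \<le> t" "t \<le> s + \<epsilon>" and w: "b \<le> s" "t \<le> b + real N * \<epsilon>" "b' \<le> s" "t \<le> b' + real N' * \<epsilon>"
  shows "AE \<omega> in M. Yw b N s t \<omega> = Yw b' N' s t \<omega>"
proof -
  have "sq_norm M (Yw b N s t) = L2_inner M (\<phi> s t) (Yw b N s t)"
    "L2_inner M (Yw b' N' s t) (Yw b N s t) = L2_inner M (\<phi> s t) (Yw b N s t)"
    "sq_norm M (Yw b' N' s t) = L2_inner M (\<phi> s t) (Yw b' N' s t)"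
    "L2_inner M (Yw b N s t) (Yw b' N' s t) = L2_inner M (\<phi> s t) (Yw b' N' s t)"
    unfolding power2_eq_square
    by (rule phi_inner_additive[OF Yw_additive L2_Yw mean_Yw st]; use w in simp)+
  then have "sq_dist M (Yw b N s t) (Yw b' N' s t) = 0"
    using L2_square_expand[OF L2_Yw_M[OF st(1)] L2_Yw_M[OF st(1)], of b N b' N'] by (simp add: mult.commute)
  then have "AE \<omega> in M. Yw b N s t \<omega> - Yw b' N' s t \<omega> = 0"
    by (rule L2_zero_AE[OF L2_diff[OF sub_refl L2_Yw_M[OF st(1)] L2_Yw_M[OF st(1)]]])
  then show ?thesis by simp
qed

text \<open>The characterization through \<open>\<phi> s t\<close> is confined to lengths up to
  \<open>\<epsilon>\<close>; longer intervals are cut into such pieces and reassembled by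
  additivity.\<close>

lemma Yw_unique:
  assumes st: "s \<le> t" and w: "b \<le> s" "t \<le> b + real N * \<epsilon>" "b' \<le> s" "t \<le> b' + real N' * \<epsilon>"
  shows "AE \<omega> in M. Yw b N s t \<omega> = Yw b' N' s t \<omega>"
proof -
  have "s \<le> t \<Longrightarrow> b \<le> s \<Longrightarrow> b' \<le> s \<Longrightarrow> t \<le> s + real n * \<epsilon> \<Longrightarrow> AE \<omega> in M. Yw b N s t \<omega> = Yw b' N' s t \<omega>" for n
  proof (induction n arbitrary: s)
    case 0
    then show ?case using Yw_unique_short[of s t b N b' N'] w eps by simp
  next
    case (Suc n)
    define u where "u = min t (s + \<epsilon>)"
    have u: "s \<le> u" "u \<le> t" "u \<le> s + \<epsilon>" "t \<le> u + real n * \<epsilon>"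
      using Suc.prems eps by (auto simp: u_def algebra_simps min_def)
    have "AE \<omega> in M. Yw b N s u \<omega> = Yw b' N' s u \<omega>"
      by (rule Yw_unique_short[OF u(1,3)]) (use Suc.prems w u in auto)
    moreover have "AE \<omega> in M. Yw b N u t \<omega> = Yw b' N' u t \<omega>"
      by (rule Suc.IH) (use Suc.prems u in auto)
    ultimately show ?case
      using Yw_additive[OF u(1,2), of b N] Yw_additive[OF u(1,2), of b' N'] by eventually_elim simp
  qed
  from this[of N] show ?thesis using st w by simp
qed

text \<open>A window anchored at \<open>s\<close> moves with the interval, which makes the
  construction commute with time shifts term by term. Additivity involves different windows and
  rests on \<open>Yw_unique\<close>. The ceiling is the number of cells of length
  \<open>\<epsilon>\<close> that cover \<open>[s, t]\<close>.\<close>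

definition Y :: "real \<Rightarrow> real \<Rightarrow> 'a \<Rightarrow> real" where
  "Y s t = Yw s (nat \<lceil>(t - s) / \<epsilon>\<rceil>) s t"

lemma window: "s \<le> t \<Longrightarrow> t \<le> s + real (nat \<lceil>(t - s) / \<epsilon>\<rceil>) * \<epsilon>"
proof -
  have "(t - s) / \<epsilon> \<le> real (nat \<lceil>(t - s) / \<epsilon>\<rceil>)" by linarith
  then show ?thesis using eps by (simp add: pos_divide_le_eq)
qed

lemma Y_additive:
  assumes "r \<le> s" "s \<le> t"
  shows "AE \<omega> in M. Y r t \<omega> = Y r s \<omega> + Y s t \<omega>"
proof -
  let ?N = "nat \<lceil>(t - r) / \<epsilon>\<rceil>"
  have w: "t \<le> r + real ?N * \<epsilon>" using window[of r t] assms by simp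
  have "AE \<omega> in M. Yw r ?N r s \<omega> = Y r s \<omega>" "AE \<omega> in M. Yw r ?N s t \<omega> = Y s t \<omega>"
    unfolding Y_def by (rule Yw_unique; use assms w window[of r s] window[of s t] in simp)+
  with Yw_additive[OF assms, of r ?N] show ?thesis
    unfolding Y_def[of r t] by eventually_elim simp
qed

lemma Y_shift:
  assumes st: "s \<le> t"
  shows "AE \<omega> in M. Y s t (T r \<omega>) = Y (s + r) (t + r) \<omega>"
proof -
  let ?N = "nat \<lceil>(t - s) / \<epsilon>\<rceil>"
  have st': "s + r \<le> t + r" using st by simp
  have Yr: "Y (s + r) (t + r) = Yw (s + r) ?N (s + r) (t + r)" by (simp add: Y_def)
  have cl: "clamp (s + r) (t + r) (grid (s + r) m k) = clamp s t (grid s m k) + r" for m k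
    by (auto simp: clamp_def grid_def max_def min_def)
  have Sr: "AE \<omega> in M. S s ?N s t m (T r \<omega>) = S (s + r) ?N (s + r) (t + r) m \<omega>" for m
  proof -
    let ?q = "\<lambda>k. clamp s t (grid s m k)"
    have "AE \<omega> in M. \<forall>k\<in>{..<?N * 2 ^ m}. \<phi> (?q k) (?q (Suc k)) (T r \<omega>) = \<phi> (?q k + r) (?q (Suc k) + r) \<omega>"
      using partition_grid[of s t s m]
      by (intro AE_finite_allI shift_phi) (auto simp: partition_def)
    then show ?thesis
      by eventually_elim (simp add: S_def part_sum_def cl)
  qed
  show ?thesis
  proof (rule L2_limit_unique[where S="\<lambda>m \<omega>. S s ?N s t m (T r \<omega>)"])
    show "(\<lambda>\<omega>. S s ?N s t m (T r \<omega>)) \<in> L2 M M" for m by (rule T_L2[OF L2_S_M])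
    show "(\<lambda>\<omega>. Y s t (T r \<omega>)) \<in> L2 M M" unfolding Y_def by (rule T_L2[OF L2_Yw_M[OF st]])
    show "Y (s + r) (t + r) \<in> L2 M M" unfolding Yr by (rule L2_Yw_M[OF st'])
    have "(\<integral>\<omega>. (S s ?N s t m (T r \<omega>) - Y s t (T r \<omega>))\<^sup>2 \<partial>M) = sq_dist M (S s ?N s t m) (Y s t)" for m
    proof (rule T_integral)
      have [measurable]: "S s ?N s t m \<in> borel_measurable M" "Y s t \<in> borel_measurable M"
        unfolding Y_def by (rule L2_measurable[OF L2_S_M], rule L2_measurable[OF L2_Yw_M[OF st]])
      show "(\<lambda>\<omega>. (S s ?N s t m \<omega> - Y s t \<omega>)\<^sup>2) \<in> borel_measurable M" by measurable
    qed
    then show "(\<lambda>m. \<integral>\<omega>. (S s ?N s t m (T r \<omega>) - Y s t (T r \<omega>))\<^sup>2 \<partial>M) \<longlonglongrightarrow> 0"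
      using Yw_limit[OF st, of s ?N] by (simp add: Y_def)
    have "(\<integral>\<omega>. (S s ?N s t m (T r \<omega>) - Y (s + r) (t + r) \<omega>)\<^sup>2 \<partial>M)
        = sq_dist M (S (s + r) ?N (s + r) (t + r) m) (Y (s + r) (t + r))" for m
    proof (rule integral_cong_AE)
      have [measurable]: "S s ?N s t m \<in> borel_measurable M" "S (s + r) ?N (s + r) (t + r) m \<in> borel_measurable M"
        "Y (s + r) (t + r) \<in> borel_measurable M"
        unfolding Yr by (rule L2_measurable[OF L2_S_M] L2_measurable[OF L2_Yw_M[OF st']])+
      show "(\<lambda>\<omega>. (S s ?N s t m (T r \<omega>) - Y (s + r) (t + r) \<omega>)\<^sup>2) \<in> borel_measurable M" by measurable
      show "(\<lambda>\<omega>. (S (s + r) ?N (s + r) (t + r) m \<omega> - Y (s + r) (t + r) \<omega>)\<^sup>2) \<in> borel_measurable M" by measurable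
      show "AE \<omega> in M. (S s ?N s t m (T r \<omega>) - Y (s + r) (t + r) \<omega>)\<^sup>2
          = (S (s + r) ?N (s + r) (t + r) m \<omega> - Y (s + r) (t + r) \<omega>)\<^sup>2"
        using Sr[of m] by eventually_elim simp
    qed
    then show "(\<lambda>m. \<integral>\<omega>. (S s ?N s t m (T r \<omega>) - Y (s + r) (t + r) \<omega>)\<^sup>2 \<partial>M) \<longlonglongrightarrow> 0"
      using Yw_limit[OF st', of "s + r" ?N] by (simp add: Yr)
  qed
qed

lemma additive_functional_Y: "additive_functional Y"
  unfolding additive_functional_def
  using Y_additive Y_shift L2_Yw mean_Yw by (auto simp: Y_def)

lemma L2_Y: "s \<le> t \<Longrightarrow> Y s t \<in> L2 M (F s t)"
  by (simp add: Y_def L2_Yw)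

text \<open>A centred additive functional is coherent, because its increments outside
  \<open>[u, v]\<close> are independent of \<open>\<eta>\<close> and have mean zero. So the error is
  again a coherent family, and monotonicity, superadditivity and shift invariance of norms are
  available for it.\<close>

lemma coherent_family_residual: "coherent_family M T F (\<lambda>s t \<omega>. \<phi> s t \<omega> - Y s t \<omega>) \<epsilon>"
proof unfold_locales
  show "\<epsilon> > 0" by (rule eps)
  fix s t :: real assume st: "s \<le> t" "t \<le> s + \<epsilon>"
  show "(\<lambda>\<omega>. \<phi> s t \<omega> - Y s t \<omega>) \<in> L2 M (F s t)"
    by (intro L2_diff F_sub L2_phi L2_Y st)
  have "integrable M (\<phi> s t)" "integrable M (Y s t)"
    using L2_phi_M[OF st] L2_F[OF L2_Y[OF st(1)] st(1)] by (auto intro: L2_integrable finite_measure_axioms)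
  then show "(\<integral>\<omega>. \<phi> s t \<omega> - Y s t \<omega> \<partial>M) = 0"
    using mean_phi[OF st] mean_Yw[OF st(1)] by (simp add: Y_def)
  show "AE \<omega> in M. \<phi> s t (T r \<omega>) - Y s t (T r \<omega>) = \<phi> (s + r) (t + r) \<omega> - Y (s + r) (t + r) \<omega>" for r
    using shift_phi[OF st, of r] Y_shift[OF st(1), of r] by eventually_elim simp
next
  fix s u v t \<eta> assume a: "s \<le> u" "u \<le> v" "v \<le> t" "t \<le> s + \<epsilon>" and \<eta>: "\<eta> \<in> L2 M (F u v)"
  have \<eta>M: "\<eta> \<in> L2 M M" using \<eta> a(2) by (rule L2_F)
  have st: "s \<le> t" "u \<le> t" "v \<le> u + \<epsilon>" using a by auto
  have YM: "Y x y \<in> L2 M M" if "x \<le> y" for x y using L2_Y[OF that] that by (rule L2_F)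
  have mY: "(\<integral>\<omega>. Y x y \<omega> \<partial>M) = 0" if "x \<le> y" for x y using mean_Yw[OF that] by (simp add: Y_def)
  have i: "integrable M (\<lambda>\<omega>. Y x y \<omega> * \<eta> \<omega>)" if "x \<le> y" for x y
    by (rule L2_integrable_mult[OF YM[OF that] \<eta>M])
  note [measurable] = L2_measurable[OF \<eta>M] L2_measurable[OF YM[OF st(1)]] L2_measurable[OF YM[OF a(1)]]
    L2_measurable[OF YM[OF a(2)]] L2_measurable[OF YM[OF a(3)]]
  have "AE \<omega> in M. Y s t \<omega> = Y s u \<omega> + Y u v \<omega> + Y v t \<omega>"
    using Y_additive[OF a(1) st(2)] Y_additive[OF a(2,3)] by eventually_elim simp
  then have "L2_inner M (Y s t) \<eta> = (\<integral>\<omega>. Y s u \<omega> * \<eta> \<omega> + Y u v \<omega> * \<eta> \<omega> + Y v t \<omega> * \<eta> \<omega> \<partial>M)"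
    by (intro integral_cong_AE) (auto elim!: eventually_mono simp: algebra_simps)
  also have "\<dots> = L2_inner M (Y s u) \<eta> + L2_inner M (Y u v) \<eta> + L2_inner M (Y v t) \<eta>"
    using a by (simp add: i)
  also have "L2_inner M (Y s u) \<eta> = 0"
    using F_inner_indep[OF L2_Y[OF a(1)] \<eta>] a mY by simp
  also have "L2_inner M (Y v t) \<eta> = 0"
    using F_inner_indep[OF \<eta> L2_Y[OF a(3)]] a mY by (simp add: mult.commute)
  finally have eq: "L2_inner M (Y s t) \<eta> = L2_inner M (Y u v) \<eta>" by simp
  have "integrable M (\<lambda>\<omega>. \<phi> s t \<omega> * \<eta> \<omega>)" "integrable M (\<lambda>\<omega>. \<phi> u v \<omega> * \<eta> \<omega>)"
    by (intro L2_integrable_mult \<eta>M L2_phi_M st a)+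
  then show "(\<integral>\<omega>. (\<phi> s t \<omega> - Y s t \<omega>) * \<eta> \<omega> \<partial>M) = (\<integral>\<omega>. (\<phi> u v \<omega> - Y u v \<omega>) * \<eta> \<omega> \<partial>M)"
    using coherent[OF a \<eta>] eq i[OF st(1)] i[OF a(2)] by (simp add: left_diff_distrib)
qed

section \<open>The error of the first chaos component on short intervals\<close>

definition residual :: "real \<Rightarrow> real" where
  "residual h = sq_dist M (\<phi> 0 h) (Y 0 h)"

lemma residual_nonneg: "0 \<le> residual h"
  by (simp add: residual_def)

lemma residual_shift:
  assumes "u \<le> v" "v \<le> u + \<epsilon>"
  shows "sq_dist M (\<phi> u v) (Y u v) = residual (v - u)"
proof -
  interpret R: coherent_family M T F "\<lambda>s t \<omega>. \<phi> s t \<omega> - Y s t \<omega>" \<epsilon> by (rule coherent_family_residual)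
  show ?thesis using R.phi_norm_shift[of 0 "v - u" u] assms by (simp add: residual_def)
qed

text \<open>The errors over the \<open>2 ^ m\<close> blocks are orthogonal and of equal norm, and
  they add up to the difference between the \<open>m\<close>-th dyadic sum and its limit.
  Convergence of the sums is thus the origin of the rate \<open>o(h)\<close>.\<close>

lemma residual_dyadic: "(\<lambda>m. 2 ^ m * residual (\<epsilon> / 2 ^ m)) \<longlonglongrightarrow> 0"
proof -
  interpret R: coherent_family M T F "\<lambda>s t \<omega>. \<phi> s t \<omega> - Y s t \<omega>" \<epsilon> by (rule coherent_family_residual)
  have "2 ^ m * residual (\<epsilon> / 2 ^ m) = sq_dist M (S 0 1 0 \<epsilon> m) (Yw 0 1 0 \<epsilon>)" for m
  proof -
    have part: "R.partition (grid 0 m)" "partition (grid 0 m)"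
      using step_le_eps[of m] eps by (auto simp: R.partition_def partition_def grid_Suc)
    have step: "grid 0 m k \<le> grid 0 m (Suc k)" for k by (rule grid_mono) simp
    have ends: "grid 0 m 0 = 0" "grid 0 m (2 ^ m) = \<epsilon>" by (simp_all add: grid_def)
    have cl: "clamp 0 \<epsilon> (grid 0 m k) = grid 0 m k" if "k \<le> 2 ^ m" for k
      using grid_mono[OF that, of 0 m] grid_mono[of 0 k 0 m] ends by (simp add: clamp_def)
    have block: "sq_dist M (\<phi> (grid 0 m k) (grid 0 m (Suc k))) (Y (grid 0 m k) (grid 0 m (Suc k)))
        = residual (\<epsilon> / 2 ^ m)" for k
      using residual_shift[OF step[of k]] step_le_eps[of m] by (simp add: grid_Suc)
    have "sq_norm M (R.part_sum (grid 0 m) (2 ^ m)) = (\<Sum>k<(2::nat) ^ m. residual (\<epsilon> / 2 ^ m))"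
      unfolding R.part_sum_norm[OF part(1)] block ..
    then have "2 ^ m * residual (\<epsilon> / 2 ^ m) = sq_norm M (R.part_sum (grid 0 m) (2 ^ m))" by simp
    also have "\<dots> = sq_dist M (S 0 1 0 \<epsilon> m) (Yw 0 1 0 \<epsilon>)"
    proof (rule integral_cong_AE)
      show "(\<lambda>\<omega>. (R.part_sum (grid 0 m) (2 ^ m) \<omega>)\<^sup>2) \<in> borel_measurable M"
        using L2_measurable[OF R.L2_part_sum_M[OF part(1)]] by measurable
      show "(\<lambda>\<omega>. (S 0 1 0 \<epsilon> m \<omega> - Yw 0 1 0 \<epsilon> \<omega>)\<^sup>2) \<in> borel_measurable M"
        using L2_measurable[OF L2_S_M] L2_measurable[OF L2_Yw_M[OF less_imp_le[OF eps]]] by measurable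
      have Y1: "Y 0 \<epsilon> = Yw 0 1 0 \<epsilon>" using eps by (simp add: Y_def)
      have "AE \<omega> in M. Y 0 \<epsilon> \<omega> = (\<Sum>k<2 ^ m. Y (grid 0 m k) (grid 0 m (Suc k)) \<omega>)"
        using additive_partition[of Y "grid 0 m" "2 ^ m", OF Y_additive step] ends by simp
      then show "AE \<omega> in M. (R.part_sum (grid 0 m) (2 ^ m) \<omega>)\<^sup>2 = (S 0 1 0 \<epsilon> m \<omega> - Yw 0 1 0 \<epsilon> \<omega>)\<^sup>2"
      proof eventually_elim
        case (elim \<omega>)
        have "S 0 1 0 \<epsilon> m \<omega> = (\<Sum>k<2 ^ m. \<phi> (grid 0 m k) (grid 0 m (Suc k)) \<omega>)"
          by (simp add: S_def part_sum_def cl)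
        then show ?case using elim by (simp add: R.part_sum_def sum_subtractf Y1)
      qed
    qed
    finally show ?thesis .
  qed
  then show ?thesis using Yw_limit[of 0 \<epsilon> 0 1] eps by simp
qed

text \<open>Rounding a length up to a dyadic scale loses at most a factor two; this extends the
  dyadic estimates to all short lengths. The scale is the one preceding the earliest scale below
  \<open>h\<close>.\<close>

lemma dyadic_scale:
  assumes "0 < h" "h \<le> \<epsilon> / 2 ^ m0"
  shows "\<exists>m\<ge>m0. h \<le> \<epsilon> / 2 ^ m \<and> \<epsilon> / 2 ^ m < 2 * h"
proof -
  have "\<exists>n. \<epsilon> / 2 ^ n < h"
    using real_arch_pow_inv[of "h / \<epsilon>" "1/2"] assms eps by (auto simp: power_one_over field_simps)
  then obtain n where n: "\<epsilon> / 2 ^ n < h" "\<And>i. i < n \<Longrightarrow> h \<le> \<epsilon> / 2 ^ i"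
    using exists_least_iff[of "\<lambda>n. \<epsilon> / 2 ^ n < h"] by (auto simp: not_less)
  have "n > m0"
  proof (rule ccontr)
    assume "\<not> n > m0"
    then have "\<epsilon> / 2 ^ m0 \<le> \<epsilon> / 2 ^ n" using eps by (intro divide_left_mono) (auto simp: power_increasing)
    then show False using n(1) assms by linarith
  qed
  then obtain m where m: "n = Suc m" "m \<ge> m0" by (cases n) auto
  then show ?thesis using n by (intro exI[of _ m]) (auto simp: field_simps)
qed

lemma phi_linear:
  assumes "0 < h" "h \<le> \<epsilon>"
  shows "sq_norm M (\<phi> u (u + h)) \<le> (2 * h / \<epsilon>) * sq_norm M (\<phi> 0 \<epsilon>)"
proof -
  obtain m where m: "h \<le> \<epsilon> / 2 ^ m" "\<epsilon> / 2 ^ m < 2 * h" using dyadic_scale[of h 0] assms by auto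
  have "sq_norm M (\<phi> u (u + h)) \<le> (1 / 2 ^ m) * sq_norm M (\<phi> 0 \<epsilon>)"
    using phi_small[of u "u + h" m] assms m by simp
  also have "\<dots> \<le> (2 * h / \<epsilon>) * sq_norm M (\<phi> 0 \<epsilon>)"
    using m eps by (intro mult_right_mono) (auto simp: field_simps)
  finally show ?thesis .
qed

lemma residual_le_dyadic:
  assumes "0 < h" "h \<le> \<epsilon> / 2 ^ m0"
  shows "\<exists>m\<ge>m0. residual h \<le> 2 ^ m * residual (\<epsilon> / 2 ^ m) * (2 * h / \<epsilon>)"
proof -
  interpret R: coherent_family M T F "\<lambda>s t \<omega>. \<phi> s t \<omega> - Y s t \<omega>" \<epsilon> by (rule coherent_family_residual)
  obtain m where m: "m \<ge> m0" and h: "h \<le> \<epsilon> / 2 ^ m" "\<epsilon> / 2 ^ m < 2 * h"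
    using dyadic_scale[OF assms] by blast
  have "residual h \<le> residual (\<epsilon> / 2 ^ m)"
    unfolding residual_def using h assms step_le_eps[of m] by (intro R.phi_norm_mono) auto
  also have "\<dots> = 2 ^ m * residual (\<epsilon> / 2 ^ m) * (1 / 2 ^ m)" by simp
  also have "\<dots> \<le> 2 ^ m * residual (\<epsilon> / 2 ^ m) * (2 * h / \<epsilon>)"
    using h eps residual_nonneg by (intro mult_left_mono) (auto simp: field_simps)
  finally show ?thesis using m by blast
qed

lemma residual_small:
  assumes "\<delta> > 0"
  shows "\<exists>h0>0. \<forall>h. 0 < h \<longrightarrow> h \<le> h0 \<longrightarrow> residual h \<le> \<delta> * h"
proof -
  obtain m0 where m0: "\<And>m. m \<ge> m0 \<Longrightarrow> 2 ^ m * residual (\<epsilon> / 2 ^ m) < \<delta> * \<epsilon> / 2"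
    using order_tendstoD(2)[OF residual_dyadic, of "\<delta> * \<epsilon> / 2"] assms eps
    by (auto simp: eventually_sequentially)
  show ?thesis
  proof (intro exI[of _ "\<epsilon> / 2 ^ m0"] conjI allI impI)
    show "0 < \<epsilon> / 2 ^ m0" using eps by simp
    fix h assume h: "0 < h" "h \<le> \<epsilon> / 2 ^ m0"
    obtain m where m: "m \<ge> m0" "residual h \<le> 2 ^ m * residual (\<epsilon> / 2 ^ m) * (2 * h / \<epsilon>)"
      using residual_le_dyadic[OF h] by blast
    have "2 ^ m * residual (\<epsilon> / 2 ^ m) * (2 * h / \<epsilon>) \<le> (\<delta> * \<epsilon> / 2) * (2 * h / \<epsilon>)"
      using m0[OF m(1)] h eps by (intro mult_right_mono) auto
    also have "\<dots> = \<delta> * h" using eps by simp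
    finally show "residual h \<le> \<delta> * h" using m(2) by linarith
  qed
qed

text \<open>With \<open>Z = Y\<close> in \<open>phi_inner_additive\<close>,
  \<open>Y 0 \<epsilon>\<close> is a projection of \<open>\<phi> 0 \<epsilon>\<close>, so the error
  at length \<open>\<epsilon>\<close> is no longer than \<open>\<phi> 0 \<epsilon>\<close>; the
  linear bound for the coherent error family brings this down to \<open>h\<close>. In contrast to
  \<open>residual_small\<close> the constant is explicit, which later gives uniformity in the
  shift.\<close>

lemma residual_linear:
  assumes h: "0 < h" "h \<le> \<epsilon>"
  shows "residual h \<le> (2 * h / \<epsilon>) * sq_norm M (\<phi> 0 \<epsilon>)"
proof -
  interpret R: coherent_family M T F "\<lambda>s t \<omega>. \<phi> s t \<omega> - Y s t \<omega>" \<epsilon> by (rule coherent_family_residual)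
  have e: "0 \<le> \<epsilon>" "\<epsilon> \<le> 0 + \<epsilon>" using eps by auto
  have YM: "Y 0 \<epsilon> \<in> L2 M M" by (rule L2_F[OF L2_Y[OF e(1)] e(1)])
  have mY: "(\<integral>\<omega>. Y x y \<omega> \<partial>M) = 0" if "x \<le> y" for x y using mean_Yw[OF that] by (simp add: Y_def)
  have "L2_inner M (Yw 0 (nat \<lceil>(\<epsilon> - 0) / \<epsilon>\<rceil>) 0 \<epsilon>) (Y 0 \<epsilon>) = L2_inner M (\<phi> 0 \<epsilon>) (Y 0 \<epsilon>)"
    by (rule phi_inner_additive[OF Y_additive L2_Y mY e]) (use eps in auto)
  then have "L2_inner M (\<phi> 0 \<epsilon>) (Y 0 \<epsilon>) = sq_norm M (Y 0 \<epsilon>)"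
    by (simp add: Y_def power2_eq_square)
  then have "sq_dist M (\<phi> 0 \<epsilon>) (Y 0 \<epsilon>) \<le> sq_norm M (\<phi> 0 \<epsilon>)"
    using L2_square_expand[OF L2_phi_M[OF e] YM] by simp
  then have "(2 * h / \<epsilon>) * sq_dist M (\<phi> 0 \<epsilon>) (Y 0 \<epsilon>) \<le> (2 * h / \<epsilon>) * sq_norm M (\<phi> 0 \<epsilon>)"
    using h eps by (intro mult_left_mono) auto
  then show ?thesis using R.phi_linear[OF h, of 0] by (simp add: residual_def)
qed

end

section \<open>Coherent families from a representation\<close>

lemma borel_measurable_diff_const [measurable]:
  fixes h :: "'a \<Rightarrow> 'g::{second_countable_topology, topological_group_add}"
  assumes [measurable]: "h \<in> N \<rightarrow>\<^sub>M borel"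
  shows "(\<lambda>x. h x - b) \<in> N \<rightarrow>\<^sub>M borel"
  unfolding diff_conv_add_uminus by measurable

text \<open>The function is \<open>min 1 (d x 0)\<close> for a left-invariant compatible metric
  \<open>d\<close>. Commutativity turns left invariance into \<open>d x y = d (x - y) 0\<close>,
  whence symmetry and the Lipschitz bound. It serves both as a bounded test function and as a gauge
  for the neighbourhoods of the unit.\<close>

lemma ex_bounded_group_norm:
  shows "\<exists>f :: 'g::{polish_group, topological_ab_group_add} \<Rightarrow> real.
    (\<forall>x. 0 \<le> f x \<and> f x \<le> 1) \<and> f 0 = 0 \<and> (\<forall>x. f (- x) = f x) \<and> (\<forall>x y. \<bar>f x - f y\<bar> \<le> f (x - y)) \<and>
    continuous_on UNIV f \<and> (\<forall>U. open U \<longrightarrow> 0 \<in> U \<longrightarrow> (\<exists>r>0. {x. f x < r} \<subseteq> U))"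
proof -
  obtain d :: "'g \<Rightarrow> 'g \<Rightarrow> real" where d: "compatible_metric d" "left_invariant d"
    using complete_left_plus_right by blast
  interpret Metric_space UNIV d using d by (simp add: compatible_metric_def)
  have top: "mtopology = euclidean" using d by (simp add: compatible_metric_def)
  have inv: "d (g + x) (g + y) = d x y" for g x y using d by (simp add: left_invariant_def)
  have opB: "open (mball x r)" for x r using openin_mball[of x r] unfolding top by simp
  define f where "f x = min 1 (d x 0)" for x
  have dd: "d x y = d (x - y) 0" for x y
    using inv[of "- y" x y] by simp
  have lip: "\<bar>f x - f y\<bar> \<le> f (x - y)" for x y
  proof -
    have "d x 0 \<le> d x y + d y 0" "d y 0 \<le> d x y + d x 0"
      using triangle[of x y 0] triangle[of y x 0] by (auto simp: commute)
    moreover have "0 \<le> d x 0" "0 \<le> d y 0" "0 \<le> d x y" by simp_all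
    ultimately show ?thesis unfolding f_def dd[of x y, symmetric] by linarith
  qed
  have "open (f -` B)" if "open B" for B
  proof (subst open_subopen, rule ballI)
    fix x assume "x \<in> f -` B"
    then obtain e where e: "e > 0" "ball (f x) e \<subseteq> B" using \<open>open B\<close> by (auto elim: openE)
    have "mball x e \<subseteq> f -` B"
    proof
      fix y assume "y \<in> mball x e"
      then have "d x y < e" by simp
      then have "\<bar>f x - f y\<bar> < e" using lip[of x y] by (simp add: f_def dd[of x y, symmetric])
      then show "y \<in> f -` B" using e by (auto simp: dist_real_def)
    qed
    then show "\<exists>T. open T \<and> x \<in> T \<and> T \<subseteq> f -` B" using opB[of x e] e by auto
  qed
  then have "continuous_on UNIV f" by (auto simp: continuous_on_open_vimage)
  moreover have "f (- x) = f x" for x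
    using dd[of 0 x] commute[of 0 x] by (simp add: f_def)
  moreover have "\<exists>r>0. {x. f x < r} \<subseteq> U" if "open U" "0 \<in> U" for U
  proof -
    have "openin mtopology U" using that top by simp
    then obtain r where r: "r > 0" "mball 0 r \<subseteq> U" using \<open>0 \<in> U\<close> unfolding openin_mtopology by auto
    have "{x. f x < min 1 r} \<subseteq> U"
    proof
      fix x assume "x \<in> {x. f x < min 1 r}"
      then have "x \<in> mball 0 r" by (simp add: f_def commute min_def split: if_splits)
      then show "x \<in> U" using r by blast
    qed
    then show ?thesis using r by (intro exI[of _ "min 1 r"]) auto
  qed
  moreover have "0 \<le> f x \<and> f x \<le> 1" "f 0 = 0" for x by (auto simp: f_def)
  ultimately show ?thesis using lip by blast
qed

context prob_space
begin

lemma indep_set_sym: "indep_set A B \<Longrightarrow> indep_set B A"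
proof (rule indep_setI)
  assume ind: "indep_set A B"
  show "B \<subseteq> events" "A \<subseteq> events" using indep_setD_ev1[OF ind] indep_setD_ev2[OF ind] by auto
  show "prob (b \<inter> a) = prob b * prob a" if "b \<in> B" "a \<in> A" for a b
    using indep_setD[OF ind that(2,1)] by (simp add: Int_commute mult.commute)
qed

lemma prob_gt_le_square:
  assumes "f \<in> L2 M M" "a > 0"
  shows "prob {x \<in> space M. a < \<bar>f x\<bar>} \<le> sq_norm M f / a\<^sup>2"
proof -
  have [measurable]: "f \<in> borel_measurable M" using assms(1) by (rule L2_measurable)
  have "a\<^sup>2 \<le> (f x)\<^sup>2" if "a < \<bar>f x\<bar>" for x
    using that assms(2) by (metis abs_le_square_iff abs_of_pos less_imp_le)
  then have "prob {x \<in> space M. a < \<bar>f x\<bar>} \<le> prob {x \<in> space M. (f x)\<^sup>2 \<ge> a\<^sup>2}"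
    by (intro finite_measure_mono) auto
  also have "\<dots> \<le> sq_norm M f / a\<^sup>2"
    by (rule integral_Markov_inequality_measure[where A="{}"]) (use assms L2_square in auto)
  finally show ?thesis .
qed

end

context noise_space
begin

definition continuous_functional :: "(real \<Rightarrow> real \<Rightarrow> 'w \<Rightarrow> real) \<Rightarrow> bool" where
  "continuous_functional Y \<longleftrightarrow> additive_functional Y \<and>
     (\<forall>\<delta>>0. ((\<lambda>t. 1 / t * prob {\<omega> \<in> space M. \<delta> < \<bar>Y 0 t \<omega>\<bar>}) \<longlongrightarrow> 0) (at_right 0))"

end

locale commutative_representation = noise_space M T F
  for M :: "'w measure" and T F +
  fixes X :: "real \<Rightarrow> real \<Rightarrow> 'w \<Rightarrow> 'g::{polish_group, topological_ab_group_add}"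
    and f :: "'g \<Rightarrow> real"
  assumes rep: "continuous_representation M T F X"
    and f_range: "0 \<le> f x" "f x \<le> 1"
    and f_zero: "f 0 = 0"
    and f_minus: "f (- x) = f x"
    and f_lipschitz: "\<bar>f x - f y\<bar> \<le> f (x - y)"
    and f_continuous: "continuous_on UNIV f"
    and f_basis: "open U \<Longrightarrow> 0 \<in> U \<Longrightarrow> \<exists>r>0. {x. f x < r} \<subseteq> U"
begin

lemma
  shows representation: "representation M T F X"
    and continuity: "\<forall>U. open U \<longrightarrow> 0 \<in> U \<longrightarrow>
        ((\<lambda>t. 1 / t * prob {\<omega> \<in> space M. X 0 t \<omega> \<notin> U}) \<longlongrightarrow> 0) (at_right 0)"
  by (insert rep, unfold continuous_representation_def, elim conjE, assumption)+

lemma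
  shows rep_shift: "\<forall>r s t. r \<le> s \<longrightarrow> (AE \<omega> in M. X r s (T t \<omega>) = X (r + t) (s + t) \<omega>)"
    and rep_measurable: "\<forall>s t. s \<le> t \<longrightarrow> X s t \<in> F s t \<rightarrow>\<^sub>M borel"
    and rep_add: "\<forall>r s t. r \<le> s \<longrightarrow> s \<le> t \<longrightarrow> (AE \<omega> in M. X s t \<omega> + X r s \<omega> = X r t \<omega>)"
  by (insert representation, unfold representation_def, elim conjE, assumption)+

lemma X_F: "s \<le> t \<Longrightarrow> X s t \<in> F s t \<rightarrow>\<^sub>M borel"
  using rep_measurable by blast

lemma X_M: "s \<le> t \<Longrightarrow> X s t \<in> M \<rightarrow>\<^sub>M borel"
  by (rule measurable_from_subalg[OF F_sub X_F])

lemma X_F_mono: "s \<le> t \<Longrightarrow> a \<le> s \<Longrightarrow> t \<le> b \<Longrightarrow> X s t \<in> F a b \<rightarrow>\<^sub>M borel"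
  by (rule measurable_from_subalg[OF F_mono X_F])

lemma X_add: "r \<le> s \<Longrightarrow> s \<le> t \<Longrightarrow> AE \<omega> in M. X r t \<omega> = X r s \<omega> + X s t \<omega>"
  using rep_add[rule_format, of r s t] by (auto simp: add.commute elim: eventually_mono)

lemma X_shift: "s \<le> t \<Longrightarrow> AE \<omega> in M. X s t (T r \<omega>) = X (s + r) (t + r) \<omega>"
  using rep_shift by blast

lemma f_measurable [measurable]: "f \<in> borel_measurable borel"
  by (rule borel_measurable_continuous_onI[OF f_continuous])

section \<open>Laws of increments and averaged test functions\<close>

definition law :: "real \<Rightarrow> 'g measure" where
  "law r = distr M borel (X 0 r)"

lemma prob_space_law: "0 \<le> r \<Longrightarrow> prob_space (law r)"
  unfolding law_def by (rule prob_space_distr[OF X_M])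

lemma sets_law [measurable_cong, simp]: "sets (law r) = sets borel"
  by (simp add: law_def)

lemma space_law [simp]: "space (law r) = UNIV"
  by (simp add: law_def)

lemma distr_X:
  assumes "s \<le> t"
  shows "distr M borel (X s t) = law (t - s)"
proof -
  have [measurable]: "X 0 (t - s) \<in> M \<rightarrow>\<^sub>M borel" "X s t \<in> M \<rightarrow>\<^sub>M borel" using assms by (auto intro!: X_M)
  have "distr M borel (X s t) = distr M borel (\<lambda>\<omega>. X 0 (t - s) (T s \<omega>))"
    using X_shift[of 0 "t - s" s] assms by (intro distr_cong_AE) (auto elim: eventually_mono)
  also have "\<dots> = distr (distr M M (T s)) borel (X 0 (t - s))"
    by (subst distr_distr) (auto simp: comp_def)
  finally show ?thesis unfolding T_distr law_def .
qed

text \<open>Moving \<open>[v, w]\<close> to the interval of the same length that starts at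
  \<open>u\<close> preserves the joint law with \<open>X s u\<close>, since both pairs are
  independent with equal marginals. The sum then becomes a single increment.\<close>

lemma distr_X_plus_X:
  assumes "s \<le> u" "u \<le> v" "v \<le> w"
  shows "distr M borel (\<lambda>\<omega>. X s u \<omega> + X v w \<omega>) = law ((u - s) + (w - v))"
proof -
  let ?w = "u + (w - v)"
  have [measurable]: "X s u \<in> M \<rightarrow>\<^sub>M borel" "X v w \<in> M \<rightarrow>\<^sub>M borel" "X u ?w \<in> M \<rightarrow>\<^sub>M borel" "X s ?w \<in> M \<rightarrow>\<^sub>M borel"
    using assms by (auto intro!: X_M)
  have pair: "distr M (borel \<Otimes>\<^sub>M borel) (\<lambda>\<omega>. (X s u \<omega>, X v' w' \<omega>)) = law (u - s) \<Otimes>\<^sub>M law (w' - v')"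
    if "u \<le> v'" "v' \<le> w'" for v' w'
  proof -
    have "distr M borel (X s u) \<Otimes>\<^sub>M distr M borel (X v' w') = distr M (borel \<Otimes>\<^sub>M borel) (\<lambda>\<omega>. (X s u \<omega>, X v' w' \<omega>))"
      by (rule indep_distr_pair[OF F_indep[of s u w'] F_sub F_sub X_F X_F_mono]) (use assms that in auto)
    then show ?thesis using assms that by (simp add: distr_X)
  qed
  have "distr M borel (\<lambda>\<omega>. X s u \<omega> + X v w \<omega>)
      = distr (distr M (borel \<Otimes>\<^sub>M borel) (\<lambda>\<omega>. (X s u \<omega>, X v w \<omega>))) borel (\<lambda>(x, y). x + y)"
    by (subst distr_distr) (auto simp: comp_def)
  also have "\<dots> = distr (distr M (borel \<Otimes>\<^sub>M borel) (\<lambda>\<omega>. (X s u \<omega>, X u ?w \<omega>))) borel (\<lambda>(x, y). x + y)"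
    using assms by (simp add: pair)
  also have "\<dots> = distr M borel (\<lambda>\<omega>. X s u \<omega> + X u ?w \<omega>)"
    by (subst distr_distr) (auto simp: comp_def)
  also have "\<dots> = distr M borel (X s ?w)"
    using X_add[of s u ?w] assms by (intro distr_cong_AE) (auto elim: eventually_mono)
  also have "\<dots> = law ((u - s) + (w - v))" using assms by (subst distr_X) (auto simp: algebra_simps)
  finally show ?thesis .
qed

text \<open>The convolution semigroup of the increments applied to \<open>f\<close>.\<close>

definition g :: "real \<Rightarrow> 'g \<Rightarrow> real" where
  "g r x = (\<integral>y. f (x + y) \<partial>law r)"

lemma f_integrable: "0 \<le> r \<Longrightarrow> integrable (law r) (\<lambda>y. f (x + y))"
proof -
  assume "0 \<le> r"
  then interpret law: prob_space "law r" by (rule prob_space_law)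
  show ?thesis by (rule law.integrable_const_bound[where B=1]) (auto simp: f_range)
qed

lemma g_measurable:
  assumes "0 \<le> r"
  shows "g r \<in> borel_measurable borel"
proof -
  interpret law: prob_space "law r" using assms by (rule prob_space_law)
  show ?thesis unfolding g_def by measurable
qed

lemma g_range:
  assumes "0 \<le> r"
  shows "0 \<le> g r x" "g r x \<le> 1"
proof -
  interpret law: prob_space "law r" using assms by (rule prob_space_law)
  show "0 \<le> g r x" unfolding g_def by (simp add: f_range)
  have "g r x \<le> (\<integral>y. 1 \<partial>law r)" unfolding g_def
    by (rule integral_mono[OF f_integrable[OF assms]]) (auto simp: f_range)
  then show "g r x \<le> 1" by (simp add: law.prob_space del: space_law)
qed

lemma g_lipschitz:
  assumes "0 \<le> r"
  shows "\<bar>g r x - g r y\<bar> \<le> f (x - y)"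
proof -
  interpret law: prob_space "law r" using assms by (rule prob_space_law)
  have "\<bar>g r x - g r y\<bar> = \<bar>\<integral>z. f (x + z) - f (y + z) \<partial>law r\<bar>"
    using f_integrable[OF assms] by (simp add: g_def)
  also have "\<dots> \<le> (\<integral>z. \<bar>f (x + z) - f (y + z)\<bar> \<partial>law r)" by (rule integral_abs_bound)
  also have "\<dots> \<le> (\<integral>z. f (x - y) \<partial>law r)"
    using f_integrable[OF assms] f_lipschitz[of "x + z" "y + z" for z]
    by (intro integral_mono) auto
  finally show ?thesis by (simp add: law.prob_space del: space_law)
qed

lemma freeze_g:
  assumes ind: "indep_set (sets A) (sets B)" and sub: "subalgebra M A" "subalgebra M B"
    and xi: "\<xi> \<in> A \<rightarrow>\<^sub>M borel" and eta: "\<eta> \<in> B \<rightarrow>\<^sub>M borel" "distr M borel \<eta> = law r"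
    and z: "z \<in> L2 M A"
  shows "(\<integral>\<omega>. f (\<xi> \<omega> + \<eta> \<omega>) * z \<omega> \<partial>M) = (\<integral>\<omega>. g r (\<xi> \<omega>) * z \<omega> \<partial>M)"
proof -
  have "integrable M z" by (rule L2_integrable[OF finite_measure_axioms L2_subalg[OF sub(1) z]])
  moreover have "\<bar>case p of (x, y) \<Rightarrow> f (x + y)\<bar> \<le> 1" for p by (cases p) (simp add: f_range)
  ultimately show ?thesis
    using freeze[OF ind sub xi eta(1), of "\<lambda>(x, y). f (x + y)" 1 z] L2_measurable[OF z]
    by (simp add: eta(2) g_def)
qed

text \<open>The centred conditional expectation, given \<open>F s t\<close>, of \<open>f\<close> at
  an increment of length \<open>\<epsilon>\<close> shifted by \<open>b\<close>, over any interval
  containing \<open>[s, t]\<close>: the remaining length \<open>\<epsilon> - (t - s)\<close> is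
  integrated out, and \<open>g \<epsilon> (- b)\<close> is the mean. The shift later absorbs the
  increments outside a block.\<close>

definition \<phi> :: "real \<Rightarrow> 'g \<Rightarrow> real \<Rightarrow> real \<Rightarrow> 'w \<Rightarrow> real" where
  "\<phi> \<epsilon> b s t \<omega> = g (\<epsilon> - (t - s)) (X s t \<omega> - b) - g \<epsilon> (- b)"

lemma phi_measurable:
  assumes "s \<le> t" "t \<le> s + \<epsilon>" and m: "X s t \<in> N \<rightarrow>\<^sub>M borel"
  shows "\<phi> \<epsilon> b s t \<in> borel_measurable N"
  unfolding \<phi>_def
  by (intro borel_measurable_diff borel_measurable_const
      measurable_compose[OF borel_measurable_diff_const[OF m] g_measurable]) (use assms in simp)

lemma phi_bound:
  assumes "s \<le> t" "t \<le> s + \<epsilon>"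
  shows "\<bar>\<phi> \<epsilon> b s t \<omega>\<bar> \<le> 1"
  using g_range[of "\<epsilon> - (t - s)" "X s t \<omega> - b"] g_range[of \<epsilon> "- b"] assms by (simp add: \<phi>_def)

lemma L2_phi:
  assumes "s \<le> t" "t \<le> s + \<epsilon>"
  shows "\<phi> \<epsilon> b s t \<in> L2 M (F s t)"
  by (rule L2_bounded[OF F_sub phi_measurable phi_bound]) (use assms in \<open>auto intro: X_F\<close>)

text \<open>The increment over \<open>[t, t']\<close> is independent of \<open>F s t\<close> and can
  be integrated out, so the factor with \<open>g\<close> is the conditional expectation of
  \<open>f (X s t' - b)\<close> given \<open>F s t\<close>.\<close>

lemma g_X_mult:
  assumes st: "s \<le> t" "t \<le> t'" and z: "z \<in> L2 M (F s t)"
  shows "(\<integral>\<omega>. g (t' - t) (X s t \<omega> - b) * z \<omega> \<partial>M) = (\<integral>\<omega>. f (X s t' \<omega> - b) * z \<omega> \<partial>M)"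
proof -
  have [measurable]: "X s t \<in> M \<rightarrow>\<^sub>M borel" "X t t' \<in> M \<rightarrow>\<^sub>M borel" "X s t' \<in> M \<rightarrow>\<^sub>M borel" using st by (auto intro!: X_M)
  have [measurable]: "z \<in> borel_measurable M" by (rule L2_measurable[OF L2_F[OF z st(1)]])
  have "(\<lambda>\<omega>. X s t \<omega> - b) \<in> F s t \<rightarrow>\<^sub>M borel" using X_F[OF st(1)] by measurable
  then have "(\<integral>\<omega>. g (t' - t) (X s t \<omega> - b) * z \<omega> \<partial>M) = (\<integral>\<omega>. f ((X s t \<omega> - b) + X t t' \<omega>) * z \<omega> \<partial>M)"
    using freeze_g[OF F_indep[OF st] F_sub F_sub _ X_F distr_X z] st by simp
  also have "\<dots> = (\<integral>\<omega>. f (X s t' \<omega> - b) * z \<omega> \<partial>M)"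
    using X_add[OF st] by (intro integral_cong_AE) (auto elim!: eventually_mono simp: algebra_simps)
  finally show ?thesis .
qed

text \<open>The increments before and after \<open>[u, v]\<close> enter only through their sum, whose law depends
  only on their total length.\<close>

lemma g_X_coherent:
  assumes "s \<le> u" "u \<le> v" "v \<le> t" "t \<le> t'" and z: "z \<in> L2 M (F u v)"
  shows "(\<integral>\<omega>. g (t' - t) (X s t \<omega> - b) * z \<omega> \<partial>M) = (\<integral>\<omega>. g ((t' - s) - (v - u)) (X u v \<omega> - b) * z \<omega> \<partial>M)"
proof -
  have st: "s \<le> t" "v \<le> t'" "s \<le> v" "u \<le> t'" using assms by auto
  have [measurable]: "X s t' \<in> M \<rightarrow>\<^sub>M borel" "X s u \<in> M \<rightarrow>\<^sub>M borel" "X u v \<in> M \<rightarrow>\<^sub>M borel" "X v t' \<in> M \<rightarrow>\<^sub>M borel"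
    using assms st by (auto intro!: X_M)
  have [measurable]: "z \<in> borel_measurable M" by (rule L2_measurable[OF L2_F[OF z assms(2)]])
  have "(\<integral>\<omega>. g (t' - t) (X s t \<omega> - b) * z \<omega> \<partial>M) = (\<integral>\<omega>. f (X s t' \<omega> - b) * z \<omega> \<partial>M)"
    by (rule g_X_mult[OF st(1) assms(4) L2_F_mono[OF z assms(1-3)]])
  also have "\<dots> = (\<integral>\<omega>. f ((X u v \<omega> - b) + (X s u \<omega> + X v t' \<omega>)) * z \<omega> \<partial>M)"
  proof (rule integral_cong_AE)
    show "AE \<omega> in M. f (X s t' \<omega> - b) * z \<omega> = f ((X u v \<omega> - b) + (X s u \<omega> + X v t' \<omega>)) * z \<omega>"
      using X_add[OF st(3) st(2)] X_add[OF assms(1,2)] by eventually_elim (simp add: algebra_simps)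
  qed measurable
  also have "\<dots> = (\<integral>\<omega>. g ((t' - s) - (v - u)) (X u v \<omega> - b) * z \<omega> \<partial>M)"
  proof (rule freeze_g[where A="F u v" and B="join_algebra (F s u) (F v t')"])
    have sub: "subalgebra M (F s u)" "subalgebra M (F u v)" "subalgebra M (F v t')" "subalgebra M (F s v)"
      using assms st by (auto intro!: F_sub)
    show "indep_set (sets (F u v)) (sets (join_algebra (F s u) (F v t')))"
      by (rule indep_set_sym, rule indep_set_join[OF sub]) (use assms st in \<open>auto intro!: F_mono F_indep\<close>)
    show "subalgebra M (F u v)" "subalgebra M (join_algebra (F s u) (F v t'))"
      by (rule sub, rule subalgebra_join[OF sub(1,3)])
    show "(\<lambda>\<omega>. X u v \<omega> - b) \<in> F u v \<rightarrow>\<^sub>M borel" using X_F[OF assms(2)] by measurable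
    have [measurable]: "X s u \<in> join_algebra (F s u) (F v t') \<rightarrow>\<^sub>M borel" "X v t' \<in> join_algebra (F s u) (F v t') \<rightarrow>\<^sub>M borel"
      using measurable_from_subalg[OF subalgebra_join_left[OF sub(1,3)] X_F[OF assms(1)]]
        measurable_from_subalg[OF subalgebra_join_right[OF sub(1,3)] X_F[OF st(2)]] .
    show "(\<lambda>\<omega>. X s u \<omega> + X v t' \<omega>) \<in> join_algebra (F s u) (F v t') \<rightarrow>\<^sub>M borel" by measurable
    have "(u - s) + (t' - v) = (t' - s) - (v - u)" by simp
    then show "distr M borel (\<lambda>\<omega>. X s u \<omega> + X v t' \<omega>) = law ((t' - s) - (v - u))"
      using distr_X_plus_X[OF assms(1,2) st(2)] by (simp only:)
  qed (rule z)
  finally show ?thesis .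
qed

lemma mean_g_X:
  assumes "s \<le> t" "t \<le> t'"
  shows "(\<integral>\<omega>. g (t' - t) (X s t \<omega> - b) \<partial>M) = g (t' - s) (- b)"
proof -
  have [measurable]: "X s t' \<in> M \<rightarrow>\<^sub>M borel" using assms by (auto intro!: X_M)
  have st': "s \<le> t'" using assms by simp
  have "(\<integral>\<omega>. g (t' - t) (X s t \<omega> - b) * 1 \<partial>M) = (\<integral>\<omega>. f (X s t' \<omega> - b) * 1 \<partial>M)"
    using assms by (intro g_X_mult L2_const finite_measure_axioms)
  also have "\<dots> = (\<integral>\<omega>. f (- b + X s t' \<omega>) \<partial>M)" by simp
  also have "\<dots> = (\<integral>y. f (- b + y) \<partial>distr M borel (X s t'))"
    by (rule integral_distr[symmetric]) measurable
  also have "\<dots> = g (t' - s) (- b)" by (simp add: distr_X[OF st'] g_def)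
  finally show ?thesis by simp
qed

lemma coherent_phi:
  assumes eps: "\<epsilon> > 0"
  shows "coherent_family M T F (\<phi> \<epsilon> b) \<epsilon>"
proof unfold_locales
  fix s t :: real assume st: "s \<le> t" "t \<le> s + \<epsilon>"
  show "\<phi> \<epsilon> b s t \<in> L2 M (F s t)" by (rule L2_phi[OF st])
  have g: "(\<lambda>\<omega>. g (\<epsilon> - (t - s)) (X s t \<omega> - b)) \<in> L2 M M"
  proof (rule L2_bounded[OF sub_refl, of _ 1])
    show "(\<lambda>\<omega>. g (\<epsilon> - (t - s)) (X s t \<omega> - b)) \<in> borel_measurable M"
      by (rule measurable_compose[OF borel_measurable_diff_const[OF X_M[OF st(1)]] g_measurable]) (use st in simp)
  qed (use st g_range[of "\<epsilon> - (t - s)"] in auto)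
  then have int: "integrable M (\<lambda>\<omega>. g (\<epsilon> - (t - s)) (X s t \<omega> - b))"
    by (rule L2_integrable[OF finite_measure_axioms])
  have e: "\<epsilon> - (t - s) = s + \<epsilon> - t" by simp
  show "(\<integral>\<omega>. \<phi> \<epsilon> b s t \<omega> \<partial>M) = 0"
    using mean_g_X[OF st, of b, folded e] int by (simp add: \<phi>_def prob_space)
  show "AE \<omega> in M. \<phi> \<epsilon> b s t (T r \<omega>) = \<phi> \<epsilon> b (s + r) (t + r) \<omega>" for r
    using X_shift[OF st(1), of r] by eventually_elim (simp add: \<phi>_def)
next
  fix s u v t \<eta> assume a: "s \<le> u" "u \<le> v" "v \<le> t" "t \<le> s + \<epsilon>" and \<eta>: "\<eta> \<in> L2 M (F u v)"
  have \<eta>M: "\<eta> \<in> L2 M M" using \<eta> a(2) by (rule L2_F)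
  have e: "\<epsilon> - (t - s) = s + \<epsilon> - t" "\<epsilon> - (v - u) = s + \<epsilon> - s - (v - u)" by auto
  have L: "(\<lambda>\<omega>. g (\<epsilon> - (y - x)) (X x y \<omega> - b)) \<in> L2 M M" if "x \<le> y" "y \<le> x + \<epsilon>" for x y
  proof (rule L2_bounded[OF sub_refl, of _ 1])
    show "(\<lambda>\<omega>. g (\<epsilon> - (y - x)) (X x y \<omega> - b)) \<in> borel_measurable M"
      by (rule measurable_compose[OF borel_measurable_diff_const[OF X_M[OF that(1)]] g_measurable]) (use that in simp)
  qed (use that g_range[of "\<epsilon> - (y - x)"] in auto)
  have "integrable M (\<lambda>\<omega>. g (\<epsilon> - (t - s)) (X s t \<omega> - b) * \<eta> \<omega>)"
    "integrable M (\<lambda>\<omega>. g (\<epsilon> - (v - u)) (X u v \<omega> - b) * \<eta> \<omega>)"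
    using a by (auto intro!: L2_integrable_mult L \<eta>M)
  moreover have "integrable M (\<lambda>\<omega>. g \<epsilon> (- b) * \<eta> \<omega>)"
    using L2_integrable[OF finite_measure_axioms \<eta>M] by simp
  ultimately show "L2_inner M (\<phi> \<epsilon> b s t) \<eta> = L2_inner M (\<phi> \<epsilon> b u v) \<eta>"
    using g_X_coherent[OF a \<eta>, of b, folded e] by (simp add: \<phi>_def left_diff_distrib)
qed (rule eps)

section \<open>First chaos components of the representation and their continuity\<close>

definition Y :: "real \<Rightarrow> 'g \<Rightarrow> real \<Rightarrow> real \<Rightarrow> 'w \<Rightarrow> real" where
  "Y \<epsilon> b = coherent_family.Y M F (\<phi> \<epsilon> b) \<epsilon>"

definition residual :: "real \<Rightarrow> 'g \<Rightarrow> real \<Rightarrow> real" where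
  "residual \<epsilon> b h = sq_dist M (\<phi> \<epsilon> b 0 h) (Y \<epsilon> b 0 h)"

context
  fixes \<epsilon> :: real
  assumes eps: "\<epsilon> > 0"
begin

lemma additive_Y: "additive_functional (Y \<epsilon> b)"
  unfolding Y_def by (rule coherent_family.additive_functional_Y[OF coherent_phi[OF eps]])

lemma residual_eq: "residual \<epsilon> b = coherent_family.residual M F (\<phi> \<epsilon> b) \<epsilon>"
  by (rule ext) (simp add: residual_def Y_def coherent_family.residual_def[OF coherent_phi[OF eps]])

lemma residual_tendsto: "((\<lambda>h. residual \<epsilon> b h / h) \<longlongrightarrow> 0) (at_right 0)"
proof (rule tendstoI)
  fix e :: real assume "e > 0"
  then obtain h0 where h0: "h0 > 0" "\<And>h. 0 < h \<Longrightarrow> h \<le> h0 \<Longrightarrow> residual \<epsilon> b h \<le> e / 2 * h"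
    using coherent_family.residual_small[OF coherent_phi[OF eps], of "e / 2" b] unfolding residual_eq by auto
  have "\<forall>\<^sub>F h in at_right 0. 0 < h \<and> h < h0"
    using h0(1) by (auto simp: eventually_at_right_field)
  then show "\<forall>\<^sub>F h in at_right 0. dist (residual \<epsilon> b h / h) 0 < e"
  proof eventually_elim
    case (elim h)
    have "residual \<epsilon> b h / h \<le> e / 2" using h0(2)[of h] elim by (simp add: pos_divide_le_eq)
    moreover have "residual \<epsilon> b h / h \<ge> 0" using elim by (simp add: residual_def)
    ultimately show ?case using \<open>e > 0\<close> unfolding dist_real_def by linarith
  qed
qed

text \<open>The constant does not involve \<open>b\<close>, because \<open>\<phi>\<close> is bounded
  by \<open>1\<close> for every shift. This supplies the dominating function when residuals are
  averaged over random shifts.\<close>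

lemma residual_linear:
  assumes "0 < h" "h \<le> \<epsilon>"
  shows "residual \<epsilon> b h \<le> 2 * h / \<epsilon>"
proof -
  have e: "0 \<le> \<epsilon>" "\<epsilon> \<le> 0 + \<epsilon>" using eps by auto
  have "sq_norm M (\<phi> \<epsilon> b 0 \<epsilon>) \<le> (\<integral>\<omega>. 1 \<partial>M)"
    by (rule integral_mono[OF L2_square[OF L2_F[OF L2_phi[OF e] e(1)]]])
      (use phi_bound[OF e] in \<open>auto simp: abs_square_le_1\<close>)
  then have "(2 * h / \<epsilon>) * sq_norm M (\<phi> \<epsilon> b 0 \<epsilon>) \<le> (2 * h / \<epsilon>) * 1"
    using assms eps by (intro mult_left_mono) (auto simp: prob_space)
  then show ?thesis
    using coherent_family.residual_linear[OF coherent_phi[OF eps] assms, of b] unfolding residual_eq by simp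
qed

lemma residual_shift:
  "u \<le> v \<Longrightarrow> v \<le> u + \<epsilon> \<Longrightarrow> sq_dist M (\<phi> \<epsilon> b u v) (Y \<epsilon> b u v) = residual \<epsilon> b (v - u)"
  unfolding residual_eq Y_def by (rule coherent_family.residual_shift[OF coherent_phi[OF eps]])

lemma L2_Y: "s \<le> t \<Longrightarrow> Y \<epsilon> b s t \<in> L2 M (F s t)"
  using additive_Y by (simp add: additive_functional_def)

lemma Y_add:
  "r \<le> s \<Longrightarrow> s \<le> t \<Longrightarrow> AE \<omega> in M. Y \<epsilon> b r t \<omega> = Y \<epsilon> b r s \<omega> + Y \<epsilon> b s t \<omega>"
  by (rule additive_functional_add[OF additive_Y])

text \<open>Both terms of \<open>\<phi>\<close> are compared with
  \<open>g (\<epsilon> - t) (- b)\<close>. By the Lipschitz property one of them is within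
  \<open>f (X 0 t \<omega>)\<close> of it; the other, being the mean of the former, is within the
  mean of \<open>f (X 0 t)\<close>.\<close>

lemma phi_minus_le:
  assumes "0 \<le> t" "t \<le> \<epsilon>"
  shows "\<bar>\<phi> \<epsilon> b 0 t \<omega>\<bar> \<le> f (X 0 t \<omega>) + (\<integral>\<omega>. f (X 0 t \<omega>) \<partial>M)"
proof -
  have t: "\<epsilon> - t \<ge> 0" using assms by simp
  have [measurable]: "X 0 t \<in> M \<rightarrow>\<^sub>M borel" "g (\<epsilon> - t) \<in> borel_measurable borel"
    using assms by (auto intro!: X_M g_measurable)
  have int: "integrable M (\<lambda>\<omega>. g (\<epsilon> - t) (X 0 t \<omega> - b))"
    by (rule integrable_const_bound[where B=1]) (auto simp: g_range[OF t])
  have int': "integrable M (\<lambda>\<omega>. f (X 0 t \<omega>))"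
    by (rule integrable_const_bound[where B=1]) (auto simp: f_range)
  have "\<bar>g (\<epsilon> - t) (- b) - g \<epsilon> (- b)\<bar> = \<bar>\<integral>\<omega>. g (\<epsilon> - t) (- b) - g (\<epsilon> - t) (X 0 t \<omega> - b) \<partial>M\<bar>"
    using mean_g_X[of 0 t \<epsilon> b] assms int by (simp add: prob_space)
  also have "\<dots> \<le> (\<integral>\<omega>. \<bar>g (\<epsilon> - t) (- b) - g (\<epsilon> - t) (X 0 t \<omega> - b)\<bar> \<partial>M)" by (rule integral_abs_bound)
  also have "\<dots> \<le> (\<integral>\<omega>. f (X 0 t \<omega>) \<partial>M)"
  proof (rule integral_mono[OF _ int'])
    show "integrable M (\<lambda>\<omega>. \<bar>g (\<epsilon> - t) (- b) - g (\<epsilon> - t) (X 0 t \<omega> - b)\<bar>)" using int by simp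
    show "\<bar>g (\<epsilon> - t) (- b) - g (\<epsilon> - t) (X 0 t \<omega> - b)\<bar> \<le> f (X 0 t \<omega>)" for \<omega>
      using g_lipschitz[OF t, of "- b" "X 0 t \<omega> - b"] by (simp add: f_minus)
  qed
  finally have 1: "\<bar>g (\<epsilon> - t) (- b) - g \<epsilon> (- b)\<bar> \<le> (\<integral>\<omega>. f (X 0 t \<omega>) \<partial>M)" .
  have "\<bar>g (\<epsilon> - t) (X 0 t \<omega> - b) - g (\<epsilon> - t) (- b)\<bar> \<le> f (X 0 t \<omega>)"
    using g_lipschitz[OF t, of "X 0 t \<omega> - b" "- b"] by simp
  then show ?thesis using 1 by (simp add: \<phi>_def)
qed

end

lemma prob_f_tendsto:
  assumes "r > 0"
  shows "((\<lambda>t. 1 / t * prob {\<omega> \<in> space M. r \<le> f (X 0 t \<omega>)}) \<longlongrightarrow> 0) (at_right 0)"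
proof -
  have "open (f -` {..<r})" using f_continuous by (auto simp: continuous_on_open_vimage)
  moreover have "{x. f x < r} = f -` {..<r}" by auto
  ultimately have "open {x. f x < r}" by simp
  from continuity[rule_format, OF this] show ?thesis using assms by (simp add: f_zero not_less)
qed

lemma mean_f_tendsto: "((\<lambda>t. \<integral>\<omega>. f (X 0 t \<omega>) \<partial>M) \<longlongrightarrow> 0) (at_right 0)"
proof (rule tendstoI)
  fix e :: real assume e: "e > 0"
  have "\<forall>\<^sub>F t in at_right 0. \<bar>1 / t * prob {\<omega> \<in> space M. e / 2 \<le> f (X 0 t \<omega>)}\<bar> < 1"
    using tendstoD[OF prob_f_tendsto[of "e / 2"], of 1] e by (simp add: dist_real_def)
  moreover have "\<forall>\<^sub>F t::real in at_right 0. 0 < t \<and> t < e / 2"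
    using eventually_at_right_real[of 0 "e / 2"] e by simp
  ultimately show "\<forall>\<^sub>F t in at_right 0. dist (\<integral>\<omega>. f (X 0 t \<omega>) \<partial>M) 0 < e"
  proof eventually_elim
    case (elim t)
    define A where "A = {\<omega> \<in> space M. e / 2 \<le> f (X 0 t \<omega>)}"
    have [measurable]: "X 0 t \<in> M \<rightarrow>\<^sub>M borel" using elim by (auto intro!: X_M)
    have A[measurable]: "A \<in> events" unfolding A_def by measurable
    have pA: "prob A < e / 2"
    proof -
      have "prob A / t < 1" using elim unfolding A_def by (metis abs_le_D1 abs_less_iff mult_1 times_divide_eq_left)
      then have "prob A < 1 * t" using elim pos_divide_less_eq[of t "prob A" 1] by blast
      then show ?thesis using elim by simp
    qed
    have int: "integrable M (\<lambda>\<omega>. f (X 0 t \<omega>))"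
      by (rule integrable_const_bound[where B=1]) (auto simp: f_range)
    have "(\<integral>\<omega>. f (X 0 t \<omega>) \<partial>M) \<le> (\<integral>\<omega>. e / 2 + indicator A \<omega> \<partial>M)"
    proof (rule integral_mono[OF int])
      show "integrable M (\<lambda>\<omega>. e / 2 + indicator A \<omega>)" by (simp add: emeasure_eq_measure)
      show "f (X 0 t \<omega>) \<le> e / 2 + indicator A \<omega>" if "\<omega> \<in> space M" for \<omega>
        using f_range(2)[of "X 0 t \<omega>"] e that by (auto simp: A_def indicator_def)
    qed
    also have "\<dots> = e / 2 + prob A" by (simp add: emeasure_eq_measure prob_space)
    finally have "(\<integral>\<omega>. f (X 0 t \<omega>) \<partial>M) < e" using pA by simp
    then show ?case by (simp add: f_range)
  qed
qed

text \<open>\<open>Y\<close> is \<open>\<phi>\<close> minus an error of squared norm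
  \<open>o(t)\<close>. Chebyshev's inequality controls the error, and \<open>\<phi>\<close> is
  bounded by \<open>f (X 0 t)\<close> and its mean, so that the continuity of \<open>X\<close> does
  the rest.\<close>

lemma continuous_Y:
  assumes eps: "\<epsilon> > 0"
  shows "continuous_functional (Y \<epsilon> b)"
  unfolding continuous_functional_def
proof (intro conjI allI impI)
  show "additive_functional (Y \<epsilon> b)" by (rule additive_Y[OF eps])
  fix \<delta> :: real assume \<delta>: "\<delta> > 0"
  let ?B = "\<lambda>t. 4 / \<delta>\<^sup>2 * (residual \<epsilon> b t / t) + 1 / t * prob {\<omega> \<in> space M. \<delta> / 4 \<le> f (X 0 t \<omega>)}"
  have lim: "(?B \<longlongrightarrow> 4 / \<delta>\<^sup>2 * 0 + 0) (at_right 0)"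
    using \<delta> by (intro tendsto_add tendsto_mult tendsto_const residual_tendsto[OF eps] prob_f_tendsto) auto
  have ev: "\<forall>\<^sub>F t in at_right 0. 0 < t \<and> t < \<epsilon>" using eps by (auto simp: eventually_at_right_field)
  have ev2: "\<forall>\<^sub>F t in at_right 0. \<bar>\<integral>\<omega>. f (X 0 t \<omega>) \<partial>M\<bar> < \<delta> / 4"
    using tendstoD[OF mean_f_tendsto, of "\<delta> / 4"] \<delta> by simp
  show "((\<lambda>t. 1 / t * prob {\<omega> \<in> space M. \<delta> < \<bar>Y \<epsilon> b 0 t \<omega>\<bar>}) \<longlongrightarrow> 0) (at_right 0)"
  proof (rule tendsto_sandwich[OF _ _ tendsto_const])
    show "(?B \<longlongrightarrow> 0) (at_right 0)" using lim by simp
    show "\<forall>\<^sub>F t in at_right 0. 0 \<le> 1 / t * prob {\<omega> \<in> space M. \<delta> < \<bar>Y \<epsilon> b 0 t \<omega>\<bar>}"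
      using ev by eventually_elim simp
    show "\<forall>\<^sub>F t in at_right 0. 1 / t * prob {\<omega> \<in> space M. \<delta> < \<bar>Y \<epsilon> b 0 t \<omega>\<bar>} \<le> ?B t"
      using ev ev2
    proof eventually_elim
      case (elim t)
      have t: "0 \<le> t" "t \<le> 0 + \<epsilon>" using elim by auto
      define \<rho> where "\<rho> \<omega> = \<phi> \<epsilon> b 0 t \<omega> - Y \<epsilon> b 0 t \<omega>" for \<omega>
      have \<rho>: "\<rho> \<in> L2 M M" unfolding \<rho>_def
        by (rule L2_diff[OF sub_refl L2_F[OF L2_phi[OF t] t(1)] L2_F[OF L2_Y[OF eps t(1)] t(1)]])
      have [measurable]: "X 0 t \<in> M \<rightarrow>\<^sub>M borel" "\<rho> \<in> borel_measurable M"
        using X_M[OF t(1)] L2_measurable[OF \<rho>] by auto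
      \<comment> \<open>When \<open>f (X 0 t)\<close> and its mean are both below
        \<open>\<delta> / 4\<close>, \<open>\<phi>\<close> is below \<open>\<delta> / 2\<close>, and
        the other half of \<open>\<delta>\<close> must come from the error.\<close>
      have "{\<omega> \<in> space M. \<delta> < \<bar>Y \<epsilon> b 0 t \<omega>\<bar>}
          \<subseteq> {\<omega> \<in> space M. \<delta> / 2 < \<bar>\<rho> \<omega>\<bar>} \<union> {\<omega> \<in> space M. \<delta> / 4 \<le> f (X 0 t \<omega>)}"
      proof safe
        fix \<omega> assume "\<delta> < \<bar>Y \<epsilon> b 0 t \<omega>\<bar>" "\<not> \<delta> / 4 \<le> f (X 0 t \<omega>)"
        then show "\<delta> / 2 < \<bar>\<rho> \<omega>\<bar>"
          using phi_minus_le[OF eps, of t b \<omega>] elim unfolding \<rho>_def by linarith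
      qed
      then have "prob {\<omega> \<in> space M. \<delta> < \<bar>Y \<epsilon> b 0 t \<omega>\<bar>}
          \<le> prob ({\<omega> \<in> space M. \<delta> / 2 < \<bar>\<rho> \<omega>\<bar>} \<union> {\<omega> \<in> space M. \<delta> / 4 \<le> f (X 0 t \<omega>)})"
        by (intro finite_measure_mono) auto
      also have "\<dots> \<le> prob {\<omega> \<in> space M. \<delta> / 2 < \<bar>\<rho> \<omega>\<bar>} + prob {\<omega> \<in> space M. \<delta> / 4 \<le> f (X 0 t \<omega>)}"
        by (intro measure_Un_le) auto
      also have "prob {\<omega> \<in> space M. \<delta> / 2 < \<bar>\<rho> \<omega>\<bar>} \<le> residual \<epsilon> b t / (\<delta> / 2)\<^sup>2"
        using prob_gt_le_square[OF \<rho>, of "\<delta> / 2"] \<delta> by (simp add: residual_def \<rho>_def)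
      also have "\<dots> = 4 / \<delta>\<^sup>2 * residual \<epsilon> b t" by (simp add: power_divide)
      finally have "prob {\<omega> \<in> space M. \<delta> < \<bar>Y \<epsilon> b 0 t \<omega>\<bar>}
          \<le> 4 / \<delta>\<^sup>2 * residual \<epsilon> b t + prob {\<omega> \<in> space M. \<delta> / 4 \<le> f (X 0 t \<omega>)}" by simp
      then have "1 / t * prob {\<omega> \<in> space M. \<delta> < \<bar>Y \<epsilon> b 0 t \<omega>\<bar>}
          \<le> 1 / t * (4 / \<delta>\<^sup>2 * residual \<epsilon> b t + prob {\<omega> \<in> space M. \<delta> / 4 \<le> f (X 0 t \<omega>)})"
        using elim by (intro mult_left_mono) auto
      then show ?case by (simp add: distrib_left mult.commute)
    qed
  qed
qed

end

section \<open>The first chaos generates the noise\<close>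

definition gen :: "'a measure \<Rightarrow> ('a \<Rightarrow> real) set \<Rightarrow> 'a measure" where
  "gen M Z = sigma (space M) {z -` B \<inter> space M | z B. z \<in> Z \<and> B \<in> sets borel}"

lemma space_gen: "space (gen M Z) = space M"
  unfolding gen_def by (rule space_measure_of) auto

lemma sets_gen: "sets (gen M Z) = sigma_sets (space M) {z -` B \<inter> space M | z B. z \<in> Z \<and> B \<in> sets borel}"
  unfolding gen_def by (rule sets_measure_of) auto

lemma gen_measurable: "z \<in> Z \<Longrightarrow> z \<in> borel_measurable (gen M Z)"
  by (rule measurableI) (auto simp: space_gen sets_gen intro!: sigma_sets.Basic)

lemma gen_least:
  assumes "space N = space M" "\<And>z. z \<in> Z \<Longrightarrow> z \<in> borel_measurable N"
  shows "subalgebra N (gen M Z)"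
proof -
  have "sigma_sets (space N) {z -` B \<inter> space M | z B. z \<in> Z \<and> B \<in> sets borel} \<subseteq> sets N"
    using assms measurable_sets[OF assms(2)] by (intro sets.sigma_sets_subset) (auto simp: assms(1)[symmetric])
  then show ?thesis using assms(1) by (simp add: subalgebra_def space_gen sets_gen)
qed

text \<open>The equation makes \<open>R - d\<close> orthogonal to \<open>d\<close>, as for a
  projection of \<open>R\<close>, and Pythagoras applies.\<close>

lemma L2_norm_le:
  assumes "d \<in> L2 M M" "R \<in> L2 M M" "sq_norm M d = L2_inner M d R"
  shows "sq_norm M d \<le> sq_norm M R"
proof -
  have "0 \<le> sq_dist M d R" by simp
  also have "\<dots> = sq_norm M R - sq_norm M d"
    using L2_square_expand[OF assms(1,2)] assms(3) by simp
  finally show ?thesis by simp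
qed

context prob_space
begin

text \<open>Splitting according to the value of \<open>J\<close> leaves products of independent
  variables, which monotone convergence sums up. \<open>freeze\<close> is restricted to bounded
  integrands, whereas the squared residuals inserted here are only integrable.\<close>

lemma freeze_countable:
  fixes r :: "nat \<Rightarrow> 'a \<Rightarrow> real"
  assumes ind: "indep_set (sets A) (sets B)" and sub: "subalgebra M A" "subalgebra M B"
    and J: "J \<in> A \<rightarrow>\<^sub>M count_space UNIV" and r: "\<And>i. r i \<in> borel_measurable B" "\<And>i. integrable M (r i)"
    and nonneg: "\<And>i \<omega>. 0 \<le> r i \<omega>" and bound: "\<And>i. (\<integral>\<omega>. r i \<omega> \<partial>M) \<le> K"
  shows "integrable M (\<lambda>\<omega>. r (J \<omega>) \<omega>)"
    and "(\<integral>\<omega>. r (J \<omega>) \<omega> \<partial>M) = (\<integral>\<omega>. (\<integral>\<omega>'. r (J \<omega>) \<omega>' \<partial>M) \<partial>M)"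
proof -
  define e where "e i = (\<integral>\<omega>. r i \<omega> \<partial>M)" for i
  have [measurable]: "J \<in> M \<rightarrow>\<^sub>M count_space UNIV" "\<And>i. r i \<in> borel_measurable M"
    using J r sub by (auto intro: measurable_from_subalg)
  have e0: "0 \<le> e i" for i unfolding e_def by (simp add: nonneg)
  let ?I = "\<lambda>i \<omega>. indicator {i} (J \<omega>) :: real"
  have I: "?I i \<in> borel_measurable A" for i
    by (rule measurable_compose[OF J]) simp
  have Iint: "integrable M (?I i)" for i
    by (rule integrable_const_bound[where B=1]) (auto simp: indicator_def)
  have prod: "L2_inner M (?I i) (r i) = (\<integral>\<omega>. ?I i \<omega> \<partial>M) * e i"
    "integrable M (\<lambda>\<omega>. ?I i \<omega> * r i \<omega>)" for i
    unfolding e_def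
    by (rule indep_var_lebesgue_integral[OF indep_varI[OF ind sub I r(1)] Iint r(2)],
        rule indep_var_integrable[OF indep_varI[OF ind sub I r(1)] Iint r(2)])
  have single: "ennreal (q (J \<omega>) \<omega>) = (\<Sum>i. ennreal (?I i \<omega> * q i \<omega>))" for q :: "nat \<Rightarrow> 'a \<Rightarrow> real" and \<omega>
    by (subst suminf_finite[of "{J \<omega>}"]) (auto simp: indicator_def)
  have "(\<integral>\<^sup>+\<omega>. ennreal (r (J \<omega>) \<omega>) \<partial>M) = (\<Sum>i. \<integral>\<^sup>+\<omega>. ennreal (?I i \<omega> * r i \<omega>) \<partial>M)"
    unfolding single[of r]
    by (rule nn_integral_suminf) (rule measurable_compose[OF borel_measurable_integrable[OF prod(2)] measurable_ennreal])
  also have "\<dots> = (\<Sum>i. ennreal ((\<integral>\<omega>. ?I i \<omega> \<partial>M) * e i))"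
    by (intro suminf_cong, subst nn_integral_eq_integral[OF prod(2)]) (auto simp: prod(1) nonneg)
  also have "\<dots> = (\<Sum>i. \<integral>\<^sup>+\<omega>. ennreal (?I i \<omega> * e i) \<partial>M)"
    by (intro suminf_cong, subst nn_integral_eq_integral[OF integrable_mult_left[OF Iint]])
      (auto simp: e0)
  also have "\<dots> = (\<integral>\<^sup>+\<omega>. ennreal (e (J \<omega>)) \<partial>M)"
    unfolding single[of "\<lambda>i \<omega>. e i"] 
    by (rule nn_integral_suminf[symmetric])
      (rule measurable_compose[OF borel_measurable_integrable[OF integrable_mult_left[OF Iint]] measurable_ennreal])
  finally have eq: "(\<integral>\<^sup>+\<omega>. ennreal (r (J \<omega>) \<omega>) \<partial>M) = (\<integral>\<^sup>+\<omega>. ennreal (e (J \<omega>)) \<partial>M)" .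
  have mr: "(\<lambda>\<omega>. r (J \<omega>) \<omega>) \<in> borel_measurable M"
    by (rule measurable_compose_countable[of r]; fact)
  have me: "(\<lambda>\<omega>. e (J \<omega>)) \<in> borel_measurable M" by measurable
  have eint: "integrable M (\<lambda>\<omega>. e (J \<omega>))"
    by (rule integrable_const_bound[where B=K]) (use me e0 bound in \<open>auto simp: e_def\<close>)
  have eq2: "(\<integral>\<^sup>+\<omega>. ennreal (r (J \<omega>) \<omega>) \<partial>M) = ennreal (\<integral>\<omega>. e (J \<omega>) \<partial>M)"
    unfolding eq by (rule nn_integral_eq_integral[OF eint]) (simp add: e0)
  then show int: "integrable M (\<lambda>\<omega>. r (J \<omega>) \<omega>)"
    using mr by (intro integrableI_nonneg) (auto simp: nonneg)
  have "ennreal (\<integral>\<omega>. r (J \<omega>) \<omega> \<partial>M) = ennreal (\<integral>\<omega>. e (J \<omega>) \<partial>M)"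
    using eq2 nn_integral_eq_integral[OF int] by (simp add: nonneg)
  then show "(\<integral>\<omega>. r (J \<omega>) \<omega> \<partial>M) = (\<integral>\<omega>. (\<integral>\<omega>'. r (J \<omega>) \<omega>' \<partial>M) \<partial>M)"
    by (subst (asm) ennreal_inj) (auto simp: nonneg e0 e_def)
qed

lemma
  assumes N: "subalgebra M N" and h: "h \<in> borel_measurable M" "\<And>x. 0 \<le> h x" "\<And>x. h x \<le> 1"
  shows L2_real_cond_exp: "real_cond_exp M N h \<in> L2 M N"
    and inner_real_cond_exp: "z \<in> L2 M N \<Longrightarrow> L2_inner M (real_cond_exp M N h) z = L2_inner M h z"
proof -
  interpret sigma_finite_subalgebra M N by (rule sigma_finite_subalgebra_prob[OF N])
  have hL2: "h \<in> L2 M M" by (rule L2_bounded[OF sub_refl h(1), of 1]) (use h in auto)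
  have int: "integrable M h" by (rule L2_integrable[OF finite_measure_axioms hL2])
  have "AE x in M. 0 \<le> real_cond_exp M N h x" "AE x in M. real_cond_exp M N h x \<le> 1"
    using h by (auto intro: real_cond_exp_ge_c[OF int] real_cond_exp_le_c[OF int])
  then have "AE x in M. norm ((real_cond_exp M N h x)\<^sup>2) \<le> 1"
    by eventually_elim (simp add: abs_square_le_1 power_le_one)
  then have "integrable M (\<lambda>x. (real_cond_exp M N h x)\<^sup>2)"
    by (intro integrable_const_bound[where B=1]) auto
  then show "real_cond_exp M N h \<in> L2 M N" by (simp add: L2_def)
  assume z: "z \<in> L2 M N"
  show "L2_inner M (real_cond_exp M N h) z = L2_inner M h z"
    using real_cond_exp_intg(2)[OF _ L2_measurable[OF z] h(1)] L2_integrable_mult[OF L2_subalg[OF N z] hL2]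
    by (simp add: mult.commute)
qed

end

text \<open>Being a projection is a linear condition. Applied to two shifts of one test function,
  this gives their difference a norm that is linear in the length of the interval.\<close>

lemma coherent_family_diff:
  assumes c: "coherent_family M T F \<phi> \<epsilon>" and c': "coherent_family M T F \<phi>' \<epsilon>"
  shows "coherent_family M T F (\<lambda>s t \<omega>. \<phi> s t \<omega> - \<phi>' s t \<omega>) \<epsilon>"
proof -
  interpret A: coherent_family M T F \<phi> \<epsilon> by (rule c)
  interpret B: coherent_family M T F \<phi>' \<epsilon> by (rule c')
  show ?thesis
  proof unfold_locales
    fix s t :: real assume st: "s \<le> t" "t \<le> s + \<epsilon>"
    show "(\<lambda>\<omega>. \<phi> s t \<omega> - \<phi>' s t \<omega>) \<in> L2 M (F s t)"
      by (intro L2_diff A.F_sub A.L2_phi B.L2_phi st)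
    show "(\<integral>\<omega>. \<phi> s t \<omega> - \<phi>' s t \<omega> \<partial>M) = 0"
      using A.mean_phi[OF st] B.mean_phi[OF st] L2_integrable[OF A.finite_measure_axioms A.L2_phi_M[OF st]]
        L2_integrable[OF A.finite_measure_axioms B.L2_phi_M[OF st]] by simp
    show "AE \<omega> in M. \<phi> s t (T r \<omega>) - \<phi>' s t (T r \<omega>) = \<phi> (s + r) (t + r) \<omega> - \<phi>' (s + r) (t + r) \<omega>" for r
      using A.shift_phi[OF st, of r] B.shift_phi[OF st, of r] by eventually_elim simp
  next
    fix s u v t \<eta> assume a: "s \<le> u" "u \<le> v" "v \<le> t" "t \<le> s + \<epsilon>" and \<eta>: "\<eta> \<in> L2 M (F u v)"
    have \<eta>M: "\<eta> \<in> L2 M M" using \<eta> a(2) by (rule A.L2_F)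
    have st: "s \<le> t" "v \<le> u + \<epsilon>" using a by auto
    have "integrable M (\<lambda>\<omega>. \<phi> s t \<omega> * \<eta> \<omega>)" "integrable M (\<lambda>\<omega>. \<phi> u v \<omega> * \<eta> \<omega>)"
      "integrable M (\<lambda>\<omega>. \<phi>' s t \<omega> * \<eta> \<omega>)" "integrable M (\<lambda>\<omega>. \<phi>' u v \<omega> * \<eta> \<omega>)"
      by (intro L2_integrable_mult \<eta>M A.L2_phi_M B.L2_phi_M st a)+
    then show "(\<integral>\<omega>. (\<phi> s t \<omega> - \<phi>' s t \<omega>) * \<eta> \<omega> \<partial>M) = (\<integral>\<omega>. (\<phi> u v \<omega> - \<phi>' u v \<omega>) * \<eta> \<omega> \<partial>M)"
      using A.coherent[OF a \<eta>] B.coherent[OF a \<eta>] by (simp add: left_diff_distrib)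
  qed (rule A.eps)
qed

locale dense_commutative_representation = commutative_representation M T F X f
  for M :: "'w measure" and T F
    and X :: "real \<Rightarrow> real \<Rightarrow> 'w \<Rightarrow> 'g::{polish_group, topological_ab_group_add}" and f +
  fixes a :: "nat \<Rightarrow> 'g"
  assumes dense: "\<delta> > 0 \<Longrightarrow> \<exists>i. f (x - a i) < \<delta>"
begin

text \<open>Rounds the shift \<open>b - w\<close> to the earliest member of the dense sequence
  within \<open>\<delta>\<close>; taking the least index makes the choice measurable in
  \<open>w\<close>.\<close>

definition nearest :: "'g \<Rightarrow> real \<Rightarrow> 'g \<Rightarrow> nat" where
  "nearest b \<delta> w = (LEAST i. f ((b - w) - a i) < \<delta>)"

lemma nearest: "\<delta> > 0 \<Longrightarrow> f ((b - w) - a (nearest b \<delta> w)) < \<delta>"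
  unfolding nearest_def using dense by (rule LeastI_ex)

lemma nearest_measurable [measurable]: "nearest b \<delta> \<in> borel \<rightarrow>\<^sub>M count_space UNIV"
proof -
  have "nearest b \<delta> = (\<lambda>w. LEAST i. f (w - (b - a i)) < \<delta>)"
  proof (rule ext)
    fix w
    have "(b - w) - a i = - (w - (b - a i))" for i by (simp add: algebra_simps)
    then have "f ((b - w) - a i) = f (w - (b - a i))" for i using f_minus by metis
    then show "nearest b \<delta> w = (LEAST i. f (w - (b - a i)) < \<delta>)" by (simp add: nearest_def)
  qed
  also have "\<dots> \<in> borel \<rightarrow>\<^sub>M count_space UNIV" by measurable
  finally show ?thesis .
qed

text \<open>The expected residual for the shift obtained by rounding \<open>b - W\<close>, where
  \<open>W\<close> has the law of an increment of length \<open>s\<close>. It does not depend on the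
  block, because the increments outside a block always have total length \<open>s\<close>.\<close>

definition mean_residual :: "real \<Rightarrow> 'g \<Rightarrow> real \<Rightarrow> real \<Rightarrow> real \<Rightarrow> real" where
  "mean_residual \<epsilon> b \<delta> s h = (\<integral>w. residual \<epsilon> (a (nearest b \<delta> w)) h \<partial>law s)"

lemma phi_dist_le:
  assumes "\<epsilon> > 0" "u \<le> v" "v \<le> u + \<epsilon>" "f (c - c') < \<delta>"
  shows "\<bar>\<phi> \<epsilon> c u v \<omega> - \<phi> \<epsilon> c' u v \<omega>\<bar> \<le> 2 * \<delta>"
proof -
  have r: "\<epsilon> - (v - u) \<ge> 0" "\<epsilon> \<ge> 0" using assms by auto
  have fc: "f (c' - c) = f (c - c')" using f_minus[of "c - c'"] by simp
  have "\<bar>g (\<epsilon> - (v - u)) (X u v \<omega> - c) - g (\<epsilon> - (v - u)) (X u v \<omega> - c')\<bar> \<le> f (c - c')"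
    using g_lipschitz[OF r(1), of "X u v \<omega> - c" "X u v \<omega> - c'"] by (simp add: fc)
  moreover have "\<bar>g \<epsilon> (- c) - g \<epsilon> (- c')\<bar> \<le> f (c - c')"
    using g_lipschitz[OF r(2), of "- c" "- c'"] by (simp add: fc)
  ultimately show ?thesis using assms(4) unfolding \<phi>_def by linarith
qed

text \<open>The pointwise bound \<open>2 * \<delta>\<close> by itself gives
  \<open>4 * \<delta>\<^sup>2\<close> whatever the length, and a sum over many short blocks would be
  out of control. By coherence of the difference this bound is used at length
  \<open>\<epsilon>\<close> only and decreases linearly from there.\<close>

lemma phi_dist_norm:
  assumes eps: "\<epsilon> > 0" and h: "u < v" "v \<le> u + \<epsilon>" and c: "f (c - c') < \<delta>"
  shows "sq_dist M (\<phi> \<epsilon> c u v) (\<phi> \<epsilon> c' u v) \<le> 8 * \<delta>\<^sup>2 * (v - u) / \<epsilon>"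
proof -
  interpret D: coherent_family M T F "\<lambda>s t \<omega>. \<phi> \<epsilon> c s t \<omega> - \<phi> \<epsilon> c' s t \<omega>" \<epsilon>
    by (rule coherent_family_diff[OF coherent_phi[OF eps] coherent_phi[OF eps]])
  have e: "0 \<le> \<epsilon>" "\<epsilon> \<le> 0 + \<epsilon>" using eps by auto
  have "sq_dist M (\<phi> \<epsilon> c 0 \<epsilon>) (\<phi> \<epsilon> c' 0 \<epsilon>) \<le> (\<integral>\<omega>. (2 * \<delta>)\<^sup>2 \<partial>M)"
  proof (rule integral_mono[OF L2_square[OF D.L2_phi_M[OF e]]])
    show "(\<phi> \<epsilon> c 0 \<epsilon> \<omega> - \<phi> \<epsilon> c' 0 \<epsilon> \<omega>)\<^sup>2 \<le> (2 * \<delta>)\<^sup>2" for \<omega>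
      using phi_dist_le[OF eps e c, of \<omega>] by (metis abs_ge_zero power2_abs power_mono)
  qed simp
  then have le: "sq_dist M (\<phi> \<epsilon> c 0 \<epsilon>) (\<phi> \<epsilon> c' 0 \<epsilon>) \<le> 4 * \<delta>\<^sup>2"
    by (simp add: prob_space power_mult_distrib)
  have "sq_dist M (\<phi> \<epsilon> c u v) (\<phi> \<epsilon> c' u v)
      \<le> (2 * (v - u) / \<epsilon>) * sq_dist M (\<phi> \<epsilon> c 0 \<epsilon>) (\<phi> \<epsilon> c' 0 \<epsilon>)"
    using D.phi_linear[of "v - u" u] h by simp
  also have "\<dots> \<le> (2 * (v - u) / \<epsilon>) * (4 * \<delta>\<^sup>2)"
    using h eps le by (intro mult_left_mono) auto
  also have "\<dots> = 8 * \<delta>\<^sup>2 * (v - u) / \<epsilon>" by (simp add: field_simps)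
  finally show ?thesis .
qed

section \<open>Approximation over a single block\<close>

context
  fixes \<epsilon> \<delta> s u v :: real and b :: 'g
  assumes eps: "\<epsilon> > 0" and delta: "\<delta> > 0" and uv: "0 \<le> u" "u < v" "v \<le> s" "v \<le> u + \<epsilon>"
begin

text \<open>The increments of \<open>[0, s + (v - u)]\<close> outside \<open>[u, v]\<close>. The
  interval is longer than \<open>[0, s]\<close> by the length of the block, so their total length is
  \<open>s\<close> whatever the block.\<close>

private definition W :: "'w \<Rightarrow> 'g" where
  "W \<omega> = X 0 u \<omega> + X v (s + (v - u)) \<omega>"

private definition rest :: "'w measure" where
  "rest = join_algebra (F 0 u) (F v (s + (v - u)))"

private lemma ord: "u \<le> v" "0 \<le> v" "v \<le> s + (v - u)" "0 \<le> s + (v - u)" "0 \<le> s"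
  using uv by auto

private lemma sub: "subalgebra M (F 0 u)" "subalgebra M (F u v)" "subalgebra M (F v (s + (v - u)))" "subalgebra M (F 0 v)"
  using uv ord by (auto intro!: F_sub)

private lemma sub_rest: "subalgebra M rest"
  unfolding rest_def by (rule subalgebra_join[OF sub(1,3)])

private lemma indep_rest: "indep_set (sets rest) (sets (F u v))"
  unfolding rest_def
  by (rule indep_set_join[OF sub]) (use uv ord in \<open>auto intro!: F_mono F_indep\<close>)

private lemma W_join:
  assumes "X 0 u \<in> A \<rightarrow>\<^sub>M borel" "X v (s + (v - u)) \<in> A \<rightarrow>\<^sub>M borel"
  shows "W \<in> A \<rightarrow>\<^sub>M borel"
  using assms unfolding W_def[abs_def] by measurable

private lemma W_rest: "W \<in> rest \<rightarrow>\<^sub>M borel"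
  unfolding rest_def
  by (rule W_join; rule measurable_from_subalg[OF _ X_F])
    (use uv ord subalgebra_join_left[OF sub(1,3)] subalgebra_join_right[OF sub(1,3)] in auto)

private lemma W_M [measurable]: "W \<in> M \<rightarrow>\<^sub>M borel"
  by (rule measurable_from_subalg[OF sub_rest W_rest])

private lemma X_uv [measurable]: "X u v \<in> M \<rightarrow>\<^sub>M borel"
  by (rule X_M[OF ord(1)])

private lemma X_W: "AE \<omega> in M. X 0 (s + (v - u)) \<omega> = W \<omega> + X u v \<omega>"
  using X_add[of 0 v "s + (v - u)"] X_add[of 0 u v] uv ord
  by (auto simp: W_def algebra_simps elim: eventually_elim2)

private lemma distr_W: "distr M borel W = law s"
  unfolding W_def using distr_X_plus_X[of 0 u v "s + (v - u)"] uv ord by simp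

text \<open>The error of rounding the shift; \<open>D2\<close> is the residual at the rounded shift,
  and the sum of both is the whole error of the approximation.\<close>

private definition D1 :: "'w \<Rightarrow> real" where
  "D1 \<omega> = \<phi> \<epsilon> (b - W \<omega>) u v \<omega> - \<phi> \<epsilon> (a (nearest b \<delta> (W \<omega>))) u v \<omega>"

private definition D2 :: "'w \<Rightarrow> real" where
  "D2 \<omega> = \<phi> \<epsilon> (a (nearest b \<delta> (W \<omega>))) u v \<omega> - Y \<epsilon> (a (nearest b \<delta> (W \<omega>))) u v \<omega>"

text \<open>\<open>D1\<close> as a function of the independent pair \<open>(W, X u v)\<close>, so
  that \<open>W\<close> can be frozen.\<close>

private definition \<kappa> :: "'g \<times> 'g \<Rightarrow> real" where
  "\<kappa> p = (g (\<epsilon> - (v - u)) (snd p + fst p - b) - g \<epsilon> (fst p - b))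
     - (g (\<epsilon> - (v - u)) (snd p + - a (nearest b \<delta> (fst p))) - g \<epsilon> (- a (nearest b \<delta> (fst p))))"

private lemma kappa_measurable [measurable]: "\<kappa> \<in> borel_measurable (borel \<Otimes>\<^sub>M borel)"
proof -
  have [measurable]: "g (\<epsilon> - (v - u)) \<in> borel_measurable borel" "g \<epsilon> \<in> borel_measurable borel"
    using uv eps by (auto intro!: g_measurable)
  have [measurable]: "(\<lambda>w. - a (nearest b \<delta> w)) \<in> borel \<rightarrow>\<^sub>M borel"
    by (rule measurable_compose[OF nearest_measurable]) simp
  have "(\<lambda>p. g (\<epsilon> - (v - u)) (snd p + fst p - b)) \<in> borel_measurable (borel \<Otimes>\<^sub>M borel)"
    "(\<lambda>p. g \<epsilon> (fst p - b)) \<in> borel_measurable (borel \<Otimes>\<^sub>M borel)"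
    "(\<lambda>p. g (\<epsilon> - (v - u)) (snd p + - a (nearest b \<delta> (fst p)))) \<in> borel_measurable (borel \<Otimes>\<^sub>M borel)"
    "(\<lambda>p. g \<epsilon> (- a (nearest b \<delta> (fst p)))) \<in> borel_measurable (borel \<Otimes>\<^sub>M borel)"
    by measurable
  then show ?thesis unfolding \<kappa>_def[abs_def] by (intro borel_measurable_diff)
qed

private lemma kappa_phi: "\<kappa> (w, X u v \<omega>) = \<phi> \<epsilon> (b - w) u v \<omega> - \<phi> \<epsilon> (a (nearest b \<delta> w)) u v \<omega>"
  by (simp add: \<kappa>_def \<phi>_def algebra_simps)

private lemma D1_eq: "D1 \<omega> = \<kappa> (W \<omega>, X u v \<omega>)"
  by (simp add: D1_def kappa_phi)

private lemma kappa_bound: "\<bar>\<kappa> p\<bar> \<le> 2"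
proof -
  have "0 \<le> g (\<epsilon> - (v - u)) x \<and> g (\<epsilon> - (v - u)) x \<le> 1" "0 \<le> g \<epsilon> x \<and> g \<epsilon> x \<le> 1" for x
    using g_range[of "\<epsilon> - (v - u)" x] g_range[of \<epsilon> x] uv eps by auto
  then show ?thesis unfolding \<kappa>_def
    by (smt (verit))
qed

private lemma L2_D1: "D1 \<in> L2 M M"
proof (rule L2_bounded[OF sub_refl])
  show "D1 \<in> borel_measurable M" unfolding D1_eq[abs_def] by measurable
  show "\<bar>D1 \<omega>\<bar> \<le> 2" for \<omega> unfolding D1_eq by (rule kappa_bound)
qed

private lemma D1_norm: "sq_norm M D1 \<le> 8 * \<delta>\<^sup>2 * (v - u) / \<epsilon>"
proof -
  define B where "B = 8 * \<delta>\<^sup>2 * (v - u) / \<epsilon>"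
  have k2: "(\<lambda>p. (\<kappa> p)\<^sup>2) \<in> borel_measurable (borel \<Otimes>\<^sub>M borel)" by measurable
  have k4: "\<bar>(\<kappa> p)\<^sup>2\<bar> \<le> 4" for p
    using power_mono[OF kappa_bound[of p], of 2] by simp
  have inner: "(\<integral>y. (\<kappa> (w, y))\<^sup>2 \<partial>distr M borel (X u v)) \<le> B" for w
  proof -
    have "(\<integral>y. (\<kappa> (w, y))\<^sup>2 \<partial>distr M borel (X u v)) = (\<integral>\<omega>. (\<kappa> (w, X u v \<omega>))\<^sup>2 \<partial>M)"
      by (rule integral_distr) measurable
    also have "\<dots> \<le> B"
      unfolding kappa_phi B_def by (rule phi_dist_norm[OF eps uv(2,4) nearest[OF delta]])
    finally show ?thesis .
  qed
  have "(\<integral>\<omega>. (D1 \<omega>)\<^sup>2 * 1 \<partial>M) = (\<integral>\<omega>. (\<integral>y. (\<kappa> (W \<omega>, y))\<^sup>2 \<partial>distr M borel (X u v)) * 1 \<partial>M)"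
    unfolding D1_eq
    by (rule freeze[OF indep_rest sub_rest sub(2) W_rest X_F[OF ord(1)] k2 k4]) auto
  also have "\<dots> \<le> (\<integral>\<omega>. B \<partial>M)"
  proof (rule integral_mono)
    interpret D: prob_space "distr M borel (X u v)" by (rule prob_space_distr) measurable
    have m: "(\<lambda>\<omega>. \<integral>y. (\<kappa> (W \<omega>, y))\<^sup>2 \<partial>distr M borel (X u v)) \<in> borel_measurable M"
      by measurable
    have "\<bar>\<integral>y. (\<kappa> (W \<omega>, y))\<^sup>2 \<partial>distr M borel (X u v)\<bar> \<le> B" for \<omega>
      using inner[of "W \<omega>"] by simp
    then show "integrable M (\<lambda>\<omega>. (\<integral>y. (\<kappa> (W \<omega>, y))\<^sup>2 \<partial>distr M borel (X u v)) * 1)"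
      using m by (intro integrable_const_bound[where B=B]) auto
    show "(\<integral>y. (\<kappa> (W \<omega>, y))\<^sup>2 \<partial>distr M borel (X u v)) * 1 \<le> B" for \<omega> using inner by simp
  qed simp
  finally show ?thesis by (simp add: prob_space B_def)
qed

text \<open>A random shift is admissible in \<open>Y\<close> because it takes values in the
  countable sequence \<open>a\<close>. Conditioning on its index, which depends on \<open>W\<close>
  and is independent of \<open>F u v\<close>, leaves the residual at a fixed shift, averaged over
  the law of \<open>W\<close>.\<close>

private lemma
  shows L2_D2: "D2 \<in> L2 M M"
    and D2_norm: "sq_norm M D2 = mean_residual \<epsilon> b \<delta> s (v - u)"
proof -
  define r where "r i \<omega> = (\<phi> \<epsilon> (a i) u v \<omega> - Y \<epsilon> (a i) u v \<omega>)\<^sup>2" for i \<omega>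
  let ?J = "\<lambda>\<omega>. nearest b \<delta> (W \<omega>)"
  have J: "?J \<in> rest \<rightarrow>\<^sub>M count_space UNIV" by (rule measurable_compose[OF W_rest nearest_measurable])
  have L: "(\<lambda>\<omega>. \<phi> \<epsilon> c u v \<omega> - Y \<epsilon> c u v \<omega>) \<in> L2 M (F u v)" for c
    by (intro L2_diff sub L2_phi L2_Y eps uv ord)
  have rm: "r i \<in> borel_measurable (F u v)" for i unfolding r_def using L2_measurable[OF L] by measurable
  have ri: "integrable M (r i)" for i unfolding r_def by (rule L2_square[OF L])
  have er: "(\<integral>\<omega>. r i \<omega> \<partial>M) = residual \<epsilon> (a i) (v - u)" for i
    unfolding r_def by (rule residual_shift[OF eps ord(1) uv(4)])
  have rb: "(\<integral>\<omega>. r i \<omega> \<partial>M) \<le> 2 * (v - u) / \<epsilon>" for i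
    unfolding er by (rule residual_linear[OF eps]) (use uv in auto)
  note fc = freeze_countable[OF indep_rest sub_rest sub(2) J rm ri _ rb]
  have D2r: "(D2 \<omega>)\<^sup>2 = r (?J \<omega>) \<omega>" for \<omega> by (simp add: D2_def r_def)
  have m: "D2 \<in> borel_measurable M" unfolding D2_def
    by (rule measurable_compose_countable[where f="\<lambda>i \<omega>. \<phi> \<epsilon> (a i) u v \<omega> - Y \<epsilon> (a i) u v \<omega>", OF _ measurable_from_subalg[OF sub_rest J]])
      (rule L2_measurable[OF L2_subalg[OF sub(2) L]])
  show "D2 \<in> L2 M M" using m fc(1) by (simp add: L2_def D2r r_def)
  have "sq_norm M D2 = (\<integral>\<omega>. residual \<epsilon> (a (?J \<omega>)) (v - u) \<partial>M)"
    unfolding D2r using fc(2) by (simp add: r_def er[unfolded r_def])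
  also have "\<dots> = (\<integral>w. residual \<epsilon> (a (nearest b \<delta> w)) (v - u) \<partial>distr M borel W)"
    by (rule integral_distr[symmetric]) measurable
  finally show "sq_norm M D2 = mean_residual \<epsilon> b \<delta> s (v - u)"
    unfolding distr_W mean_residual_def .
qed

text \<open>The approximant is affine in the first chaos element over \<open>[u, v]\<close>, with coefficients
  chosen according to the remaining increments \<open>W\<close>.\<close>

lemma block_approximation:
  defines "A \<equiv> join_algebra (join_algebra (F 0 u) (gen M (range (\<lambda>i. Y \<epsilon> (a i) u v)))) (F v (s + (v - u)))"
  shows "\<exists>\<Psi>\<in>L2 M A. (\<integral>\<omega>. (g (\<epsilon> - (v - u)) (X 0 (s + (v - u)) \<omega> - b) - \<Psi> \<omega>)\<^sup>2 \<partial>M)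
    \<le> 16 * \<delta>\<^sup>2 * (v - u) / \<epsilon> + 2 * mean_residual \<epsilon> b \<delta> s (v - u)"
proof
  define \<Gamma> where "\<Gamma> \<omega> = g (\<epsilon> - (v - u)) (X 0 (s + (v - u)) \<omega> - b)" for \<omega>
  define \<Psi> where "\<Psi> \<omega> = g \<epsilon> (W \<omega> - b) + Y \<epsilon> (a (nearest b \<delta> (W \<omega>))) u v \<omega>" for \<omega>
  have r: "0 \<le> \<epsilon> - (v - u)" "0 \<le> \<epsilon>" using uv eps by auto
  \<comment> \<open>Since \<open>X 0 (s + (v - u)) = W + X u v\<close> almost everywhere,
    \<open>\<Gamma>\<close> is \<open>g \<epsilon> (W - b)\<close> plus \<open>\<phi>\<close> over
    the block at shift \<open>b - W\<close>. \<open>\<Psi>\<close> keeps the former and replaces the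
    latter by the functional at the rounded shift.\<close>
  have ae: "AE \<omega> in M. \<Gamma> \<omega> - \<Psi> \<omega> = D1 \<omega> + D2 \<omega>"
    using X_W by eventually_elim (simp add: \<Gamma>_def \<Psi>_def D1_def D2_def \<phi>_def algebra_simps)
  have [measurable]: "X 0 (s + (v - u)) \<in> M \<rightarrow>\<^sub>M borel" by (rule X_M[OF ord(4)])
  have \<Gamma>: "\<Gamma> \<in> L2 M M"
  proof (rule L2_bounded[OF sub_refl, of _ 1])
    show "\<Gamma> \<in> borel_measurable M" unfolding \<Gamma>_def
      by (rule measurable_compose[OF _ g_measurable[OF r(1)]]) measurable
  qed (use g_range[OF r(1)] in \<open>auto simp: \<Gamma>_def\<close>)
  define Z where "Z = gen M (range (\<lambda>i. Y \<epsilon> (a i) u v))"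
  have YM: "Y \<epsilon> c u v \<in> borel_measurable M" for c
    by (rule L2_measurable[OF L2_F[OF L2_Y[OF eps ord(1)] ord(1)]])
  have Z: "subalgebra M Z" unfolding Z_def by (rule gen_least) (auto simp: YM)
  have FZ: "subalgebra M (join_algebra (F 0 u) Z)" by (rule subalgebra_join[OF sub(1) Z])
  have A: "subalgebra M A" unfolding A_def Z_def[symmetric] by (rule subalgebra_join[OF FZ sub(3)])
  have sAl: "subalgebra A (join_algebra (F 0 u) Z)" and sAr: "subalgebra A (F v (s + (v - u)))"
    unfolding A_def Z_def[symmetric]
    by (rule subalgebra_join_left[OF FZ sub(3)], rule subalgebra_join_right[OF FZ sub(3)])
  have WA: "W \<in> A \<rightarrow>\<^sub>M borel"
  proof (rule W_join)
    show "X 0 u \<in> A \<rightarrow>\<^sub>M borel"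
      by (rule measurable_from_subalg[OF sAl measurable_from_subalg[OF subalgebra_join_left[OF sub(1) Z] X_F[OF uv(1)]]])
    show "X v (s + (v - u)) \<in> A \<rightarrow>\<^sub>M borel" by (rule measurable_from_subalg[OF sAr X_F[OF ord(3)]])
  qed
  have YA: "Y \<epsilon> (a i) u v \<in> borel_measurable A" for i
    by (rule measurable_from_subalg[OF sAl measurable_from_subalg[OF subalgebra_join_right[OF sub(1) Z]]])
      (auto simp: Z_def intro: gen_measurable)
  have \<Psi>A: "\<Psi> \<in> borel_measurable A"
    unfolding \<Psi>_def[abs_def]
  proof (rule borel_measurable_add)
    show "(\<lambda>\<omega>. g \<epsilon> (W \<omega> - b)) \<in> borel_measurable A"
      by (rule measurable_compose[OF borel_measurable_diff_const[OF WA] g_measurable[OF r(2)]])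
    show "(\<lambda>\<omega>. Y \<epsilon> (a (nearest b \<delta> (W \<omega>))) u v \<omega>) \<in> borel_measurable A"
      by (rule measurable_compose_countable[where f="\<lambda>i. Y \<epsilon> (a i) u v", OF YA measurable_compose[OF WA nearest_measurable]])
  qed
  have DD: "(\<lambda>\<omega>. D1 \<omega> + D2 \<omega>) \<in> L2 M M" by (rule L2_add[OF sub_refl L2_D1 L2_D2])
  have "\<Psi> \<in> L2 M M"
  proof (rule L2_AE_cong[OF L2_diff[OF sub_refl \<Gamma> DD] measurable_from_subalg[OF A \<Psi>A]])
    show "AE \<omega> in M. \<Gamma> \<omega> - (D1 \<omega> + D2 \<omega>) = \<Psi> \<omega>" using ae by eventually_elim simp
  qed
  then show "\<Psi> \<in> L2 M A" using \<Psi>A by (simp add: L2_def)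
  have "sq_dist M \<Gamma> \<Psi> = (\<integral>\<omega>. (D1 \<omega> + D2 \<omega>)\<^sup>2 \<partial>M)"
    using L2_measurable[OF \<Gamma>] L2_measurable[OF \<open>\<Psi> \<in> L2 M M\<close>] L2_measurable[OF DD] ae
    by (intro integral_cong_AE) (auto elim: eventually_mono)
  also have "\<dots> \<le> 2 * sq_norm M D1 + 2 * sq_norm M D2"
    by (rule L2_add_le[OF L2_D1 L2_D2])
  also have "\<dots> \<le> 2 * (8 * \<delta>\<^sup>2 * (v - u) / \<epsilon>) + 2 * mean_residual \<epsilon> b \<delta> s (v - u)"
    using D1_norm D2_norm by simp
  finally show "(\<integral>\<omega>. (g (\<epsilon> - (v - u)) (X 0 (s + (v - u)) \<omega> - b) - \<Psi> \<omega>)\<^sup>2 \<partial>M)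
    \<le> 16 * \<delta>\<^sup>2 * (v - u) / \<epsilon> + 2 * mean_residual \<epsilon> b \<delta> s (v - u)"
    by (simp add: \<Gamma>_def)
qed

end

text \<open>For each \<open>w\<close> the integrand tends to \<open>0\<close> because the residual
  is \<open>o(h)\<close>, at a rate that may depend on \<open>w\<close>; the bound
  \<open>2 * s / \<epsilon>\<close>, common to all shifts, permits dominated convergence.\<close>

lemma mean_residual_tendsto:
  assumes eps: "\<epsilon> > 0" and s: "s > 0"
  shows "(\<lambda>n. real n * mean_residual \<epsilon> b \<delta> s (s / real n)) \<longlonglongrightarrow> 0"
proof -
  interpret law: prob_space "law s" by (rule prob_space_law) (use s in simp)
  let ?r = "\<lambda>n w. real n * residual \<epsilon> (a (nearest b \<delta> w)) (s / real n)"
  \<comment> \<open>The dominating bound requires steps of length at most \<open>\<epsilon>\<close>,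
    so the sequence is started at such an \<open>n0\<close>; the offset is removed at the
    end.\<close>
  obtain n0 where n0: "n0 > 0" "s / real n0 \<le> \<epsilon>"
  proof -
    obtain n where n: "s / \<epsilon> < real n" using reals_Archimedean2 by blast
    then have "n > 0" using s eps by (metis divide_pos_pos less_asym of_nat_0_less_iff order_less_trans)
    then show thesis using n eps by (intro that[of n]) (auto simp: field_simps)
  qed
  have lim: "(\<lambda>n. ?r n w) \<longlonglongrightarrow> 0" for w
  proof -
    have "filterlim (\<lambda>n. s / real n) (at_right 0) sequentially"
      unfolding filterlim_at
    proof (intro conjI)
      show "(\<lambda>n. s / real n) \<longlonglongrightarrow> 0" by (rule lim_const_over_n)
      show "\<forall>\<^sub>F n in sequentially. s / real n \<in> {0<..} \<and> s / real n \<noteq> 0"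
        using eventually_gt_at_top[of 0] by eventually_elim (use s in auto)
    qed
    from filterlim_compose[OF residual_tendsto[OF eps, of "a (nearest b \<delta> w)"] this]
    have "(\<lambda>n. s * (residual \<epsilon> (a (nearest b \<delta> w)) (s / real n) / (s / real n))) \<longlonglongrightarrow> s * 0"
      by (intro tendsto_mult tendsto_const)
    then show ?thesis using s by (simp add: mult.commute)
  qed
  have "(\<lambda>n. \<integral>w. ?r (n + n0) w \<partial>law s) \<longlonglongrightarrow> (\<integral>w. 0 \<partial>law s)"
  proof (rule integral_dominated_convergence[where w="\<lambda>w. 2 * s / \<epsilon>"])
    show "AE w in law s. (\<lambda>n. ?r (n + n0) w) \<longlonglongrightarrow> 0"
      using lim by (intro AE_I2 LIMSEQ_ignore_initial_segment)
    show "AE w in law s. norm (?r (n + n0) w) \<le> 2 * s / \<epsilon>" for n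
    proof (rule AE_I2)
      fix w
      have pos: "0 < real (n + n0)" using n0 by simp
      have "s / real (n + n0) \<le> s / real n0" using n0 s by (intro divide_left_mono) auto
      then have "residual \<epsilon> (a (nearest b \<delta> w)) (s / real (n + n0)) \<le> 2 * (s / real (n + n0)) / \<epsilon>"
        using n0 s by (intro residual_linear[OF eps]) auto
      then have "real (n + n0) * residual \<epsilon> (a (nearest b \<delta> w)) (s / real (n + n0))
          \<le> real (n + n0) * (2 * (s / real (n + n0)) / \<epsilon>)"
        using pos by (intro mult_left_mono) auto
      also have "\<dots> = 2 * s / \<epsilon>" using pos by simp
      finally show "norm (?r (n + n0) w) \<le> 2 * s / \<epsilon>"
        using pos by (simp add: residual_def del: of_nat_add)
    qed
    show "(\<lambda>w. ?r (n + n0) w) \<in> borel_measurable (law s)" for n by measurable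
  qed auto
  then have "(\<lambda>n. real (n + n0) * mean_residual \<epsilon> b \<delta> s (s / real (n + n0))) \<longlonglongrightarrow> 0"
    by (simp add: mean_residual_def)
  then show ?thesis by (rule LIMSEQ_offset)
qed

section \<open>Exchanging the fields of the blocks for functionals\<close>

context
  fixes \<epsilon> s h :: real and b :: 'g and n :: nat
  assumes eps: "\<epsilon> > 0" and n: "n > 0" and h: "0 < h" "h \<le> \<epsilon>" "s = real n * h"
begin

private definition H :: "nat \<Rightarrow> 'w measure" where
  "H k = gen M {Y \<epsilon> (a i) (real j * h) (real (Suc j) * h) | i j. k \<le> j \<and> j < n}"

text \<open>An interpolating chain: the past up to \<open>k * h\<close> is known in full, the later
  blocks only through their functionals. At \<open>k = n\<close> it is the field up to
  \<open>s\<close>; at \<open>k = 0\<close> the full part is \<open>F 0 0\<close>, which is trivial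
  up to null sets.\<close>

definition blocks :: "nat \<Rightarrow> 'w measure" where
  "blocks k = join_algebra (F 0 (real k * h)) (H k)"

definition target :: "'w \<Rightarrow> real" where
  "target \<omega> = f (X 0 (s + \<epsilon>) \<omega> - b)"

private lemma grid: "0 \<le> real j * h" "real j * h \<le> real (Suc j) * h" "j \<le> k \<Longrightarrow> real j * h \<le> real k * h"
  using h by (auto intro!: mult_right_mono)

private lemma H_measurable:
  "k \<le> j \<Longrightarrow> j < n \<Longrightarrow> Y \<epsilon> (a i) (real j * h) (real (Suc j) * h) \<in> borel_measurable (H k)"
  unfolding H_def by (rule gen_measurable) blast

private lemma H_least:
  assumes "space N = space M" "\<And>i j. k \<le> j \<Longrightarrow> j < n \<Longrightarrow> Y \<epsilon> (a i) (real j * h) (real (Suc j) * h) \<in> borel_measurable N"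
  shows "subalgebra N (H k)"
  unfolding H_def by (rule gen_least[OF assms(1)]) (use assms(2) in auto)

private lemma Y_F: "x \<le> real j * h \<Longrightarrow> real (Suc j) * h \<le> y \<Longrightarrow>
    Y \<epsilon> (a i) (real j * h) (real (Suc j) * h) \<in> borel_measurable (F x y)"
  by (rule L2_measurable[OF L2_F_mono[OF L2_Y[OF eps]]]) (use grid in auto)

private lemma H_F: "y \<ge> s \<Longrightarrow> k \<le> n \<Longrightarrow> subalgebra (F (real k * h) y) (H k)"
proof (rule H_least)
  assume y: "y \<ge> s" and k: "k \<le> n"
  have kn: "real k * h \<le> y" using grid(3)[OF k] h(3) y by linarith
  show "space (F (real k * h) y) = space M" by (rule F_space[OF kn])
  fix i j assume j: "k \<le> j" "j < n"
  have "real (Suc j) * h \<le> real n * h" using j by (intro grid(3)) simp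
  then show "Y \<epsilon> (a i) (real j * h) (real (Suc j) * h) \<in> borel_measurable (F (real k * h) y)"
    by (intro Y_F; use grid(3)[OF j(1)] h(3) y in linarith)
qed

private lemma H_M: "subalgebra M (H k)"
  by (rule H_least[OF refl], rule L2_measurable[OF L2_F[OF L2_Y[OF eps]]]) (use grid in auto)

lemma sub_blocks: "subalgebra M (blocks k)"
  unfolding blocks_def by (rule subalgebra_join[OF F_sub H_M]) (rule grid)

lemma blocks_F: "k \<le> n \<Longrightarrow> subalgebra (F 0 s) (blocks k)"
  unfolding blocks_def
proof (rule join_least[OF F_sub H_M])
  assume k: "k \<le> n"
  then have ks: "real k * h \<le> s" using grid(3)[of k n] h by simp
  show "subalgebra (F 0 s) (F 0 (real k * h))" by (rule F_mono) (use ks grid in auto)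
  have "subalgebra (F (real k * h) s) (H k)" by (rule H_F[OF order_refl k])
  moreover have "subalgebra (F 0 s) (F (real k * h) s)" by (rule F_mono) (use ks grid in auto)
  ultimately show "subalgebra (F 0 s) (H k)" by (auto simp: subalgebra_def)
qed (rule grid)

lemma blocks_left: "subalgebra (blocks k) (F 0 (real k * h))"
  unfolding blocks_def by (rule subalgebra_join_left[OF F_sub H_M]) (rule grid)

lemma blocks_right: "subalgebra (blocks k) (H k)"
  unfolding blocks_def by (rule subalgebra_join_right[OF F_sub H_M]) (rule grid)

lemma blocks_mono: "subalgebra (blocks (Suc k)) (blocks k)"
proof -
  have sp: "space (blocks k) = space M" for k using sub_blocks[of k] by (simp add: subalgebra_def)
  have F: "subalgebra (F 0 (real (Suc k) * h)) (F 0 (real k * h))"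
    by (rule F_mono) (use grid in auto)
  show ?thesis unfolding blocks_def[of k]
  proof (rule join_least[OF F_sub H_M])
    show "subalgebra (blocks (Suc k)) (F 0 (real k * h))"
      using F blocks_left[of "Suc k"] by (auto simp: subalgebra_def)
    show "subalgebra (blocks (Suc k)) (H k)"
    proof (rule H_least[OF sp])
      fix i j assume j: "k \<le> j" "j < n"
      show "Y \<epsilon> (a i) (real j * h) (real (Suc j) * h) \<in> borel_measurable (blocks (Suc k))"
      proof (cases "j = k")
        case True
        then show ?thesis
          by (intro measurable_from_subalg[OF blocks_left] Y_F) (use grid in auto)
      next
        case False
        then show ?thesis
          using j by (intro measurable_from_subalg[OF blocks_right H_measurable]) auto
      qed
    qed
  qed (rule grid)
qed

private definition x :: "nat \<Rightarrow> 'w \<Rightarrow> real" where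
  "x k = real_cond_exp M (blocks k) target"

private lemma s_pos: "0 \<le> s" "0 \<le> s + \<epsilon>" "0 \<le> s + h" "s + h \<le> s + \<epsilon>"
  using h n eps by auto

private lemma target_M: "target \<in> borel_measurable M"
  unfolding target_def using X_M[OF s_pos(2)] by measurable

private lemma target_L2: "target \<in> L2 M M"
  by (rule L2_bounded[OF sub_refl target_M, of 1]) (simp add: target_def f_range)

private lemma L2_x: "x k \<in> L2 M (blocks k)"
  unfolding x_def by (rule L2_real_cond_exp[OF sub_blocks target_M]) (auto simp: target_def f_range)

private lemma inner_x: "z \<in> L2 M (blocks k) \<Longrightarrow> L2_inner M (x k) z = L2_inner M target z"
  unfolding x_def by (rule inner_real_cond_exp[OF sub_blocks target_M]) (auto simp: target_def f_range)

private lemma L2_x_M: "x k \<in> L2 M M"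
  by (rule L2_subalg[OF sub_blocks L2_x])

private lemma step_orthogonal:
  assumes w: "w \<in> L2 M (blocks k)"
  shows "(\<integral>\<omega>. (x (Suc k) \<omega> - x k \<omega>) * w \<omega> \<partial>M) = 0"
proof -
  have wM: "w \<in> L2 M M" by (rule L2_subalg[OF sub_blocks w])
  have "L2_inner M (x (Suc k)) w = L2_inner M (x k) w"
    using inner_x[OF w] inner_x[OF L2_mono[OF blocks_mono w]] by simp
  then show ?thesis
    using L2_integrable_mult[OF L2_x_M wM] by (simp add: left_diff_distrib)
qed

text \<open>The squared norm of the step \<open>d\<close> is its inner product with the target.
  Projection to time \<open>s + h\<close> turns the target into \<open>\<Gamma>\<close>, and
  \<open>d\<close> is orthogonal to the approximant \<open>\<Psi>\<close>, so \<open>d\<close> is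
  not longer than \<open>\<Gamma> - \<Psi>\<close>. As \<open>\<Psi>\<close> uses the full field
  after the block, plain orthogonality to \<open>blocks k\<close> does not suffice.\<close>

lemma block_step:
  assumes k: "k < n" and \<delta>: "\<delta> > 0"
  shows "sq_dist M (x (Suc k)) (x k) \<le> 16 * \<delta>\<^sup>2 * h / \<epsilon> + 2 * mean_residual \<epsilon> b \<delta> s h"
proof -
  let ?u = "real k * h" and ?v = "real (Suc k) * h"
  define d where "d \<omega> = x (Suc k) \<omega> - x k \<omega>" for \<omega>
  have vu: "?v - ?u = h" by (simp add: algebra_simps)
  have ord: "0 \<le> ?u" "?u < ?v" "?v \<le> s" "?v \<le> ?u + \<epsilon>" "?v \<le> s + h"
    using grid(3)[of "Suc k" n] k h by (auto simp: algebra_simps)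
  have d: "d \<in> L2 M (blocks (Suc k))"
    unfolding d_def by (rule L2_diff[OF sub_blocks L2_x L2_mono[OF blocks_mono L2_x]])
  have dM: "d \<in> L2 M M" by (rule L2_subalg[OF sub_blocks d])
  \<comment> \<open>\<open>d\<close> is measurable already at time \<open>s\<close>; the later time
    is chosen so that the projected target carries \<open>g (\<epsilon> - h)\<close>, as in the
    block approximation.\<close>
  have dF: "d \<in> L2 M (F 0 (s + h))"
    by (rule L2_F_mono[OF L2_mono[OF blocks_F d]]) (use k s_pos h in auto)
  define Z where "Z = gen M (range (\<lambda>i. Y \<epsilon> (a i) ?u ?v))"
  define A where "A = join_algebra (join_algebra (F 0 ?u) Z) (F ?v (s + h))"
  obtain \<Psi> where \<Psi>: "\<Psi> \<in> L2 M A"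
    and \<Psi>_le: "(\<integral>\<omega>. (g (\<epsilon> - h) (X 0 (s + h) \<omega> - b) - \<Psi> \<omega>)\<^sup>2 \<partial>M)
      \<le> 16 * \<delta>\<^sup>2 * h / \<epsilon> + 2 * mean_residual \<epsilon> b \<delta> s h"
    using block_approximation[OF eps \<delta> ord(1-4), of b] unfolding vu A_def Z_def by blast
  have Zv: "Y \<epsilon> (a i) ?u ?v \<in> borel_measurable (F 0 ?v)" for i by (rule Y_F) (use grid in auto)
  have F0v: "subalgebra M (F 0 ?v)" "subalgebra M (F 0 ?u)" "subalgebra M (F ?v (s + h))"
    by (rule F_sub[OF grid(1)], rule F_sub[OF grid(1)], rule F_sub[OF ord(5)])
  have ZF: "subalgebra (F 0 ?v) Z"
    unfolding Z_def by (rule gen_least[OF F_space[OF grid(1)]]) (use Zv in blast)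
  have ZM: "subalgebra M Z" using ZF F0v(1) by (auto simp: subalgebra_def)
  have KL: "subalgebra (F 0 ?v) (join_algebra (F 0 ?u) Z)"
    by (rule join_least[OF F0v(2) ZM F_mono ZF]) (use grid in auto)
  have KLM: "subalgebra M (join_algebra (F 0 ?u) Z)" by (rule subalgebra_join[OF F0v(2) ZM])
  have CL: "subalgebra (F ?v (s + h)) (H (Suc k))"
    by (rule H_F) (use k h in auto)
  have Zk: "subalgebra (blocks k) Z"
    unfolding Z_def
  proof (rule gen_least)
    show "space (blocks k) = space M" using sub_blocks[of k] by (simp add: subalgebra_def)
    show "z \<in> borel_measurable (blocks k)" if "z \<in> range (\<lambda>i. Y \<epsilon> (a i) ?u ?v)" for z
      using that H_measurable[OF order_refl k] by (auto intro: measurable_from_subalg[OF blocks_right] simp del: of_nat_Suc)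
  qed
  have Hk: "subalgebra (blocks k) (H (Suc k))"
  proof (rule H_least)
    show "space (blocks k) = space M" using sub_blocks[of k] by (simp add: subalgebra_def)
    show "Y \<epsilon> (a i) (real j * h) (real (Suc j) * h) \<in> borel_measurable (blocks k)" if "Suc k \<le> j" "j < n" for i j
      by (rule measurable_from_subalg[OF blocks_right]) (rule H_measurable; use that in simp)
  qed
  have small: "subalgebra (blocks k) (join_algebra (join_algebra (F 0 ?u) Z) (H (Suc k)))"
    by (intro join_least[OF KLM H_M] join_least[OF F0v(2) ZM] blocks_left Zk Hk)
  \<comment> \<open>Past and future are separated at the end of the block. \<open>\<Psi>\<close>
    takes from the past only \<open>F 0 ?u\<close> and the functionals of this block, but its future
    part is arbitrary; \<open>d\<close> depends on the future through functionals alone. This is the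
    situation of \<open>conditional_orthogonal\<close>.\<close>
  have orth: "L2_inner M d \<Psi> = 0"
  proof (rule conditional_orthogonal[OF F0v(1,3) F_indep KL CL])
    show "d \<in> L2 M (join_algebra (F 0 ?v) (H (Suc k)))" using d by (simp add: blocks_def)
    show "L2_inner M d w = 0"
      if "w \<in> L2 M (join_algebra (join_algebra (F 0 ?u) Z) (H (Suc k)))" for w
      unfolding d_def by (rule step_orthogonal[OF L2_mono[OF small that]])
    show "\<Psi> \<in> L2 M (join_algebra (join_algebra (F 0 ?u) Z) (F ?v (s + h)))" using \<Psi> by (simp add: A_def)
  qed (rule grid(1), rule ord(5))
  define \<Gamma> where "\<Gamma> \<omega> = g (\<epsilon> - h) (X 0 (s + h) \<omega> - b)" for \<omega>
  have r: "0 \<le> \<epsilon> - h" using h by simp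
  have \<Gamma>: "\<Gamma> \<in> L2 M M"
  proof (rule L2_bounded[OF sub_refl, of _ 1])
    show "\<Gamma> \<in> borel_measurable M" unfolding \<Gamma>_def
      by (rule measurable_compose[OF borel_measurable_diff_const[OF X_M[OF s_pos(3)]] g_measurable[OF r]])
  qed (use g_range[OF r] in \<open>auto simp: \<Gamma>_def\<close>)
  have A: "subalgebra M A" unfolding A_def by (rule subalgebra_join[OF KLM F0v(3)])
  have \<Psi>M: "\<Psi> \<in> L2 M M" by (rule L2_subalg[OF A \<Psi>])
  have "sq_norm M d = L2_inner M (x (Suc k)) d - L2_inner M (x k) d"
    using L2_integrable_mult[OF L2_x_M dM] by (simp add: d_def power2_eq_square left_diff_distrib)
  also have "L2_inner M (x k) d = 0"
    using step_orthogonal[OF L2_x] by (simp add: d_def mult.commute)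
  also have "L2_inner M (x (Suc k)) d = L2_inner M target d" by (rule inner_x[OF d])
  also have "\<dots> = L2_inner M \<Gamma> d"
  proof -
    have e: "s + \<epsilon> - (s + h) = \<epsilon> - h" by simp
    show ?thesis unfolding target_def \<Gamma>_def
      by (rule g_X_mult[OF s_pos(3,4) dF, unfolded e, symmetric])
  qed
  also have "\<dots> = (\<integral>\<omega>. d \<omega> * (\<Gamma> \<omega> - \<Psi> \<omega>) \<partial>M)"
    using orth L2_integrable_mult[OF dM \<Gamma>] L2_integrable_mult[OF dM \<Psi>M] by (simp add: right_diff_distrib mult.commute)
  finally have "sq_norm M d = (\<integral>\<omega>. d \<omega> * (\<Gamma> \<omega> - \<Psi> \<omega>) \<partial>M)" by simp
  then have "sq_norm M d \<le> sq_dist M \<Gamma> \<Psi>"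
    by (rule L2_norm_le[OF dM L2_diff[OF sub_refl \<Gamma> \<Psi>M]])
  then show ?thesis using \<Psi>_le by (simp add: d_def \<Gamma>_def)
qed

text \<open>The steps from \<open>x n\<close> to \<open>x 0\<close> are orthogonal, so their squared
  norms add up to at most \<open>n\<close> times the bound for one block. Dropping the piece
  \<open>[s, s + \<epsilon>]\<close> costs at most the mean of \<open>f (X 0 \<epsilon>)\<close>, by
  the Lipschitz property and because \<open>f\<close> takes values in \<open>[0, 1]\<close>.\<close>

lemma blocks_distance:
  assumes \<delta>: "\<delta> > 0"
  shows "\<exists>z\<in>L2 M (blocks 0). (\<integral>\<omega>. (f (X 0 s \<omega> - b) - z \<omega>)\<^sup>2 \<partial>M) \<le>
    2 * (\<integral>\<omega>. f (X 0 \<epsilon> \<omega>) \<partial>M) + 2 * (real n * (16 * \<delta>\<^sup>2 * h / \<epsilon> + 2 * mean_residual \<epsilon> b \<delta> s h))"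
proof
  define c where "c = 16 * \<delta>\<^sup>2 * h / \<epsilon> + 2 * mean_residual \<epsilon> b \<delta> s h"
  have mono0: "subalgebra (blocks k) (blocks 0)" for k
  proof (induction k)
    case (Suc k)
    then show ?case using blocks_mono[of k] by (auto simp: subalgebra_def)
  qed (simp add: subalgebra_def)
  have "sq_dist M (x k) (x 0) \<le> real k * c" if "k \<le> n" for k
    using that
  proof (induction k)
    case 0
    then show ?case by simp
  next
    case (Suc k)
    let ?d = "\<lambda>\<omega>. x (Suc k) \<omega> - x k \<omega>" and ?y = "\<lambda>\<omega>. x 0 \<omega> - x k \<omega>"
    have y: "?y \<in> L2 M (blocks k)" by (rule L2_diff[OF sub_blocks L2_mono[OF mono0 L2_x] L2_x])
    have d: "?d \<in> L2 M M" by (rule L2_diff[OF sub_refl L2_x_M L2_x_M])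
    have "sq_dist M (x (Suc k)) (x 0) = sq_dist M ?d ?y" by simp
    also have "\<dots> = sq_norm M ?d + sq_norm M ?y"
      using L2_square_expand[OF d L2_subalg[OF sub_blocks y]] step_orthogonal[OF y] by simp
    also have "\<dots> \<le> c + real k * c"
      using block_step[OF _ \<delta>, of k] Suc by (simp add: c_def power2_commute)
    finally show ?case by (simp add: algebra_simps)
  qed
  then have dist: "sq_dist M (x n) (x 0) \<le> real n * c" by simp
  define \<psi> where "\<psi> \<omega> = f (X 0 s \<omega> - b)" for \<omega>
  have "\<psi> \<in> borel_measurable (F 0 s)" unfolding \<psi>_def using X_F[OF s_pos(1)] by measurable
  then have \<psi>F: "\<psi> \<in> L2 M (F 0 s)"
    by (rule L2_bounded[OF F_sub[OF s_pos(1)], of _ 1]) (simp add: \<psi>_def f_range)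
  have \<psi>: "\<psi> \<in> L2 M (blocks n)" using L2_mono[OF blocks_left[of n]] \<psi>F h by simp
  have \<psi>M: "\<psi> \<in> L2 M M" by (rule L2_subalg[OF sub_blocks \<psi>])
  \<comment> \<open>\<open>e\<close> is the conditional expectation of
    \<open>target - \<psi>\<close> given \<open>blocks n\<close>, since \<open>\<psi>\<close> is
    already measurable there; hence it is not longer than \<open>target - \<psi>\<close>.\<close>
  define e where "e \<omega> = x n \<omega> - \<psi> \<omega>" for \<omega>
  have e: "e \<in> L2 M (blocks n)" unfolding e_def by (rule L2_diff[OF sub_blocks L2_x \<psi>])
  have eM: "e \<in> L2 M M" by (rule L2_subalg[OF sub_blocks e])
  have i: "integrable M (\<lambda>\<omega>. x n \<omega> * e \<omega>)" "integrable M (\<lambda>\<omega>. \<psi> \<omega> * e \<omega>)" "integrable M (\<lambda>\<omega>. target \<omega> * e \<omega>)"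
    by (rule L2_integrable_mult[OF L2_x_M eM], rule L2_integrable_mult[OF \<psi>M eM],
        rule L2_integrable_mult[OF target_L2 eM])
  have "(e \<omega>)\<^sup>2 = x n \<omega> * e \<omega> - \<psi> \<omega> * e \<omega>" for \<omega>
    by (simp add: e_def power2_eq_square algebra_simps)
  then have "sq_norm M e = L2_inner M (x n) e - L2_inner M \<psi> e"
    using i by simp
  also have "\<dots> = (\<integral>\<omega>. e \<omega> * (target \<omega> - \<psi> \<omega>) \<partial>M)"
    using inner_x[OF e] i by (simp add: right_diff_distrib mult.commute)
  finally have "sq_norm M e \<le> sq_dist M target \<psi>"
    by (rule L2_norm_le[OF eM L2_diff[OF sub_refl target_L2 \<psi>M]])
  also have "\<dots> \<le> (\<integral>\<omega>. f (X s (s + \<epsilon>) \<omega>) \<partial>M)"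
  proof (rule integral_mono_AE)
    show "integrable M (\<lambda>\<omega>. (target \<omega> - \<psi> \<omega>)\<^sup>2)" by (rule L2_square[OF L2_diff[OF sub_refl target_L2 \<psi>M]])
    have [measurable]: "X s (s + \<epsilon>) \<in> M \<rightarrow>\<^sub>M borel" using eps by (intro X_M) simp
    show "integrable M (\<lambda>\<omega>. f (X s (s + \<epsilon>) \<omega>))"
      by (rule integrable_const_bound[where B=1]) (auto simp: f_range)
    have "AE \<omega> in M. X 0 (s + \<epsilon>) \<omega> = X 0 s \<omega> + X s (s + \<epsilon>) \<omega>" using X_add[of 0 s "s + \<epsilon>"] s_pos eps by simp
    then show "AE \<omega> in M. (target \<omega> - \<psi> \<omega>)\<^sup>2 \<le> f (X s (s + \<epsilon>) \<omega>)"
    proof eventually_elim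
      case (elim \<omega>)
      have "\<bar>target \<omega> - \<psi> \<omega>\<bar> \<le> f (X s (s + \<epsilon>) \<omega>)"
        using f_lipschitz[of "X 0 (s + \<epsilon>) \<omega> - b" "X 0 s \<omega> - b"] elim by (simp add: target_def \<psi>_def)
      then have "\<bar>target \<omega> - \<psi> \<omega>\<bar>\<^sup>2 \<le> (f (X s (s + \<epsilon>) \<omega>))\<^sup>2" by (rule power_mono) simp
      also have "\<dots> \<le> f (X s (s + \<epsilon>) \<omega>)"
        using f_range by (simp add: power2_eq_square mult_left_le_one_le)
      finally show ?case by simp
    qed
  qed
  also have "\<dots> = (\<integral>\<omega>. f (X 0 \<epsilon> \<omega>) \<partial>M)"
  proof -
    have [measurable]: "X s (s + \<epsilon>) \<in> M \<rightarrow>\<^sub>M borel" "X 0 \<epsilon> \<in> M \<rightarrow>\<^sub>M borel" using eps by (auto intro!: X_M)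
    have "(\<integral>\<omega>. f (X s (s + \<epsilon>) \<omega>) \<partial>M) = (\<integral>y. f y \<partial>distr M borel (X s (s + \<epsilon>)))"
      by (rule integral_distr[symmetric]) measurable
    also have "\<dots> = (\<integral>y. f y \<partial>distr M borel (X 0 \<epsilon>))"
      using eps distr_X[of s "s + \<epsilon>"] distr_X[of 0 \<epsilon>] by simp
    also have "\<dots> = (\<integral>\<omega>. f (X 0 \<epsilon> \<omega>) \<partial>M)" by (rule integral_distr) measurable
    finally show ?thesis .
  qed
  finally have e_le: "sq_dist M \<psi> (x n) \<le> (\<integral>\<omega>. f (X 0 \<epsilon> \<omega>) \<partial>M)" by (simp add: e_def power2_commute)
  show "x 0 \<in> L2 M (blocks 0)" by (rule L2_x)
  have "sq_dist M \<psi> (x 0) \<le> 2 * sq_dist M \<psi> (x n) + 2 * sq_dist M (x n) (x 0)"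
    by (rule L2_triangle_le[OF \<psi>M L2_x_M L2_x_M])
  also have "\<dots> \<le> 2 * (\<integral>\<omega>. f (X 0 \<epsilon> \<omega>) \<partial>M) + 2 * (real n * c)" using e_le dist by simp
  finally show "(\<integral>\<omega>. (f (X 0 s \<omega> - b) - x 0 \<omega>)\<^sup>2 \<partial>M) \<le>
    2 * (\<integral>\<omega>. f (X 0 \<epsilon> \<omega>) \<partial>M) + 2 * (real n * (16 * \<delta>\<^sup>2 * h / \<epsilon> + 2 * mean_residual \<epsilon> b \<delta> s h))"
    by (simp add: \<psi>_def c_def)
qed

text \<open>Members of \<open>F 0 0\<close> are independent of themselves, so they have probability
  \<open>0\<close> or \<open>1\<close> and lie in any field that contains the null sets. The
  functional of a block is almost everywhere a difference of functionals starting at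
  \<open>0\<close>.\<close>

lemma blocks_0_least:
  assumes "space N = space M" "null_sets M \<subseteq> sets N" "subalgebra M N"
    and Y: "\<And>i r. 0 \<le> r \<Longrightarrow> r \<le> s \<Longrightarrow> Y \<epsilon> (a i) 0 r \<in> borel_measurable N"
  shows "subalgebra N (blocks 0)"
  unfolding blocks_def
proof (rule join_least[OF F_sub H_M])
  show "subalgebra N (F 0 (real 0 * h))"
  proof -
    have "A \<in> sets N" if A: "A \<in> sets (F 0 0)" for A
    proof -
      have Ae: "A \<in> events" "A \<subseteq> space M" using A F_sub[of 0 0] sets.sets_into_space by (auto simp: subalgebra_def)
      have "prob (A \<inter> A) = prob A * prob A" by (rule indep_setD[OF F_indep[of 0 0 0] A A]) auto
      then have "prob A = 0 \<or> prob A = 1" by simp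
      then show ?thesis
      proof
        assume "prob A = 0"
        then have "A \<in> null_sets M" using Ae by (auto simp: null_sets_def emeasure_eq_measure)
        then show ?thesis using assms(2) by auto
      next
        assume "prob A = 1"
        then have "space M - A \<in> null_sets M"
          using Ae prob_compl[OF Ae(1)] by (auto simp: null_sets_def emeasure_eq_measure)
        then have "space N - (space M - A) \<in> sets N" using assms(2) by (intro sets.compl_sets) auto
        moreover have "space N - (space M - A) = A" using assms(1) Ae by auto
        ultimately show ?thesis by simp
      qed
    qed
    then show ?thesis using assms(1) F_space[of 0 0] by (auto simp: subalgebra_def)
  qed
  show "subalgebra N (H 0)"
  proof (rule H_least[OF assms(1)])
    fix i j assume j: "j < n"
    have js: "real (Suc j) * h \<le> s" "real j * h \<le> s"
      using grid(3)[of "Suc j" n] grid(3)[of j n] j h by auto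
    have "AE \<omega> in M. Y \<epsilon> (a i) 0 (real (Suc j) * h) \<omega>
        = Y \<epsilon> (a i) 0 (real j * h) \<omega> + Y \<epsilon> (a i) (real j * h) (real (Suc j) * h) \<omega>"
      by (rule Y_add[OF eps grid(1,2)])
    then have ae: "AE \<omega> in M. Y \<epsilon> (a i) 0 (real (Suc j) * h) \<omega> - Y \<epsilon> (a i) 0 (real j * h) \<omega>
        = Y \<epsilon> (a i) (real j * h) (real (Suc j) * h) \<omega>" by eventually_elim simp
    show "Y \<epsilon> (a i) (real j * h) (real (Suc j) * h) \<in> borel_measurable N"
      by (rule measurable_AE_cong_complete[OF complete assms(3,2) _ ae])
        (use js grid in \<open>auto intro!: borel_measurable_diff Y simp del: of_nat_Suc\<close>)
  qed
qed (rule grid)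

end

text \<open>For one \<open>\<epsilon>\<close> an error of the order of the mean of
  \<open>f (X 0 \<epsilon>)\<close> remains, so a sequence of values \<open>\<epsilon>\<close>
  tending to \<open>0\<close> enters. The choices are made in the order \<open>\<epsilon>\<close>,
  rounding accuracy, number of blocks. The limit of the approximants is measurable for
  \<open>N\<close> and agrees with the function up to a null set.\<close>

lemma f_X_measurable:
  assumes s: "s > 0" and N: "subalgebra M N" "null_sets M \<subseteq> sets N"
    and Y: "\<And>l i r. 0 \<le> r \<Longrightarrow> r \<le> s \<Longrightarrow> Y (1 / real (Suc l)) (a i) 0 r \<in> borel_measurable N"
  shows "(\<lambda>\<omega>. f (X 0 s \<omega> - b)) \<in> borel_measurable N"
proof -
  have sp: "space N = space M" using N by (simp add: subalgebra_def)
  define \<psi> where "\<psi> \<omega> = f (X 0 s \<omega> - b)" for \<omega>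
  have \<psi>m: "\<psi> \<in> borel_measurable M" unfolding \<psi>_def using X_M[OF less_imp_le[OF s]] by measurable
  have \<psi>: "\<psi> \<in> L2 M M"
    by (rule L2_bounded[OF sub_refl \<psi>m, of 1]) (simp add: \<psi>_def f_range)
  have approx: "\<exists>z\<in>L2 M N. sq_dist M \<psi> z \<le> e" if e: "e > 0" for e :: real
  proof -
    have "filterlim (\<lambda>l. 1 / real (Suc l)) (at_right 0) sequentially"
      unfolding filterlim_at by (intro conjI LIMSEQ_Suc[OF lim_1_over_n]) simp
    from filterlim_compose[OF mean_f_tendsto this]
    have "(\<lambda>l. \<integral>\<omega>. f (X 0 (1 / real (Suc l)) \<omega>) \<partial>M) \<longlonglongrightarrow> 0" .
    then have "\<forall>\<^sub>F l in sequentially. (\<integral>\<omega>. f (X 0 (1 / real (Suc l)) \<omega>) \<partial>M) < e / 4"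
      using e by (intro order_tendstoD) auto
    then obtain l where l: "(\<integral>\<omega>. f (X 0 (1 / real (Suc l)) \<omega>) \<partial>M) < e / 4"
      by (auto simp: eventually_sequentially)
    define \<epsilon> where "\<epsilon> = 1 / real (Suc l)"
    have eps: "\<epsilon> > 0" by (simp add: \<epsilon>_def)
    \<comment> \<open>This makes the total rounding error
      \<open>16 * \<delta>\<^sup>2 * s / \<epsilon>\<close> equal to \<open>e / 8\<close>. The
      budget is \<open>2 * (e / 4) + 2 * (e / 8 + 2 * (e / 16)) = e\<close>.\<close>
    define \<delta> where "\<delta> = sqrt (e * \<epsilon> / (128 * s))"
    have \<delta>: "\<delta> > 0" "\<delta>\<^sup>2 = e * \<epsilon> / (128 * s)" using e eps s by (auto simp: \<delta>_def)
    have "\<forall>\<^sub>F n in sequentially. real n * mean_residual \<epsilon> b \<delta> s (s / real n) < e / 16"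
      using e by (intro order_tendstoD(2)[OF mean_residual_tendsto[OF eps s]]) auto
    moreover have "\<forall>\<^sub>F n in sequentially. s / real n < \<epsilon>"
      using eps by (intro order_tendstoD(2)[OF lim_const_over_n]) auto
    moreover have "\<forall>\<^sub>F n in sequentially. n > 0" by (rule eventually_gt_at_top)
    ultimately have "\<forall>\<^sub>F n in sequentially. real n * mean_residual \<epsilon> b \<delta> s (s / real n) < e / 16 \<and> s / real n < \<epsilon> \<and> n > 0"
      by eventually_elim simp
    then obtain n where n: "real n * mean_residual \<epsilon> b \<delta> s (s / real n) < e / 16" "s / real n < \<epsilon>" "n > 0"
      by (auto simp: eventually_sequentially)
    define h where "h = s / real n"
    have h: "0 < h" "h \<le> \<epsilon>" "s = real n * h" using n s by (auto simp: h_def)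
    obtain z where z: "z \<in> L2 M (blocks \<epsilon> h n 0)"
      and z_le: "sq_dist M \<psi> z \<le>
        2 * (\<integral>\<omega>. f (X 0 \<epsilon> \<omega>) \<partial>M) + 2 * (real n * (16 * \<delta>\<^sup>2 * h / \<epsilon> + 2 * mean_residual \<epsilon> b \<delta> s h))"
      using blocks_distance[OF eps n(3) h \<delta>(1), of b] unfolding \<psi>_def by blast
    have "real n * (16 * \<delta>\<^sup>2 * h / \<epsilon>) = 16 * \<delta>\<^sup>2 * s / \<epsilon>" using h by simp
    also have "\<dots> = e / 8" using s eps by (simp add: \<delta>(2))
    finally have "real n * (16 * \<delta>\<^sup>2 * h / \<epsilon>) = e / 8" .
    moreover have "real n * (p + 2 * q) = real n * p + 2 * (real n * q)" for p q :: real
      by (simp add: algebra_simps)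
    ultimately have "real n * (16 * \<delta>\<^sup>2 * h / \<epsilon> + 2 * mean_residual \<epsilon> b \<delta> s h)
        = e / 8 + 2 * (real n * mean_residual \<epsilon> b \<delta> s h)" by (simp only:)
    moreover have "D = e / 8 + 2 * C \<Longrightarrow> A < e / 4 \<Longrightarrow> C < e / 16 \<Longrightarrow> 2 * A + 2 * D \<le> e" for A C D :: real
      by linarith
    ultimately have "2 * (\<integral>\<omega>. f (X 0 \<epsilon> \<omega>) \<partial>M) + 2 * (real n * (16 * \<delta>\<^sup>2 * h / \<epsilon> + 2 * mean_residual \<epsilon> b \<delta> s h)) \<le> e"
      using l[folded \<epsilon>_def] n(1)[folded h_def] by blast
    then have "sq_dist M \<psi> z \<le> e" using z_le by (rule_tac order_trans)
    moreover have "z \<in> L2 M N"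
      by (rule L2_mono[OF blocks_0_least[OF eps n(3) h sp N(2,1)] z]) (unfold \<epsilon>_def, rule Y)
    ultimately show ?thesis by blast
  qed
  have "\<exists>z. \<forall>m. z m \<in> L2 M N \<and> (sq_dist M \<psi> (z m)) \<le> (1 / 2) ^ m"
    using approx[of "(1 / 2) ^ m" for m] by (intro choice allI) auto
  then obtain z where z: "\<And>m. z m \<in> L2 M N" "\<And>m. sq_dist M \<psi> (z m) \<le> (1 / 2) ^ m" by blast
  have zM: "z m \<in> L2 M M" for m by (rule L2_subalg[OF N(1) z(1)])
  have "\<exists>Z\<in>L2 M N. (\<lambda>m. \<integral>\<omega>. (z m \<omega> - Z \<omega>)\<^sup>2 \<partial>M) \<longlonglongrightarrow> 0"
  proof (rule L2_complete[OF N(1) z(1)])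
    fix e :: real assume "e > 0"
    then obtain k where k: "(1 / 2) ^ k < e / 4" using real_arch_pow_inv[of "e / 4" "1 / 2"] by auto
    have zk: "sq_dist M \<psi> (z m) < e / 4" if "m \<ge> k" for m
    proof -
      have "(1 / 2 :: real) ^ m \<le> (1 / 2) ^ k" using that by (intro power_decreasing) auto
      then show ?thesis using z(2)[of m] k by linarith
    qed
    have "sq_dist M (z m) (z m') < e" if "m \<ge> k" "m' \<ge> k" for m m'
      using L2_triangle_le[OF zM \<psi> zM, of m m'] zk[OF that(1)] zk[OF that(2)] by (simp add: power2_commute)
    then show "\<exists>k. \<forall>m\<ge>k. \<forall>m'\<ge>k. sq_dist M (z m) (z m') < e" by blast
  qed
  then obtain Z where Z: "Z \<in> L2 M N" "(\<lambda>m. \<integral>\<omega>. (z m \<omega> - Z \<omega>)\<^sup>2 \<partial>M) \<longlonglongrightarrow> 0" by blast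
  have half: "(\<lambda>m. (1 / 2 :: real) ^ m) \<longlonglongrightarrow> 0" by (rule LIMSEQ_realpow_zero) auto
  have "(\<lambda>m. \<integral>\<omega>. (z m \<omega> - \<psi> \<omega>)\<^sup>2 \<partial>M) \<longlonglongrightarrow> 0"
    by (rule tendsto_sandwich[OF _ _ tendsto_const half]) (use z(2) in \<open>auto simp: power2_commute\<close>)
  then have "AE \<omega> in M. Z \<omega> = \<psi> \<omega>"
    by (rule L2_limit_unique[OF zM L2_subalg[OF N(1) Z(1)] \<psi> Z(2)])
  then show ?thesis
    using measurable_AE_cong_complete[OF complete N L2_measurable[OF Z(1)]] unfolding \<psi>_def by simp
qed

text \<open>By density of \<open>a\<close> the sets where \<open>f (x - a i)\<close> is below a
  rational form a countable basis, so the real functions \<open>f (X 0 s - a i)\<close> decide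
  measurability into the group. At \<open>s = 0\<close> additivity forces \<open>X 0 0\<close> to
  vanish almost everywhere.\<close>

lemma X_measurable:
  assumes s: "s \<ge> 0" and N: "subalgebra M N" "null_sets M \<subseteq> sets N"
    and Y: "\<And>l i r. 0 \<le> r \<Longrightarrow> r \<le> s \<Longrightarrow> Y (1 / real (Suc l)) (a i) 0 r \<in> borel_measurable N"
  shows "X 0 s \<in> N \<rightarrow>\<^sub>M borel"
proof (cases "s = 0")
  case True
  have "AE \<omega> in M. X 0 0 \<omega> = X 0 0 \<omega> + X 0 0 \<omega>" by (rule X_add) auto
  then have ae: "AE \<omega> in M. 0 = X 0 0 \<omega>" by eventually_elim simp
  show ?thesis unfolding True
    by (rule measurable_AE_cong_complete[OF complete N _ ae]) auto
next
  case False
  then have s: "s > 0" using s by simp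
  have sp: "space N = space M" using N by (simp add: subalgebra_def)
  define S where "S = {{x. f (x - a i) < r} | i r. r \<in> \<rat>}"
  have cS: "countable S"
  proof -
    have "S = (\<lambda>(i, r). {x. f (x - a i) < r}) ` (UNIV \<times> \<rat>)" by (auto simp: S_def)
    then show ?thesis by (simp add: countable_rat)
  qed
  have shift_open: "open {x. f (x - c) < r}" for c r
  proof -
    have "continuous_on UNIV (\<lambda>x. f (x + - c))"
      by (rule continuous_on_compose2[OF f_continuous]) (auto intro!: continuous_intros)
    then have "open ((\<lambda>x. f (x - c)) -` {..<r})" by (simp add: continuous_on_open_vimage)
    moreover have "(\<lambda>x. f (x - c)) -` {..<r} = {x. f (x - c) < r}" by auto
    ultimately show ?thesis by simp
  qed
  have basis: "topological_basis S"
  proof (rule topological_basisI)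
    show "open B" if "B \<in> S" for B using that shift_open by (auto simp: S_def)
    fix U :: "'g set" and x assume U: "open U" "x \<in> U"
    have "open ((\<lambda>y. x + y) -` U)"
      using U(1) by (intro open_vimage) (auto intro!: continuous_intros)
    then obtain r where r: "r > 0" "{y. f y < r} \<subseteq> (\<lambda>y. x + y) -` U"
      using f_basis[of "(\<lambda>y. x + y) -` U"] U(2) by auto
    \<comment> \<open>With a radius below \<open>r / 2\<close> the ball around \<open>a i\<close>
      stays within the \<open>r\<close>-ball around \<open>x\<close>, by the triangle inequality
      that follows from the Lipschitz property and the symmetry of \<open>f\<close>.\<close>
    obtain q where q: "q \<in> \<rat>" "0 < q" "q < r / 2" using Rats_dense_in_real[of 0 "r / 2"] r by auto
    obtain i where i: "f (x - a i) < q" using dense[OF q(2)] by blast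
    have "{z. f (z - a i) < q} \<subseteq> U"
    proof
      fix z assume z: "z \<in> {z. f (z - a i) < q}"
      have "\<bar>f (z - a i) - f (x - z + (z - a i)) \<bar> \<le> f (z - a i - (x - z + (z - a i)))" by (rule f_lipschitz)
      have "f (z - x) \<le> f (z - a i) + f (x - a i)"
      proof -
        have "\<bar>f (z - x) - f (a i - x)\<bar> \<le> f (z - x - (a i - x))" by (rule f_lipschitz)
        moreover have "f (a i - x) = f (x - a i)" using f_minus[of "x - a i"] by simp
        ultimately show ?thesis by simp
      qed
      then have "f (z - x) < r" using z i q by simp
      then have "x + (z - x) \<in> U" using r(2) by auto
      then show "z \<in> U" by simp
    qed
    then show "\<exists>B'\<in>S. x \<in> B' \<and> B' \<subseteq> U" using i q(1) by (intro bexI[of _ "{z. f (z - a i) < q}"]) (auto simp: S_def)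
  qed
  have eq: "borel = sigma UNIV S"
    by (rule borel_eq_countable_basis[OF cS basis])
  show ?thesis unfolding eq
  proof (rule measurable_measure_of)
    fix B assume "B \<in> S"
    then obtain i r where B: "B = {x. f (x - a i) < r}" by (auto simp: S_def)
    have [measurable]: "(\<lambda>\<omega>. f (X 0 s \<omega> - a i)) \<in> borel_measurable N" by (rule f_X_measurable[OF s N Y])
    have "{\<omega> \<in> space N. f (X 0 s \<omega> - a i) < r} \<in> sets N" by measurable
    moreover have "X 0 s -` B \<inter> space N = {\<omega> \<in> space N. f (X 0 s \<omega> - a i) < r}" by (auto simp: B)
    ultimately show "X 0 s -` B \<inter> space N \<in> sets N" by simp
  qed auto
qed

end

section \<open>Representations in the Hilbert space\<close>

instance separable_hilbert \<subseteq> banach ..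

text \<open>Gram-Schmidt by recursion: finitely many chosen vectors do not span the space, and a
  vector outside their span has a nonzero remainder after its projection is subtracted.\<close>

lemma ex_orthonormal_sequence:
  assumes inf: "\<nexists>B :: 'h::real_inner set. finite B \<and> span B = UNIV"
  shows "\<exists>e :: nat \<Rightarrow> 'h. \<forall>i j. e i \<bullet> e j = (if i = j then 1 else 0)"
proof -
  define P where "P f n r \<longleftrightarrow> r \<bullet> r = 1 \<and> (\<forall>m<n. f m \<bullet> r = 0)" for f :: "nat \<Rightarrow> 'h" and n r
  have "\<exists>e. \<forall>n. P e n (e n)"
  proof (rule dependent_wf_choice[of "less_than"])
    show "wf less_than" by simp
    show "P f n r = P g n r" if "\<And>m. (m, n) \<in> less_than \<Longrightarrow> f m = g m" for f g n r
      using that by (auto simp: P_def)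
    fix n f assume f: "\<And>m. (m, n) \<in> less_than \<Longrightarrow> P f m (f m)"
    have orth: "f i \<bullet> f j = (if i = j then 1 else 0)" if "i < n" "j < n" for i j
      using f[of i] f[of j] that by (cases i j rule: linorder_cases) (auto simp: P_def inner_commute)
    have "span (f ` {..<n}) \<noteq> UNIV" using inf by blast
    then obtain v where v: "v \<notin> span (f ` {..<n})" by blast
    define w where "w = v - (\<Sum>m<n. (f m \<bullet> v) *\<^sub>R f m)"
    have "w \<noteq> 0"
    proof
      assume "w = 0"
      then have "v = (\<Sum>m<n. (f m \<bullet> v) *\<^sub>R f m)" by (simp add: w_def)
      also have "\<dots> \<in> span (f ` {..<n})" by (intro span_sum span_scale span_base) auto
      finally show False using v by simp
    qed
    have w: "f m \<bullet> w = 0" if "m < n" for m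
    proof -
      have "(\<Sum>k<n. (f k \<bullet> v) * (f m \<bullet> f k)) = (\<Sum>k<n. if k = m then f m \<bullet> v else 0)"
        by (intro sum.cong) (auto simp: orth that)
      then show ?thesis using that by (simp add: w_def inner_diff_right inner_sum_right)
    qed
    have "P f n ((1 / norm w) *\<^sub>R w)"
      using w \<open>w \<noteq> 0\<close> by (auto simp: P_def power2_norm_eq_inner[symmetric] power2_eq_square)
    then show "\<exists>r. P f n r" ..
  qed
  then obtain e where e: "\<And>n. P e n (e n)" by blast
  have "e i \<bullet> e j = (if i = j then 1 else 0)" for i j
    using e[of i] e[of j] by (cases i j rule: linorder_cases) (auto simp: P_def inner_commute)
  then show ?thesis by blast
qed

context noise_space
begin

text \<open>Disjoint increments are independent and centred, and stationarity makes the variance a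
  function of the length, which is therefore additive and monotone. In the last bound the factor
  \<open>2\<close> pays for rounding \<open>1 / t\<close> down to an integer.\<close>

lemma additive_variance:
  assumes Y: "additive_functional Y"
  defines "V \<equiv> \<lambda>t. \<integral>\<omega>. (Y 0 t \<omega>)\<^sup>2 \<partial>M"
  shows "s \<le> t \<Longrightarrow> sq_norm M (Y s t) = V (t - s)"
    and "0 \<le> s \<Longrightarrow> 0 \<le> t \<Longrightarrow> V (s + t) = V s + V t"
    and "0 \<le> t \<Longrightarrow> V (real n * t) = real n * V t"
    and "0 \<le> s \<Longrightarrow> s \<le> t \<Longrightarrow> V s \<le> V t"
    and "0 < t \<Longrightarrow> t \<le> 1 \<Longrightarrow> V t \<le> 2 * t * V 1"
proof -
  have YM: "Y s t \<in> L2 M M" if "s \<le> t" for s t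
    by (rule L2_F[OF additive_functional_L2[OF Y that] that])
  have [measurable]: "Y s t \<in> borel_measurable M" if "s \<le> t" for s t
    by (rule L2_measurable[OF YM[OF that]])
  show 1: "sq_norm M (Y s t) = V (t - s)" if "s \<le> t" for s t
  proof -
    have m: "(\<lambda>\<omega>. (Y 0 (t - s) \<omega>)\<^sup>2) \<in> borel_measurable M" "(\<lambda>\<omega>. (Y s t \<omega>)\<^sup>2) \<in> borel_measurable M"
      using L2_measurable[OF YM[of 0 "t - s"]] L2_measurable[OF YM[of s t]] that by auto
    have "AE \<omega> in M. Y 0 (t - s) (T s \<omega>) = Y s t \<omega>"
      using additive_functional_shift[OF Y, of 0 "t - s" s] that by simp
    then have "sq_norm M (Y s t) = (\<integral>\<omega>. (Y 0 (t - s) (T s \<omega>))\<^sup>2 \<partial>M)"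
      using m by (intro integral_cong_AE) (auto elim: eventually_mono measurable_compose[OF T_measurable])
    also have "\<dots> = V (t - s)" unfolding V_def by (rule T_integral[OF m(1)])
    finally show ?thesis .
  qed
  show 2: "V (s + t) = V s + V t" if st: "0 \<le> s" "0 \<le> t" for s t
  proof -
    have o: "s \<le> s + t" "0 \<le> s + t" using st by auto
    have "sq_norm M (Y 0 (s + t)) = (\<integral>\<omega>. (Y 0 s \<omega> - (-1) * Y s (s + t) \<omega>)\<^sup>2 \<partial>M)"
      using additive_functional_add[OF Y st(1) o(1)] L2_measurable[OF YM[OF st(1)]] L2_measurable[OF YM[OF o(1)]]
        L2_measurable[OF YM[OF o(2)]]
      by (intro integral_cong_AE) (auto elim: eventually_mono)
    also have "\<dots> = V s - 2 * (\<integral>\<omega>. Y 0 s \<omega> * ((-1) * Y s (s + t) \<omega>) \<partial>M) + (\<integral>\<omega>. ((-1) * Y s (s + t) \<omega>)\<^sup>2 \<partial>M)"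
      unfolding V_def by (rule L2_square_expand[OF YM[OF st(1)] L2_cmult[OF YM[OF o(1)]]])
    also have "(\<integral>\<omega>. Y 0 s \<omega> * ((-1) * Y s (s + t) \<omega>) \<partial>M) = 0"
      using F_inner_indep[OF additive_functional_L2[OF Y st(1)] additive_functional_L2[OF Y o(1)] st(1) order_refl o(1)]
        additive_functional_mean[OF Y st(1)] by simp
    also have "(\<integral>\<omega>. ((-1) * Y s (s + t) \<omega>)\<^sup>2 \<partial>M) = V t" using 1[OF o(1)] by simp
    finally show ?thesis by (simp add: V_def)
  qed
  have V0: "V 0 = 0" using 2[of 0 0] by simp
  show 3: "V (real n * t) = real n * V t" if "0 \<le> t" for n t
  proof (induction n)
    case (Suc n)
    have "V (real n * t + t) = V (real n * t) + V t" using that by (intro 2) auto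
    then show ?case using Suc by (simp add: algebra_simps)
  qed (simp add: V0)
  have Vpos: "0 \<le> V t" for t by (simp add: V_def)
  show 4: "V s \<le> V t" if "0 \<le> s" "s \<le> t" for s t
    using 2[of s "t - s"] that Vpos[of "t - s"] by simp
  show "V t \<le> 2 * t * V 1" if t: "0 < t" "t \<le> 1" for t
  proof -
    \<comment> \<open>\<open>n\<close> steps of length \<open>t\<close> fit into
      \<open>[0, 1]\<close>, and \<open>n \<ge> 1\<close> gives
      \<open>2 * t * n \<ge> 1\<close>.\<close>
    define n where "n = nat \<lfloor>1 / t\<rfloor>"
    have n: "real n \<le> 1 / t" "1 / t < real n + 1" "1 \<le> real n"
      using t unfolding n_def by (auto simp: le_floor_iff)
    have "real n * t \<le> 1" using n(1) t by (simp add: pos_le_divide_eq)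
    then have "real n * V t \<le> V 1" using 3[of t n] 4[of "real n * t" 1] t by simp
    have "1 \<le> 2 * t * real n"
    proof -
      have "1 < (real n + 1) * t" using n(2) t by (simp add: pos_divide_less_eq)
      also have "\<dots> \<le> (2 * real n) * t" using n(3) t by (intro mult_right_mono) auto
      finally show ?thesis by (simp add: mult_ac)
    qed
    then have "1 * V t \<le> 2 * t * real n * V t" by (rule mult_right_mono[OF _ Vpos])
    also have "\<dots> = 2 * t * (real n * V t)" by simp
    also have "\<dots> \<le> 2 * t * V 1" using \<open>real n * V t \<le> V 1\<close> t by (intro mult_left_mono) auto
    finally show ?thesis by simp
  qed
qed

end

section \<open>The Hilbert space valued process with given functionals as coordinates\<close>

locale functional_sequence = noise_space M T F
  for M :: "'w measure" and T F +
  fixes y :: "nat \<Rightarrow> real \<Rightarrow> real \<Rightarrow> 'w \<Rightarrow> real" and e :: "nat \<Rightarrow> 'h::separable_hilbert"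
  assumes y: "continuous_functional (y i)"
    and e: "e i \<bullet> e j = (if i = j then 1 else 0)"
begin

lemma y_additive: "additive_functional (y i)"
  using y by (simp add: continuous_functional_def)

definition v :: "nat \<Rightarrow> real" where
  "v i = sq_norm M (y i 0 1)"

text \<open>The divisor \<open>1 + v i\<close> removes the dependence on the size of
  \<open>y i\<close>, including the case \<open>v i = 0\<close>. In Chebyshev's inequality
  \<open>(1/8)^i\<close> is squared and divided by the square of a threshold of order
  \<open>2^(-i)\<close>, which leaves the summable \<open>(1/16)^i\<close>.\<close>

definition c :: "nat \<Rightarrow> real" where
  "c i = (1 / 8) ^ i / (1 + v i)"

lemma v_nonneg: "0 \<le> v i" by (simp add: v_def)

lemma c_pos: "0 < c i" using v_nonneg[of i] by (simp add: c_def)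

lemma norm_e: "norm (e i) = 1" by (simp add: norm_eq_sqrt_inner e)

lemma y_M: "s \<le> t \<Longrightarrow> y i s t \<in> borel_measurable M"
  by (rule L2_measurable[OF L2_F[OF additive_functional_L2[OF y_additive]]])

text \<open>\<open>lim\<close> has a value also where the series diverges. So \<open>Z s t\<close>
  is measurable for \<open>F s t\<close> as it stands, and at each sample point it is determined by
  the coordinates.\<close>

definition Z :: "real \<Rightarrow> real \<Rightarrow> 'w \<Rightarrow> 'h" where
  "Z s t \<omega> = lim (\<lambda>n. \<Sum>i<n. (c i * y i s t \<omega>) *\<^sub>R e i)"

lemma Z_F: "s \<le> t \<Longrightarrow> Z s t \<in> F s t \<rightarrow>\<^sub>M borel"
  unfolding Z_def
  by (intro borel_measurable_lim_metric borel_measurable_sum borel_measurable_scaleR borel_measurable_times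
      borel_measurable_const L2_measurable[OF additive_functional_L2[OF y_additive]])

lemma Z_M: "s \<le> t \<Longrightarrow> Z s t \<in> M \<rightarrow>\<^sub>M borel"
  by (rule measurable_from_subalg[OF F_sub Z_F])

lemma second_moment_le:
  assumes "s \<le> t"
  shows "sq_norm M (y i s t) \<le> real (nat \<lceil>t - s\<rceil>) * v i"
proof -
  note V = additive_variance[OF y_additive[of i]]
  have "sq_norm M (y i s t) = sq_norm M (y i 0 (t - s))" by (rule V(1)[OF assms])
  also have "\<dots> \<le> sq_norm M (y i 0 (real (nat \<lceil>t - s\<rceil>) * 1))"
    using assms by (intro V(4)) (auto intro: real_nat_ceiling_ge)
  also have "\<dots> = real (nat \<lceil>t - s\<rceil>) * v i" unfolding v_def by (rule V(3)) simp
  finally show ?thesis .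
qed

text \<open>The mean of \<open>\<bar>y i s t\<bar>\<close> is at most \<open>1\<close> plus the
  second moment, hence at most a multiple of \<open>1 + v i\<close>, which \<open>c i\<close>
  cancels. A series of nonnegative functions with summable means converges almost
  everywhere.\<close>

lemma AE_summable:
  assumes st: "s \<le> t"
  shows "AE \<omega> in M. summable (\<lambda>i. c i * \<bar>y i s t \<omega>\<bar>)"
proof -
  define K where "K = 1 + real (nat \<lceil>t - s\<rceil>)"
  have K: "K \<ge> 1" by (simp add: K_def)
  have yL: "y i s t \<in> L2 M M" for i by (rule L2_F[OF additive_functional_L2[OF y_additive st] st])
  have [measurable]: "y i s t \<in> borel_measurable M" for i by (rule y_M[OF st])
  have le: "(\<integral>\<^sup>+\<omega>. ennreal (c i * \<bar>y i s t \<omega>\<bar>) \<partial>M) \<le> ennreal (K * (1 / 8) ^ i)" for i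
  proof -
    have int: "integrable M (\<lambda>\<omega>. \<bar>y i s t \<omega>\<bar>)"
      using L2_integrable[OF finite_measure_axioms yL] by simp
    have "(\<integral>\<omega>. \<bar>y i s t \<omega>\<bar> \<partial>M) \<le> (\<integral>\<omega>. 1 + (y i s t \<omega>)\<^sup>2 \<partial>M)"
    proof (rule integral_mono[OF int])
      show "integrable M (\<lambda>\<omega>. 1 + (y i s t \<omega>)\<^sup>2)" using L2_square[OF yL] by simp
      show "\<bar>y i s t \<omega>\<bar> \<le> 1 + (y i s t \<omega>)\<^sup>2" for \<omega>
        using sum_squares_ge_zero[of "\<bar>y i s t \<omega>\<bar> - 1" "y i s t \<omega>"]
        by (simp add: power2_eq_square algebra_simps)
    qed
    also have "\<dots> = 1 + sq_norm M (y i s t)" using L2_square[OF yL] by (simp add: prob_space)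
    also have "\<dots> \<le> 1 + real (nat \<lceil>t - s\<rceil>) * v i" using second_moment_le[OF st] by simp
    also have "\<dots> \<le> K * (1 + v i)" using v_nonneg[of i] by (simp add: K_def algebra_simps)
    finally have "c i * (\<integral>\<omega>. \<bar>y i s t \<omega>\<bar> \<partial>M) \<le> c i * (K * (1 + v i))"
      using c_pos[of i] by (intro mult_left_mono) auto
    also have "\<dots> = K * (1 / 8) ^ i" using v_nonneg[of i] by (simp add: c_def)
    finally have "(\<integral>\<omega>. c i * \<bar>y i s t \<omega>\<bar> \<partial>M) \<le> K * (1 / 8) ^ i" by simp
    then show ?thesis
      using int c_pos[of i] by (subst nn_integral_eq_integral) (auto intro: ennreal_leI)
  qed
  have sm: "summable (\<lambda>i. K * (1 / 8 :: real) ^ i)" by (intro summable_mult summable_geometric) simp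
  have "(\<integral>\<^sup>+\<omega>. (\<Sum>i. ennreal (c i * \<bar>y i s t \<omega>\<bar>)) \<partial>M) = (\<Sum>i. \<integral>\<^sup>+\<omega>. ennreal (c i * \<bar>y i s t \<omega>\<bar>) \<partial>M)"
    by (rule nn_integral_suminf) measurable
  also have "\<dots> \<le> (\<Sum>i. ennreal (K * (1 / 8) ^ i))" by (intro suminf_le le) auto
  also have "\<dots> = ennreal (\<Sum>i. K * (1 / 8) ^ i)" using K by (intro suminf_ennreal2[OF _ sm]) simp
  finally have "(\<integral>\<^sup>+\<omega>. (\<Sum>i. ennreal (c i * \<bar>y i s t \<omega>\<bar>)) \<partial>M) \<noteq> \<infinity>"
    by (auto simp: top_unique)
  then have "AE \<omega> in M. (\<Sum>i. ennreal (c i * \<bar>y i s t \<omega>\<bar>)) \<noteq> \<infinity>"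
    by (intro nn_integral_noteq_infinite) auto
  then show ?thesis
  proof eventually_elim
    case (elim \<omega>)
    show ?case by (rule summable_suminf_not_top) (use elim in \<open>auto simp: less_imp_le[OF c_pos]\<close>)
  qed
qed

lemma AE_Z:
  assumes "s \<le> t"
  shows "AE \<omega> in M. (\<lambda>n. \<Sum>i<n. (c i * y i s t \<omega>) *\<^sub>R e i) \<longlonglongrightarrow> Z s t \<omega>"
  using AE_summable[OF assms]
proof eventually_elim
  case (elim \<omega>)
  have "summable (\<lambda>i. norm ((c i * y i s t \<omega>) *\<^sub>R e i))"
    using elim c_pos by (simp add: norm_e abs_mult less_imp_le)
  then have "summable (\<lambda>i. (c i * y i s t \<omega>) *\<^sub>R e i)" by (rule summable_norm_cancel)
  then have "convergent (\<lambda>n. \<Sum>i<n. (c i * y i s t \<omega>) *\<^sub>R e i)" by (simp add: summable_iff_convergent)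
  then show ?case unfolding Z_def by (simp add: convergent_LIMSEQ_iff)
qed

text \<open>Orthonormality lets the functionals be read off from \<open>Z\<close>; the faithfulness
  of \<open>Z\<close> rests on this.\<close>

lemma AE_Z_inner:
  assumes "s \<le> t"
  shows "AE \<omega> in M. Z s t \<omega> \<bullet> e j = c j * y j s t \<omega>"
  using AE_Z[OF assms]
proof eventually_elim
  case (elim \<omega>)
  have "(\<lambda>n. (\<Sum>i<n. (c i * y i s t \<omega>) *\<^sub>R e i) \<bullet> e j) \<longlonglongrightarrow> Z s t \<omega> \<bullet> e j"
    by (intro tendsto_inner elim tendsto_const)
  moreover have "(\<lambda>n. (\<Sum>i<n. (c i * y i s t \<omega>) *\<^sub>R e i) \<bullet> e j) \<longlonglongrightarrow> c j * y j s t \<omega>"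
  proof (rule tendsto_eventually)
    have "(\<Sum>i<n. (c i * y i s t \<omega>) *\<^sub>R e i) \<bullet> e j = c j * y j s t \<omega>" if "j < n" for n
    proof -
      have "(\<Sum>i<n. (c i * y i s t \<omega>) *\<^sub>R e i) \<bullet> e j = (\<Sum>i<n. if i = j then c j * y j s t \<omega> else 0)"
        unfolding inner_sum_left by (intro sum.cong) (auto simp: e)
      then show ?thesis using that by simp
    qed
    then show "\<forall>\<^sub>F n in sequentially. (\<Sum>i<n. (c i * y i s t \<omega>) *\<^sub>R e i) \<bullet> e j = c j * y j s t \<omega>"
      by (rule eventually_mono[OF eventually_gt_at_top[of j]])
  qed
  ultimately show ?case by (rule LIMSEQ_unique)
qed

lemma Z_shift:
  assumes "s \<le> t"
  shows "AE \<omega> in M. Z s t (T r \<omega>) = Z (s + r) (t + r) \<omega>"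
proof -
  have "AE \<omega> in M. \<forall>i. y i s t (T r \<omega>) = y i (s + r) (t + r) \<omega>"
    by (subst AE_all_countable) (intro allI additive_functional_shift[OF y_additive assms])
  then show ?thesis by eventually_elim (simp add: Z_def)
qed

lemma Z_add:
  assumes "r \<le> s" "s \<le> t"
  shows "AE \<omega> in M. Z s t \<omega> + Z r s \<omega> = Z r t \<omega>"
proof -
  have rt: "r \<le> t" using assms by simp
  have "AE \<omega> in M. \<forall>i. y i r t \<omega> = y i r s \<omega> + y i s t \<omega>"
    by (subst AE_all_countable) (intro allI additive_functional_add[OF y_additive assms])
  then show ?thesis using AE_Z[OF assms(1)] AE_Z[OF assms(2)] AE_Z[OF rt]
  proof eventually_elim
    case (elim \<omega>)
    have "(\<lambda>n. (\<Sum>i<n. (c i * y i s t \<omega>) *\<^sub>R e i) + (\<Sum>i<n. (c i * y i r s \<omega>) *\<^sub>R e i)) \<longlonglongrightarrow> Z s t \<omega> + Z r s \<omega>"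
      by (intro tendsto_add elim)
    moreover have "(\<Sum>i<n. (c i * y i s t \<omega>) *\<^sub>R e i) + (\<Sum>i<n. (c i * y i r s \<omega>) *\<^sub>R e i)
        = (\<Sum>i<n. (c i * y i r t \<omega>) *\<^sub>R e i)" for n
      using elim(1) by (simp add: sum.distrib[symmetric] distrib_left scaleR_add_left add.commute)
    ultimately have "(\<lambda>n. \<Sum>i<n. (c i * y i r t \<omega>) *\<^sub>R e i) \<longlonglongrightarrow> Z s t \<omega> + Z r s \<omega>" by simp
    then show ?case using elim(4) by (rule LIMSEQ_unique)
  qed
qed

text \<open>The thresholds \<open>\<delta> / 2 ^ (i + 2)\<close> are summable, while \<open>c i\<close> decays fast enough for Chebyshev's
  inequality to bound the \<open>i\<close>-th term by a summable multiple of \<open>t\<close>.\<close>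

lemma Z_continuous_ball:
  assumes \<delta>: "\<delta> > 0"
  shows "((\<lambda>t. 1 / t * prob {\<omega> \<in> space M. \<delta> \<le> norm (Z 0 t \<omega>)}) \<longlongrightarrow> 0) (at_right 0)"
proof -
  define d where "d i = \<delta> / 2 ^ (i + 2)" for i :: nat
  define A where "A t i = {\<omega> \<in> space M. d i / c i < \<bar>y i 0 t \<omega>\<bar>}" for t i
  define B where "B i = 32 / \<delta>\<^sup>2 * (1 / 16 :: real) ^ i" for i :: nat
  have d: "d i > 0" for i using \<delta> by (simp add: d_def)
  have sd: "d sums (\<delta> / 2)"
  proof -
    have "(\<lambda>i. (\<delta> / 4) * (1 / 2) ^ i) sums ((\<delta> / 4) * (1 / (1 - 1 / 2)))"
      by (intro sums_mult geometric_sums) simp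
    moreover have "(\<lambda>i. (\<delta> / 4) * (1 / 2) ^ i) = d" by (rule ext) (simp add: d_def power_one_over)
    ultimately show ?thesis by simp
  qed
  have sB: "summable B" unfolding B_def by (intro summable_mult summable_geometric) simp
  have A: "A t i \<in> events" if "0 \<le> t" for t i using y_M[OF that] unfolding A_def by measurable
  have AB: "1 / t * prob (A t i) \<le> B i" if t: "0 < t" "t \<le> 1" for t i
  proof -
    have t0: "0 \<le> t" using t by simp
    have "prob (A t i) \<le> sq_norm M (y i 0 t) / (d i / c i)\<^sup>2"
      unfolding A_def
      by (rule prob_gt_le_square[OF L2_F[OF additive_functional_L2[OF y_additive t0] t0]]) (use d c_pos in simp)
    also have "\<dots> \<le> (2 * t * v i) / (d i / c i)\<^sup>2"
      using additive_variance(5)[OF y_additive[of i] t] by (intro divide_right_mono) (auto simp: v_def)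
    also have "\<dots> = t * (2 * (v i / (1 + v i)\<^sup>2) * ((1 / 8) ^ i)\<^sup>2 / (d i)\<^sup>2)"
    proof -
      have "(c i)\<^sup>2 = ((1 / 8) ^ i)\<^sup>2 / (1 + v i)\<^sup>2" by (simp only: c_def power_divide)
      moreover have "(2 * t * v i) / (d i / c i)\<^sup>2 = 2 * t * v i * (c i)\<^sup>2 / (d i)\<^sup>2" by (simp add: power_divide)
      moreover have "2 * t * V * (P / Q) / D = t * (2 * (V / Q) * P / D)" for V P Q D :: real by simp
      ultimately show ?thesis by (simp only:)
    qed
    also have "\<dots> \<le> t * (2 * 1 * ((1 / 8) ^ i)\<^sup>2 / (d i)\<^sup>2)"
    proof -
      have "v i \<le> (1 + v i)\<^sup>2" using v_nonneg[of i] by (simp add: power2_eq_square algebra_simps)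
      then have "v i / (1 + v i)\<^sup>2 \<le> 1" using v_nonneg[of i] by (simp add: pos_divide_le_eq)
      then show ?thesis using t0 by (intro mult_left_mono divide_right_mono mult_right_mono) auto
    qed
    also have "2 * 1 * ((1 / 8) ^ i)\<^sup>2 / (d i)\<^sup>2 = B i"
    proof -
      have "(d i)\<^sup>2 = \<delta>\<^sup>2 / (16 * 4 ^ i)"
        by (simp add: d_def power_divide power_mult_distrib power_add power2_eq_square power_mult_distrib[symmetric])
      moreover have "((1 / 8 :: real) ^ i)\<^sup>2 = (1 / 64) ^ i" by (simp add: power2_eq_square power_mult_distrib[symmetric])
      moreover have "(1 / 64 :: real) ^ i * 4 ^ i = (1 / 16) ^ i" by (simp add: power_mult_distrib[symmetric])
      moreover have "2 * 1 * P / (E / (16 * Q)) = 32 / E * (P * Q)" for P E Q :: real by simp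
      ultimately show ?thesis unfolding B_def by (simp only:)
    qed
    finally have "prob (A t i) \<le> t * B i" .
    then show ?thesis using t by (simp add: pos_divide_le_eq mult.commute)
  qed
  have lim: "((\<lambda>t. 1 / t * prob (A t i)) \<longlongrightarrow> 0) (at_right 0)" for i
    using y[of i] d[of i] c_pos[of i] unfolding continuous_functional_def A_def by simp
  have ev: "\<forall>\<^sub>F t::real in at_right 0. 0 < t \<and> t < 1"
    using eventually_at_right_real[of 0 1] by simp
  have "\<forall>\<^sub>F p in ((at_top :: nat filter) \<times>\<^sub>F at_right (0::real)). True \<and> (0 < snd p \<and> snd p < 1)"
    using eventually_prodI[OF always_eventually[of "\<lambda>_::nat. True"] ev] by simp
  then have bnd: "\<forall>\<^sub>F (i, t) in (at_top \<times>\<^sub>F at_right 0). norm (1 / t * prob (A t i)) \<le> B i"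
    by eventually_elim (use AB in \<open>auto simp: split_beta\<close>)
  \<comment> \<open>Tannery's theorem: each term tends to \<open>0\<close> by continuity of
    \<open>y i\<close>, and the summable bound \<open>B i\<close> is uniform in
    \<open>t\<close>.\<close>
  have tan: "((\<lambda>t. \<Sum>i. 1 / t * prob (A t i)) \<longlongrightarrow> (\<Sum>i. 0)) (at_right 0)"
    using tannerys_theorem[OF lim bnd sB] by simp
  show ?thesis
  proof (rule tendsto_sandwich[OF _ _ tendsto_const])
    show "((\<lambda>t. \<Sum>i. 1 / t * prob (A t i)) \<longlongrightarrow> 0) (at_right 0)" using tan by simp
    show "\<forall>\<^sub>F t in at_right 0. 0 \<le> 1 / t * prob {\<omega> \<in> space M. \<delta> \<le> norm (Z 0 t \<omega>)}"
      using ev by eventually_elim simp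
    show "\<forall>\<^sub>F t in at_right 0. 1 / t * prob {\<omega> \<in> space M. \<delta> \<le> norm (Z 0 t \<omega>)} \<le> (\<Sum>i. 1 / t * prob (A t i))"
      using ev
    proof eventually_elim
      case (elim t)
      then have t: "0 < t" "t \<le> 1" "0 \<le> t" by auto
      have [measurable]: "Z 0 t \<in> M \<rightarrow>\<^sub>M borel" by (rule Z_M[OF t(3)])
      have s1: "summable (\<lambda>i. 1 / t * prob (A t i))"
        by (rule summable_comparison_test'[OF sB, of 0]) (use AB[OF t(1,2)] t in simp)
      then have s2: "summable (\<lambda>i. prob (A t i))"
        using summable_mult[OF s1, of t] t by simp
      \<comment> \<open>Outside all events \<open>A t i\<close> every partial sum has norm at most
        the sum \<open>\<delta> / 2\<close> of the thresholds, so the limit cannot reach norm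
        \<open>\<delta>\<close>.\<close>
      have "prob {\<omega> \<in> space M. \<delta> \<le> norm (Z 0 t \<omega>)} \<le> prob (\<Union>i. A t i)"
      proof (rule finite_measure_mono_AE)
        show "AE \<omega> in M. \<omega> \<in> {\<omega> \<in> space M. \<delta> \<le> norm (Z 0 t \<omega>)} \<longrightarrow> \<omega> \<in> (\<Union>i. A t i)"
          using AE_Z[OF t(3)] AE_space
        proof eventually_elim
          case (elim \<omega>)
          show ?case
          proof (rule impI, rule ccontr)
            assume big: "\<omega> \<in> {\<omega> \<in> space M. \<delta> \<le> norm (Z 0 t \<omega>)}" and "\<omega> \<notin> (\<Union>i. A t i)"
            then have small: "c i * \<bar>y i 0 t \<omega>\<bar> \<le> d i" for i
            proof -
              have "\<omega> \<notin> A t i" using \<open>\<omega> \<notin> (\<Union>i. A t i)\<close> by blast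
              then have "\<bar>y i 0 t \<omega>\<bar> \<le> d i / c i" using elim(2) by (simp add: A_def not_less)
              then show ?thesis using c_pos[of i] by (simp add: pos_le_divide_eq mult.commute)
            qed
            have "norm (\<Sum>i<n. (c i * y i 0 t \<omega>) *\<^sub>R e i) \<le> \<delta> / 2" for n
            proof -
              have "norm (\<Sum>i<n. (c i * y i 0 t \<omega>) *\<^sub>R e i) \<le> (\<Sum>i<n. norm ((c i * y i 0 t \<omega>) *\<^sub>R e i))"
                by (rule norm_sum)
              also have "\<dots> \<le> (\<Sum>i<n. d i)"
                using small c_pos by (intro sum_mono) (simp add: norm_e abs_mult less_imp_le)
              also have "\<dots> \<le> (\<Sum>i. d i)" using d sd by (intro sum_le_suminf) (auto simp: sums_iff less_imp_le)
              finally show ?thesis using sd by (simp add: sums_iff)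
            qed
            then have "norm (Z 0 t \<omega>) \<le> \<delta> / 2"
              by (intro LIMSEQ_le_const2[OF tendsto_norm[OF elim(1)]]) auto
            then show False using big \<delta> by simp
          qed
        qed
        show "(\<Union>i. A t i) \<in> events" using A[OF t(3)] by auto
      qed
      also have "\<dots> \<le> (\<Sum>i. prob (A t i))"
        using A[OF t(3)] s2 by (intro finite_measure_subadditive_countably) auto
      finally have "1 / t * prob {\<omega> \<in> space M. \<delta> \<le> norm (Z 0 t \<omega>)} \<le> 1 / t * (\<Sum>i. prob (A t i))"
        using t by (intro mult_left_mono) auto
      also have "\<dots> = (\<Sum>i. 1 / t * prob (A t i))" by (rule suminf_mult[OF s2, symmetric])
      finally show ?case .
    qed
  qed
qed

lemma Z_continuous:
  assumes U: "open U" "0 \<in> U"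
  shows "((\<lambda>t. 1 / t * prob {\<omega> \<in> space M. Z 0 t \<omega> \<notin> U}) \<longlongrightarrow> 0) (at_right 0)"
proof -
  obtain \<delta> where \<delta>: "\<delta> > 0" "ball 0 \<delta> \<subseteq> U" using U by (rule openE)
  have ev: "\<forall>\<^sub>F t::real in at_right 0. 0 < t \<and> t < 1"
    using eventually_at_right_real[of 0 1] by simp
  show ?thesis
  proof (rule tendsto_sandwich[OF _ _ tendsto_const Z_continuous_ball[OF \<delta>(1)]])
    show "\<forall>\<^sub>F t in at_right 0. 0 \<le> 1 / t * prob {\<omega> \<in> space M. Z 0 t \<omega> \<notin> U}"
      using ev by eventually_elim simp
    show "\<forall>\<^sub>F t in at_right 0. 1 / t * prob {\<omega> \<in> space M. Z 0 t \<omega> \<notin> U} \<le> 1 / t * prob {\<omega> \<in> space M. \<delta> \<le> norm (Z 0 t \<omega>)}"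
      using ev
    proof eventually_elim
      case (elim t)
      have [measurable]: "Z 0 t \<in> M \<rightarrow>\<^sub>M borel" by (rule Z_M) (use elim in simp)
      have "{\<omega> \<in> space M. Z 0 t \<omega> \<notin> U} \<subseteq> {\<omega> \<in> space M. \<delta> \<le> norm (Z 0 t \<omega>)}"
        using \<delta>(2) by (auto simp: subset_iff dist_norm not_less[symmetric])
      then have "prob {\<omega> \<in> space M. Z 0 t \<omega> \<notin> U} \<le> prob {\<omega> \<in> space M. \<delta> \<le> norm (Z 0 t \<omega>)}"
        by (rule finite_measure_mono) measurable
      then show ?case using elim by (intro mult_left_mono) auto
    qed
  qed
qed

lemma Z_tendsto_1:
  assumes U: "open U" "0 \<in> U"
  shows "((\<lambda>t. prob {\<omega> \<in> space M. Z 0 t \<omega> \<in> U}) \<longlongrightarrow> 1) (at_right 0)"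
proof -
  have "((\<lambda>t. 1 - t * (1 / t * prob {\<omega> \<in> space M. Z 0 t \<omega> \<notin> U})) \<longlongrightarrow> 1 - 0 * 0) (at_right 0)"
    by (intro tendsto_diff tendsto_mult tendsto_const Z_continuous[OF U] tendsto_ident_at)
  then have lim: "((\<lambda>t. 1 - t * (1 / t * prob {\<omega> \<in> space M. Z 0 t \<omega> \<notin> U})) \<longlongrightarrow> 1) (at_right 0)" by simp
  have ev: "\<forall>\<^sub>F t::real in at_right 0. 0 < t \<and> t < 1"
    using eventually_at_right_real[of 0 1] by simp
  then have "\<forall>\<^sub>F t in at_right 0. 1 - t * (1 / t * prob {\<omega> \<in> space M. Z 0 t \<omega> \<notin> U}) = prob {\<omega> \<in> space M. Z 0 t \<omega> \<in> U}"
  proof eventually_elim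
    case (elim t)
    have [measurable]: "Z 0 t \<in> M \<rightarrow>\<^sub>M borel" by (rule Z_M) (use elim in simp)
    have [measurable]: "U \<in> sets borel" using U by simp
    have "{\<omega> \<in> space M. Z 0 t \<omega> \<notin> U} = space M - {\<omega> \<in> space M. Z 0 t \<omega> \<in> U}" by auto
    moreover have "{\<omega> \<in> space M. Z 0 t \<omega> \<in> U} \<in> events" by measurable
    ultimately show ?case using elim by (simp add: prob_compl)
  qed
  then show ?thesis by (rule tendsto_cong[THEN iffD1]) (rule lim)
qed

lemma continuous_representation_Z: "continuous_representation M T F Z"
  unfolding continuous_representation_def representation_def
  by (intro conjI allI impI Z_shift Z_F Z_add Z_tendsto_1 Z_continuous)

text \<open>The hypothesis puts generation in the form of minimality. It is applied to the field
  generated by \<open>Z\<close> and the null sets, for which the functionals are measurable because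
  they are coordinates of \<open>Z\<close> almost everywhere.\<close>

lemma faithful_representation_Z:
  assumes gen: "\<And>t N. 0 \<le> t \<Longrightarrow> subalgebra M N \<Longrightarrow> null_sets M \<subseteq> sets N \<Longrightarrow>
      (\<And>i r. 0 \<le> r \<Longrightarrow> r \<le> t \<Longrightarrow> y i 0 r \<in> borel_measurable N) \<Longrightarrow> sets (F 0 t) \<subseteq> sets N"
  shows "faithful_representation M T F Z"
  unfolding faithful_representation_def
proof (intro conjI allI impI)
  show "representation M T F Z"
    using continuous_representation_Z by (simp add: continuous_representation_def)
  fix t :: real assume t: "0 \<le> t"
  define G where "G = {Z 0 s -` B \<inter> space M | s B. s \<in> {0..t} \<and> B \<in> sets borel}"
  define N where "N = sigma (space M) (G \<union> null_sets M)"
  have GM: "G \<union> null_sets M \<subseteq> events"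
    using measurable_sets[OF Z_M] by (auto simp: G_def)
  then have Pow: "G \<union> null_sets M \<subseteq> Pow (space M)" using sets.sets_into_space by blast
  have sN: "sets N = sigma_sets (space M) (G \<union> null_sets M)" "space N = space M"
    using Pow by (simp_all add: N_def)
  have N: "subalgebra M N" using sets.sigma_sets_subset[OF GM] sN by (simp add: subalgebra_def)
  have nN: "null_sets M \<subseteq> sets N" unfolding sN(1) by (auto intro: sigma_sets.Basic)
  have ZN: "Z 0 r \<in> N \<rightarrow>\<^sub>M borel" if "0 \<le> r" "r \<le> t" for r
    by (rule measurableI) (use that in \<open>auto simp: sN G_def intro!: sigma_sets.Basic\<close>)
  have "y i 0 r \<in> borel_measurable N" if r: "0 \<le> r" "r \<le> t" for i r
  proof (rule measurable_AE_cong_complete[OF complete N nN])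
    show "(\<lambda>\<omega>. (Z 0 r \<omega> \<bullet> e i) / c i) \<in> borel_measurable N"
      by (intro borel_measurable_divide borel_measurable_inner ZN r borel_measurable_const)
    show "AE \<omega> in M. (Z 0 r \<omega> \<bullet> e i) / c i = y i 0 r \<omega>"
      using AE_Z_inner[OF r(1), of i] by eventually_elim (use c_pos[of i] in simp)
  qed simp
  then have "sets (F 0 t) \<subseteq> sets N" by (rule gen[OF t N nN])
  moreover have "sets N \<subseteq> sets (F 0 t)"
  proof -
    have "G \<subseteq> sets (F 0 t)"
    proof
      fix E assume "E \<in> G"
      then obtain s B where E: "E = Z 0 s -` B \<inter> space M" "0 \<le> s" "s \<le> t" "B \<in> sets borel" by (auto simp: G_def)
      have "Z 0 s \<in> F 0 t \<rightarrow>\<^sub>M borel"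
        by (rule measurable_from_subalg[OF F_mono Z_F]) (use E in auto)
      from measurable_sets[OF this E(4)] show "E \<in> sets (F 0 t)" using E F_space[OF t] by simp
    qed
    then have "sigma_sets (space (F 0 t)) (G \<union> null_sets M) \<subseteq> sets (F 0 t)"
      using F_null[OF t] by (intro sets.sigma_sets_subset) auto
    then show ?thesis using sN F_space[OF t] by simp
  qed
  ultimately show "sets (F 0 t) = generated_field M {Z 0 s -` B \<inter> space M | s B. s \<in> {0..t} \<and> B \<in> sets borel}"
    unfolding generated_field_def G_def[symmetric] sN(1)[symmetric] by (rule equalityI)
qed

end

theorem theorem1p8:
  assumes "\<nexists>B :: 'h::separable_hilbert set. finite B \<and> span B = UNIV"
  shows "brown_subordinate TYPE('w) TYPE('g::{polish_group, topological_ab_group_add}) TYPE('h)"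
  unfolding brown_subordinate_def
proof (intro allI impI)
  fix M :: "'w measure" and T F
  assume noise: "noise M T F"
    and "\<exists>X :: real \<Rightarrow> real \<Rightarrow> 'w \<Rightarrow> 'g. continuous_representation M T F X \<and> faithful_representation M T F X"
  then obtain X :: "real \<Rightarrow> real \<Rightarrow> 'w \<Rightarrow> 'g"
    where X: "continuous_representation M T F X" "faithful_representation M T F X" by (elim exE conjE)
  obtain f :: "'g \<Rightarrow> real" where f: "\<And>x. 0 \<le> f x \<and> f x \<le> 1" "f 0 = 0" "\<And>x. f (- x) = f x"
    "\<And>x y. \<bar>f x - f y\<bar> \<le> f (x - y)" "continuous_on UNIV f"
    "\<And>U. open U \<Longrightarrow> 0 \<in> U \<Longrightarrow> \<exists>r>0. {x. f x < r} \<subseteq> U"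
    using ex_bounded_group_norm[where 'g='g] by blast
  have rep: "commutative_representation M T F X f"
    by unfold_locales (use noise X f in auto)
  obtain D :: "'g set" where D: "countable D" "closure D = UNIV"
    using separable[where 'a='g] by (auto simp: separable_space_def)
  have D0: "D \<noteq> {}" using D(2) by auto
  define a where "a = from_nat_into D"
  have dense: "\<exists>i. f (x - a i) < \<delta>" if "\<delta> > 0" for x \<delta>
  proof -
    have "continuous_on UNIV (\<lambda>z. f (x + - z))"
      by (rule continuous_on_compose2[OF f(5)]) (auto intro!: continuous_intros)
    then have op: "open ((\<lambda>z. f (x + - z)) -` {..<\<delta>})" by (simp add: continuous_on_open_vimage)
    have "x \<in> (\<lambda>z. f (x + - z)) -` {..<\<delta>}" using that f(2) by simp
    then have "(\<lambda>z. f (x + - z)) -` {..<\<delta>} \<inter> D \<noteq> {}"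
      using open_Int_closure_eq_empty[OF op, of D] D(2) by blast
    then obtain z where "z \<in> D" "f (x + - z) < \<delta>" by blast
    moreover obtain i where "a i = z"
      using from_nat_into_surj[OF D(1) \<open>z \<in> D\<close>] by (auto simp: a_def)
    ultimately show ?thesis by auto
  qed
  interpret R: dense_commutative_representation M T F X f a
    by (intro dense_commutative_representation.intro rep dense_commutative_representation_axioms.intro dense)
  obtain e :: "nat \<Rightarrow> 'h" where e: "\<And>i j. e i \<bullet> e j = (if i = j then 1 else 0)"
    using ex_orthonormal_sequence[OF assms] by blast
  \<comment> \<open>The pairing function runs through all combinations of a scale
    \<open>1 / (l + 1)\<close> and a shift \<open>a i\<close>, so that one sequence contains every
    functional from which \<open>X\<close> is recovered.\<close>
  define y where "y k = R.Y (1 / real (Suc (fst (prod_decode k)))) (a (snd (prod_decode k)))" for k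
  interpret S: functional_sequence M T F y e
    by unfold_locales (auto simp: y_def e simp del: of_nat_Suc intro!: R.continuous_Y)
  have "faithful_representation M T F S.Z"
  proof (rule S.faithful_representation_Z)
    fix t N assume t: "0 \<le> t" and N: "subalgebra M N" "null_sets M \<subseteq> sets N"
      and yN: "\<And>i r. 0 \<le> r \<Longrightarrow> r \<le> t \<Longrightarrow> y i 0 r \<in> borel_measurable N"
    have YN: "R.Y (1 / real (Suc l)) (a i) 0 r \<in> borel_measurable N" if "0 \<le> r" "r \<le> t" for l i r
      using yN[OF that, of "prod_encode (l, i)"] by (simp add: y_def)
    have XN: "X 0 s \<in> N \<rightarrow>\<^sub>M borel" if "s \<in> {0..t}" for s
      by (rule R.X_measurable[OF _ N YN]) (use that in auto)
    have sp: "space N = space M" using N by (simp add: subalgebra_def)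
    have "sets (F 0 t) = generated_field M {X 0 s -` B \<inter> space M | s B. s \<in> {0..t} \<and> B \<in> sets borel}"
      using X(2) t by (simp add: faithful_representation_def)
    also have "\<dots> \<subseteq> sets N"
    proof -
      have "{X 0 s -` B \<inter> space M | s B. s \<in> {0..t} \<and> B \<in> sets borel} \<union> null_sets M \<subseteq> sets N"
        using N(2) measurable_sets[OF XN] sp by auto
      then show ?thesis unfolding generated_field_def sp[symmetric] by (rule sets.sigma_sets_subset)
    qed
    finally show "sets (F 0 t) \<subseteq> sets N" .
  qed
  with S.continuous_representation_Z
  show "\<exists>Y :: real \<Rightarrow> real \<Rightarrow> 'w \<Rightarrow> 'h. continuous_representation M T F Y \<and> faithful_representation M T F Y"
    by (intro exI conjI)
qed

end
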